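(* Let $\beta=\sum_i\beta^ie_i\colon O^2\to\mathfrak{g}^2$ be a smooth $\mathfrak{g}$-equivariant function with $\beta(0,0)=0$, and let $\beta_t(x,y)=t^{-1}\beta(tx,ty)$. Then the equation $$\frac{\partial m_t}{\partial t}=-m_t\circ\sum_i\beta_t^iL_i\qquad (t\in[0,1])$$ holds if and only if $$\frac{\partial M_t}{\partial t}=-M_t\circ[\mathrm{d},\iota(\beta_t)]\qquad (t\in[0,1]),$$ where $\iota(\beta_t)=\sum_i\beta_t^i\otimes\iota(e_i)$; since $M_t$ is a chain map, the latter equation may also be written $\frac{\partial M_t}{\partial t}=-\big[\mathrm{d},M_t\circ\sum_i\beta_t^i\otimes\iota(e_i)\big]$.
   Context: $\mathfrak{g}$ is a finite-dimensional real Lie algebra, $G$ the connected simply connected Lie group with Lie algebra $\mathfrak{g}$, $J(x)=\det_{\mathfrak{g}}\big(\frac{1-e^{-\mathrm{ad}_x}}{\mathrm{ad}_x}\big)$ the Jacobian of $\exp\colon\mathfrak{g}\to G$. $U\subset\mathfrak{g}$ is a star-shaped open neighborhood of $0$ over which $\exp$ is a diffeomorphism onto its image (so $J>0$ on $U$ and $J^{1/2}$ is well defined there), and $O\subset U$ is a star-shaped open neighborhood of $0$ with $\exp(x)\exp(y)\in\exp(U)$ for $x,y\in O$. Put $\Phi(x,y)=\log(\exp(x)\exp(y))$ and $\kappa(x,y)=\frac{J^{1/2}(x)J^{1/2}(y)}{J^{1/2}(\Phi(x,y))}$ on $O^2=O\times O$. For $t\in(0,1]$ put $\Phi_t(x,y)=t^{-1}\Phi(tx,ty)$,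 $\kappa_t(x,y)=\kappa(tx,ty)$, and $\Phi_0(x,y)=x+y$, $\kappa_0=1$. $\mathcal{D}'_{\mathrm{comp}}$ denotes compactly supported distributions, and $m_t=(\Phi_t)_*\circ\kappa_t\colon\mathcal{D}'_{\mathrm{comp}}(O^2)\to\mathcal{D}'_{\mathrm{comp}}(\mathfrak{g})$ (multiplication by $\kappa_t$ followed by push-forward). $\mathfrak{g}^2=\mathfrak{g}\oplus\mathfrak{g}$ acts on $O^2$ infinitesimally by the adjoint action, via the Lie algebra homomorphism to vector fields $\xi=(\xi_1,\xi_2)\mapsto X^\xi$, $X^\xi(x,y)=([x,\xi_1],[y,\xi_2])$; $e_i$ is a basis of $\mathfrak{g}^2$, and $L_i=L(e_i)$ is the corresponding Lie derivative, acting on distributions by $\langle L_iu,f\rangle=-\langle u,X^{e_i}f\rangle$. $\beta_t$ is extended smoothly to $t=0$. $\mathfrak{g}$-equivariance of $\beta$ is with respect to the diagonal adjoint actions of $\mathfrak{g}$ on $O^2$ and $\mathfrak{g}^2$ (infinitesimally). For a module $\mathcal{M}$ over a finite-dimensional Lie algebra $\mathfrak{h}$, $C^\bullet(\mathfrak{h},\mathcal{M})=\mathcal{M}\otimes\wedge^\bullet\mathfrak{h}^*$ is the Chevalley-Eilenberg complex with its usual differential $\mathrm{d}$. $\psi\colon\mathfrak{g}\to\mathfrak{g}^2$ is the diagonal embedding and $\psi^*\colon\wedge(\mathfrak{g}^2)^*=\wedge\mathfrak{g}^*\otimes\wedge\mathfrak{g}^*\to\wedge\mathfrak{g}^*$ the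 induced map (the product in the exterior algebra). With $\mathcal{D}'_{\mathrm{comp}}(O^2)$ viewed as a $\mathfrak{g}^2$-module and $\mathcal{D}'_{\mathrm{comp}}(\mathfrak{g})$ as a $\mathfrak{g}$-module, $M_t=m_t\otimes\psi^*\colon C(\mathfrak{g}^2,\mathcal{D}'_{\mathrm{comp}}(O^2))\to C(\mathfrak{g},\mathcal{D}'_{\mathrm{comp}}(\mathfrak{g}))$, which is a chain map. $\iota(e_i)$ denotes contraction on $\wedge(\mathfrak{g}^2)^*$, $\beta^i_t$ also denotes the operator of multiplication by the function $\beta_t^i$ on distributions, and $[\cdot,\cdot]$ of operators is the graded commutator (so $[\mathrm{d},h]=\mathrm{d}h+h\mathrm{d}$ for $h$ of degree $-1$). *)

theory Defs
  imports "HOL-Analysis.Analysis" "HOL-Library.Function_Algebras"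
begin

section \<open>Function spaces as real vector spaces\<close>

text \<open>Addition, negation and zero of functions are pointwise
  (\<^theory>\<open>HOL-Library.Function_Algebras\<close>); so is scalar multiplication.  Distributions and
  vector fields on a group are represented as functionals and operators on functions, and this
  instance makes them elements of real vector spaces.\<close>

instantiation "fun" :: (type, scaleR) scaleR
begin
definition scaleR_fun_def: "r *\<^sub>R f = (\<lambda>x. r *\<^sub>R f x)"
instance ..
end

instance "fun" :: (type, real_vector) real_vector
  by standard (auto simp: scaleR_fun_def plus_fun_def fun_eq_iff scaleR_add_left scaleR_add_right)


section \<open>Smooth maps\<close>

text \<open>Iterated directional derivatives; the last vector of the list is applied first.\<close>

primrec iter_deriv ::
    "('a::real_normed_vector \<Rightarrow> 'b::real_normed_vector) \<Rightarrow> 'a list \<Rightarrow> 'a \<Rightarrow> 'b" where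
  "iter_deriv f [] = f"
| "iter_deriv f (v # vs) = (\<lambda>x. frechet_derivative (iter_deriv f vs) (at x) v)"

text \<open>\<open>C\<^sup>\<infinity>\<close> on an open subset \<open>S\<close> of a finite-dimensional space.  The map is a total function;
  only its values on \<open>S\<close> matter.\<close>

definition smooth_on :: "'a::real_normed_vector set \<Rightarrow> ('a \<Rightarrow> 'b::real_normed_vector) \<Rightarrow> bool" where
  "smooth_on S f \<longleftrightarrow> (\<forall>vs. \<forall>x\<in>S. iter_deriv f vs differentiable (at x))"


section \<open>Compactly supported distributions\<close>

text \<open>\<open>\<D>'\<^sub>c\<^sub>o\<^sub>m\<^sub>p(W)\<close> for open \<open>W\<close>, as the dual of the Frechet space \<open>C\<^sup>\<infinity>(W)\<close>: linear functionals
  bounded by finitely many derivatives on a compact subset of \<open>W\<close>.  A functional is fixed to be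
  \<open>0\<close> on functions that are not smooth on \<open>W\<close>, so that equality of distributions is
  equality of functionals.  By the estimate, \<open>u f\<close> depends only on the restriction of \<open>f\<close> to \<open>W\<close>.\<close>

definition comp_distributions :: "'a::euclidean_space set \<Rightarrow> (('a \<Rightarrow> real) \<Rightarrow> real) set" where
  "comp_distributions W = {u.
     (\<forall>f. \<not> smooth_on W f \<longrightarrow> u f = 0) \<and>
     (\<forall>f g a b. smooth_on W f \<and> smooth_on W g \<longrightarrow>
        u (\<lambda>x. a * f x + b * g x) = a * u f + b * u g) \<and>
     (\<exists>K N C. compact K \<and> K \<subseteq> W \<and>
        (\<forall>f r. smooth_on W f \<and> 0 \<le> r \<and>
           (\<forall>x\<in>K. \<forall>vs. set vs \<subseteq> Basis \<and> length vs \<le> N \<longrightarrow> \<bar>iter_deriv f vs x\<bar> \<le> r)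
           \<longrightarrow> \<bar>u f\<bar> \<le> C * r))}"

definition dist_mult ::
    "'a::euclidean_space set \<Rightarrow> ('a \<Rightarrow> real) \<Rightarrow> (('a \<Rightarrow> real) \<Rightarrow> real) \<Rightarrow> ('a \<Rightarrow> real) \<Rightarrow> real" where
  "dist_mult W g u = (\<lambda>f. if smooth_on W f then u (\<lambda>x. g x * f x) else 0)"

text \<open>Push-forward under \<open>F : W \<rightarrow> V\<close>, where \<open>V\<close> is the whole target space.\<close>

definition dist_push ::
    "('a::euclidean_space \<Rightarrow> 'b::euclidean_space) \<Rightarrow> (('a \<Rightarrow> real) \<Rightarrow> real) \<Rightarrow> ('b \<Rightarrow> real) \<Rightarrow> real" where
  "dist_push F u = (\<lambda>f. if smooth_on UNIV f then u (\<lambda>x. f (F x)) else 0)"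

text \<open>Lie derivative along the vector field \<open>X\<close>: \<open>\<langle>L\<^sub>X u, f\<rangle> = - \<langle>u, X f\<rangle>\<close>.\<close>

definition dist_lie ::
    "'a::euclidean_space set \<Rightarrow> ('a \<Rightarrow> 'a) \<Rightarrow> (('a \<Rightarrow> real) \<Rightarrow> real) \<Rightarrow> ('a \<Rightarrow> real) \<Rightarrow> real" where
  "dist_lie W X u = (\<lambda>f. if smooth_on W f
     then - u (\<lambda>p. frechet_derivative f (at p) (X p)) else 0)"

text \<open>Derivative at \<open>t\<close> of a curve of distributions defined on \<open>[0,1]\<close>, tested against every smooth
  function; one-sided at the end points.\<close>

definition has_dist_derivative ::
    "(real \<Rightarrow> ('a::euclidean_space \<Rightarrow> real) \<Rightarrow> real) \<Rightarrow> (('a \<Rightarrow> real) \<Rightarrow> real) \<Rightarrow> real \<Rightarrow> bool" where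
  "has_dist_derivative v w t \<longleftrightarrow>
     (\<forall>f. smooth_on UNIV f \<longrightarrow> ((\<lambda>s. v s f) has_real_derivative w f) (at t within {0..1}))"


section \<open>Lie algebras and Chevalley-Eilenberg complexes\<close>

definition lie_algebra :: "('a::real_vector \<Rightarrow> 'a \<Rightarrow> 'a) \<Rightarrow> bool" where
  "lie_algebra br \<longleftrightarrow> bilinear br \<and> (\<forall>x. br x x = 0) \<and>
     (\<forall>x y z. br x (br y z) + br y (br z x) + br z (br x y) = 0)"

definition br2 :: "('a \<Rightarrow> 'a \<Rightarrow> 'a) \<Rightarrow> 'a \<times> 'a \<Rightarrow> 'a \<times> 'a \<Rightarrow> 'a \<times> 'a" where
  "br2 br p q = (br (fst p) (fst q), br (snd p) (snd q))"

definition diag :: "'a \<Rightarrow> 'a \<times> 'a" where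
  "diag x = (x, x)"

text \<open>\<open>C\<^sup>\<bullet>(\<hh>,\<M>) = \<M> \<otimes> \<and>\<^sup>\<bullet>\<hh>\<^sup>*\<close> for a subspace \<open>M\<close> of an ambient vector space.  An element of the
  direct sum over all degrees is given by its values on lists of arguments, the component of
  degree \<open>k\<close> being the alternating \<open>k\<close>-linear map on lists of length \<open>k\<close>.  As \<open>\<hh>\<close> is
  finite-dimensional, only finitely many components are nonzero.\<close>

definition ce_cochains :: "'m::real_vector set \<Rightarrow> ('h::real_vector list \<Rightarrow> 'm) set" where
  "ce_cochains M = {\<omega>.
     (\<forall>xs. \<omega> xs \<in> M) \<and>
     (\<forall>xs. \<forall>i<length xs. linear (\<lambda>v. \<omega> (xs[i := v]))) \<and>
     (\<forall>xs i j. i < j \<and> j < length xs \<and> xs ! i = xs ! j \<longrightarrow> \<omega> xs = 0)}"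

text \<open>The differential, with \<open>act\<close> the module action; \<open>nths xs (- I)\<close> omits the arguments with
  index in \<open>I\<close>.\<close>

definition ce_d :: "('h \<Rightarrow> 'h \<Rightarrow> 'h) \<Rightarrow> ('h \<Rightarrow> 'm \<Rightarrow> 'm) \<Rightarrow>
    ('h list \<Rightarrow> 'm::real_vector) \<Rightarrow> 'h list \<Rightarrow> 'm" where
  "ce_d br act \<omega> = (\<lambda>xs.
     (\<Sum>i<length xs. (-1) ^ i *\<^sub>R act (xs ! i) (\<omega> (nths xs (- {i})))) +
     (\<Sum>j<length xs. \<Sum>i<j. (-1) ^ (i + j) *\<^sub>R \<omega> (br (xs ! i) (xs ! j) # nths xs (- {i, j}))))"

text \<open>Graded commutator of the differentials with an operator of degree \<open>-1\<close>.\<close>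

definition d_commutator ::
    "('c \<Rightarrow> 'c) \<Rightarrow> ('d \<Rightarrow> 'd::plus) \<Rightarrow> ('c \<Rightarrow> 'd) \<Rightarrow> 'c \<Rightarrow> 'd" where
  "d_commutator dC dD h = (\<lambda>\<omega>. dD (h \<omega>) + h (dC \<omega>))"

text \<open>The action of \<open>\<xi>\<close> on distributions by the Lie derivative along \<open>p \<mapsto> [p,\<xi>]\<close>.\<close>

definition ad_lie :: "('a \<Rightarrow> 'a \<Rightarrow> 'a) \<Rightarrow> 'a::euclidean_space set \<Rightarrow> 'a \<Rightarrow>
    (('a \<Rightarrow> real) \<Rightarrow> real) \<Rightarrow> ('a \<Rightarrow> real) \<Rightarrow> real" where
  "ad_lie br W \<xi> = dist_lie W (\<lambda>p. br p \<xi>)"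

definition ce_d_dist :: "('a \<Rightarrow> 'a \<Rightarrow> 'a) \<Rightarrow> 'a::euclidean_space set \<Rightarrow>
    ('a list \<Rightarrow> ('a \<Rightarrow> real) \<Rightarrow> real) \<Rightarrow> 'a list \<Rightarrow> ('a \<Rightarrow> real) \<Rightarrow> real" where
  "ce_d_dist br W = ce_d br (ad_lie br W)"


section \<open>Lie groups\<close>

text \<open>An atlas is a set of charts \<open>(V, \<phi>)\<close>; it need not be maximal.\<close>

definition smooth_atlas :: "('g::topological_space set \<times> ('g \<Rightarrow> 'v::euclidean_space)) set \<Rightarrow> bool" where
  "smooth_atlas A \<longleftrightarrow>
     (\<forall>(V, \<phi>)\<in>A. open V \<and> open (\<phi> ` V) \<and> homeomorphism V (\<phi> ` V) \<phi> (inv_into V \<phi>)) \<and>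
     (\<Union>(V, \<phi>)\<in>A. V) = UNIV \<and>
     (\<forall>(V, \<phi>)\<in>A. \<forall>(W, \<psi>)\<in>A. smooth_on (\<phi> ` (V \<inter> W)) (\<lambda>a. \<psi> (inv_into V \<phi> a)))"

text \<open>Smoothness on an open set of a map from, respectively into, the manifold.\<close>

definition smooth_from :: "('g::topological_space set \<times> ('g \<Rightarrow> 'v::euclidean_space)) set \<Rightarrow>
    'g set \<Rightarrow> ('g \<Rightarrow> 'b::real_normed_vector) \<Rightarrow> bool" where
  "smooth_from A S f \<longleftrightarrow> (\<forall>(V, \<phi>)\<in>A. smooth_on (\<phi> ` (V \<inter> S)) (\<lambda>a. f (inv_into V \<phi> a)))"

definition smooth_into :: "('g::topological_space set \<times> ('g \<Rightarrow> 'v::euclidean_space)) set \<Rightarrow>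
    'b::real_normed_vector set \<Rightarrow> ('b \<Rightarrow> 'g) \<Rightarrow> bool" where
  "smooth_into A S h \<longleftrightarrow> continuous_on S h \<and>
     (\<forall>(V, \<phi>)\<in>A. smooth_on (S \<inter> h -` V) (\<lambda>a. \<phi> (h a)))"

text \<open>The group is the whole type \<open>'g\<close>, with multiplication \<open>mul\<close>, unit \<open>e\<close> and inversion \<open>iv\<close>;
  smoothness of the operations is expressed in charts of the source.\<close>

definition lie_group ::
    "('g::{t2_space,second_countable_topology} set \<times> ('g \<Rightarrow> 'v::euclidean_space)) set \<Rightarrow>
     ('g \<Rightarrow> 'g \<Rightarrow> 'g) \<Rightarrow> 'g \<Rightarrow> ('g \<Rightarrow> 'g) \<Rightarrow> bool" where
  "lie_group A mul e iv \<longleftrightarrow> group mul e iv \<and> smooth_atlas A \<and>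
     (\<forall>(V, \<phi>)\<in>A. \<forall>(W, \<psi>)\<in>A. smooth_into A ((\<phi> ` V) \<times> (\<psi> ` W))
        (\<lambda>(a, b). mul (inv_into V \<phi> a) (inv_into W \<psi> b))) \<and>
     (\<forall>(V, \<phi>)\<in>A. smooth_into A (\<phi> ` V) (\<lambda>a. iv (inv_into V \<phi> a)))"

text \<open>Left-invariant vector fields, as derivations of \<open>C\<^sup>\<infinity>(G)\<close> commuting with left translations.  They
  are fixed to be \<open>0\<close> on functions that are not smooth.\<close>

definition left_invariant_fields ::
    "('g::topological_space set \<times> ('g \<Rightarrow> 'v::euclidean_space)) set \<Rightarrow> ('g \<Rightarrow> 'g \<Rightarrow> 'g) \<Rightarrow>
     (('g \<Rightarrow> real) \<Rightarrow> 'g \<Rightarrow> real) set" where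
  "left_invariant_fields A mul = {X.
     (\<forall>f. \<not> smooth_from A UNIV f \<longrightarrow> X f = 0) \<and>
     (\<forall>f. smooth_from A UNIV f \<longrightarrow> smooth_from A UNIV (X f)) \<and>
     (\<forall>f h a b. smooth_from A UNIV f \<and> smooth_from A UNIV h \<longrightarrow>
        X (\<lambda>g. a * f g + b * h g) = (\<lambda>g. a * X f g + b * X h g)) \<and>
     (\<forall>f h. smooth_from A UNIV f \<and> smooth_from A UNIV h \<longrightarrow>
        X (\<lambda>g. f g * h g) = (\<lambda>g. X f g * h g + f g * X h g)) \<and>
     (\<forall>f k. smooth_from A UNIV f \<longrightarrow> X (\<lambda>g. f (mul k g)) = (\<lambda>g. X f (mul k g)))}"

text \<open>\<open>lf\<close> is an isomorphism from the Lie algebra with bracket \<open>br\<close> onto the Lie algebra of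
  left-invariant vector fields on the group.\<close>

definition lie_algebra_of_group ::
    "('a::real_vector \<Rightarrow> 'a \<Rightarrow> 'a) \<Rightarrow> ('g::topological_space set \<times> ('g \<Rightarrow> 'v::euclidean_space)) set \<Rightarrow>
     ('g \<Rightarrow> 'g \<Rightarrow> 'g) \<Rightarrow> ('a \<Rightarrow> ('g \<Rightarrow> real) \<Rightarrow> 'g \<Rightarrow> real) \<Rightarrow> bool" where
  "lie_algebra_of_group br A mul lf \<longleftrightarrow>
     linear lf \<and> bij_betw lf UNIV (left_invariant_fields A mul) \<and>
     (\<forall>x y f. smooth_from A UNIV f \<longrightarrow> lf (br x y) f = lf x (lf y f) - lf y (lf x f))"

definition integral_curve :: "('g::topological_space set \<times> ('g \<Rightarrow> 'v::euclidean_space)) set \<Rightarrow>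
    (('g \<Rightarrow> real) \<Rightarrow> 'g \<Rightarrow> real) \<Rightarrow> (real \<Rightarrow> 'g) \<Rightarrow> bool" where
  "integral_curve A X \<gamma> \<longleftrightarrow> continuous_on UNIV \<gamma> \<and>
     (\<forall>f. smooth_from A UNIV f \<longrightarrow>
        (\<forall>t. ((\<lambda>s. f (\<gamma> s)) has_real_derivative X f (\<gamma> t)) (at t)))"

text \<open>\<open>E\<close> is the exponential map: \<open>t \<mapsto> E (t x)\<close> is the integral curve through the unit of the
  left-invariant field of \<open>x\<close>.\<close>

definition lie_exp :: "('g::topological_space set \<times> ('g \<Rightarrow> 'v::euclidean_space)) set \<Rightarrow> 'g \<Rightarrow>
    ('a::real_vector \<Rightarrow> ('g \<Rightarrow> real) \<Rightarrow> 'g \<Rightarrow> real) \<Rightarrow> ('a \<Rightarrow> 'g) \<Rightarrow> bool" where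
  "lie_exp A e lf E \<longleftrightarrow> E 0 = e \<and> (\<forall>x. integral_curve A (lf x) (\<lambda>t. E (t *\<^sub>R x)))"

definition diffeo_onto_image :: "('g::topological_space set \<times> ('g \<Rightarrow> 'v::euclidean_space)) set \<Rightarrow>
    'a::real_normed_vector set \<Rightarrow> ('a \<Rightarrow> 'g) \<Rightarrow> bool" where
  "diffeo_onto_image A U E \<longleftrightarrow> smooth_into A U E \<and> inj_on E U \<and> open (E ` U) \<and>
     smooth_from A (E ` U) (inv_into U E)"

definition star_nbhd_0 :: "'a::real_normed_vector set \<Rightarrow> bool" where
  "star_nbhd_0 S \<longleftrightarrow> open S \<and> 0 \<in> S \<and> (\<forall>x\<in>S. closed_segment 0 x \<subseteq> S)"


section \<open>The maps \<open>\<Phi>\<^sub>t\<close>, \<open>\<kappa>\<^sub>t\<close>, \<open>m\<^sub>t\<close>, \<open>M\<^sub>t\<close>\<close>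

text \<open>\<open>J(x) = det ((1 - e\<^sup>-\<^sup>a\<^sup>d\<^sup>x) / ad\<^sub>x)\<close>, where \<open>(1 - e\<^sup>-\<^sup>z) / z\<close> is the entire function
  \<open>\<Sum>\<^sub>n (-1)\<^sup>n z\<^sup>n / (n+1)!\<close>.\<close>

definition exp_jac :: "(real^'n \<Rightarrow> real^'n \<Rightarrow> real^'n) \<Rightarrow> real^'n \<Rightarrow> real" where
  "exp_jac br x = det (matrix (\<lambda>y. \<Sum>n. ((-1) ^ n / fact (Suc n)) *\<^sub>R (br x ^^ n) y))"

definition Phi :: "('g \<Rightarrow> 'g \<Rightarrow> 'g) \<Rightarrow> ('a \<Rightarrow> 'g) \<Rightarrow> 'a set \<Rightarrow> 'a \<times> 'a \<Rightarrow> 'a" where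
  "Phi mul E U = (\<lambda>(x, y). inv_into U E (mul (E x) (E y)))"

definition kappa :: "(real^'n \<Rightarrow> real^'n \<Rightarrow> real^'n) \<Rightarrow> ('g \<Rightarrow> 'g \<Rightarrow> 'g) \<Rightarrow> (real^'n \<Rightarrow> 'g) \<Rightarrow>
    (real^'n) set \<Rightarrow> (real^'n) \<times> (real^'n) \<Rightarrow> real" where
  "kappa br mul E U = (\<lambda>(x, y). sqrt (exp_jac br x) * sqrt (exp_jac br y)
     / sqrt (exp_jac br (Phi mul E U (x, y))))"

definition Phi_t :: "('g \<Rightarrow> 'g \<Rightarrow> 'g) \<Rightarrow> ('a::real_vector \<Rightarrow> 'g) \<Rightarrow> 'a set \<Rightarrow> real \<Rightarrow> 'a \<times> 'a \<Rightarrow> 'a" where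
  "Phi_t mul E U t = (\<lambda>(x, y). if t = 0 then x + y
     else (1 / t) *\<^sub>R Phi mul E U (t *\<^sub>R x, t *\<^sub>R y))"

definition kappa_t :: "(real^'n \<Rightarrow> real^'n \<Rightarrow> real^'n) \<Rightarrow> ('g \<Rightarrow> 'g \<Rightarrow> 'g) \<Rightarrow> (real^'n \<Rightarrow> 'g) \<Rightarrow>
    (real^'n) set \<Rightarrow> real \<Rightarrow> (real^'n) \<times> (real^'n) \<Rightarrow> real" where
  "kappa_t br mul E U t = (\<lambda>(x, y). if t = 0 then 1
     else kappa br mul E U (t *\<^sub>R x, t *\<^sub>R y))"

definition m_map :: "(real^'n \<Rightarrow> real^'n \<Rightarrow> real^'n) \<Rightarrow> ('g \<Rightarrow> 'g \<Rightarrow> 'g) \<Rightarrow> (real^'n \<Rightarrow> 'g) \<Rightarrow>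
    (real^'n) set \<Rightarrow> (real^'n) set \<Rightarrow> real \<Rightarrow>
    (((real^'n) \<times> (real^'n) \<Rightarrow> real) \<Rightarrow> real) \<Rightarrow> (real^'n \<Rightarrow> real) \<Rightarrow> real" where
  "m_map br mul E U Ob t u =
     dist_push (Phi_t mul E U t) (dist_mult (Ob \<times> Ob) (kappa_t br mul E U t) u)"

definition M_map :: "(real^'n \<Rightarrow> real^'n \<Rightarrow> real^'n) \<Rightarrow> ('g \<Rightarrow> 'g \<Rightarrow> 'g) \<Rightarrow> (real^'n \<Rightarrow> 'g) \<Rightarrow>
    (real^'n) set \<Rightarrow> (real^'n) set \<Rightarrow> real \<Rightarrow>
    (((real^'n) \<times> (real^'n)) list \<Rightarrow> ((real^'n) \<times> (real^'n) \<Rightarrow> real) \<Rightarrow> real) \<Rightarrow>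
    (real^'n) list \<Rightarrow> (real^'n \<Rightarrow> real) \<Rightarrow> real" where
  "M_map br mul E U Ob t \<omega> = (\<lambda>zs. m_map br mul E U Ob t (\<omega> (map diag zs)))"

text \<open>\<open>\<beta>\<^sub>t\<close>, extended to \<open>t = 0\<close> by its limit.\<close>

definition rescale :: "('a::real_normed_vector \<Rightarrow> 'b::real_normed_vector) \<Rightarrow> real \<Rightarrow> 'a \<Rightarrow> 'b" where
  "rescale \<beta> t p = (if t = 0 then Lim (at_right 0) (\<lambda>s. (1 / s) *\<^sub>R \<beta> (s *\<^sub>R p))
     else (1 / t) *\<^sub>R \<beta> (t *\<^sub>R p))"

text \<open>For a function \<open>b\<close> with values in \<open>\<hh>\<close> and a basis \<open>B\<close> of \<open>\<hh>\<close>: the operators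
  \<open>\<Sum>\<^sub>i b\<^sup>i L(e\<^sub>i)\<close> on distributions and \<open>\<iota>(b) = \<Sum>\<^sub>i b\<^sup>i \<otimes> \<iota>(e\<^sub>i)\<close> on distribution-valued cochains.\<close>

definition lie_along :: "('a \<Rightarrow> 'a \<Rightarrow> 'a) \<Rightarrow> 'a::euclidean_space set \<Rightarrow> 'a set \<Rightarrow> ('a \<Rightarrow> 'a) \<Rightarrow>
    (('a \<Rightarrow> real) \<Rightarrow> real) \<Rightarrow> ('a \<Rightarrow> real) \<Rightarrow> real" where
  "lie_along br W B b u =
     (\<Sum>\<xi>\<in>B. dist_mult W (\<lambda>p. representation B (b p) \<xi>) (ad_lie br W \<xi> u))"

definition contraction :: "'a::euclidean_space set \<Rightarrow> 'a set \<Rightarrow> ('a \<Rightarrow> 'a) \<Rightarrow>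
    ('a list \<Rightarrow> ('a \<Rightarrow> real) \<Rightarrow> real) \<Rightarrow> 'a list \<Rightarrow> ('a \<Rightarrow> real) \<Rightarrow> real" where
  "contraction W B b \<omega> =
     (\<lambda>xs. \<Sum>\<xi>\<in>B. dist_mult W (\<lambda>p. representation B (b p) \<xi>) (\<omega> (\<xi> # xs)))"

text \<open>Infinitesimal equivariance under the diagonal adjoint actions on source and target.\<close>

definition diag_equivariant :: "('a \<Rightarrow> 'a \<Rightarrow> 'a) \<Rightarrow> ('a::real_normed_vector \<times> 'a) set \<Rightarrow>
    ('a \<times> 'a \<Rightarrow> 'a \<times> 'a) \<Rightarrow> bool" where
  "diag_equivariant br W \<beta> \<longleftrightarrow> (\<forall>p\<in>W. \<forall>\<zeta>.
     frechet_derivative \<beta> (at p) (br2 br (diag \<zeta>) p) = br2 br (diag \<zeta>) (\<beta> p))"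

end

(* Contracting with beta_t and commuting with d gives, by Cartan's formula and the Leibniz rule, the
   operator sum_i beta_t^i L_i plus terms in the derivatives of the beta_t^i and in brackets with the
   basis elements.  On diagonal arguments these extra terms cancel, because beta_t is equivariant;
   so M_t o [d, iota(beta_t)] is m_t o sum_i beta_t^i L_i applied to the value of the cochain, and
   cochains of degree 0 give the converse.

   That M_t is a chain map amounts to invariance of kappa_t and equivariance of Phi_t.  Both follow
   from g exp(x) g^-1 = exp(Ad(g) x), where Ad(g) is defined through left-invariant fields: the curve
   t -> g exp(tx) g^-1 exp(t Ad(g) x)^-1 is not seen by any smooth function, and smooth functions
   separate points near the unit.  The same identity shows that the Jacobian J has no zero on U: if
   (1 - e^{-ad x})/ad x kills v, then exp(sv) commutes with exp(x), so exp is constant along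
   Ad(exp(sv)) x, and injectivity gives [v, x] = 0 and then v = 0. *)

theory Submission
  imports Defs
begin

section \<open>Calculus of smooth maps\<close>

text \<open>The obstacle is that the group is seen only through globally defined smooth functions:
  left-invariant fields are derivations of these, and each t -> exp(tx) is given as an integral
  curve tested on them, with smoothness of exp known on U only. The proof builds neither bump
  functions nor the one-parameter law exp((s+t)x) = exp(sx) exp(tx). Instead, injectivity of
  \<open>lf\<close> shows that the differentials at the unit of global smooth functions fill the
  dual of the Lie algebra. This yields coordinates near the unit. As the bracket is a commutator of
  derivations, d/ds Ad(exp(sv)) x = [v, Ad(exp(sv)) x] comes from mixed second derivatives of
  f(exp(av) exp(rx) exp(bv)^-1); this is why the symmetry of second derivatives is proved.
  Invariance of kappa_t and Phi_t is wanted only infinitesimally, so group elements near the unit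
  suffice and no point has to leave its domain. Having no zero on the star-shaped U, J is positive
  there because J(0) = 1; hence its square roots are smooth. At t = 0, beta_t is the linear part of
  beta at the origin, and equivariance passes to the limit.\<close>

lemma linear_eq_sum_Basis:
  fixes f :: "'a::euclidean_space \<Rightarrow> 'b::real_vector"
  assumes "linear f"
  shows "f w = (\<Sum>b\<in>Basis. (w \<bullet> b) *\<^sub>R f b)"
proof -
  have "f (\<Sum>b\<in>Basis. (w \<bullet> b) *\<^sub>R b) = (\<Sum>b\<in>Basis. (w \<bullet> b) *\<^sub>R f b)"
    by (simp only: linear_sum[OF assms] linear_cmul[OF assms])
  then show ?thesis by (simp only: euclidean_representation)
qed

text \<open>Closure properties are proved by induction on the order with the first derivative split
  off, whereas \<open>iter_deriv\<close> exposes the last one. Order 0 already asks for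
  differentiability, so that \<open>frechet_derivative\<close> is meaningful at every stage.\<close>

primrec Ck :: "nat \<Rightarrow> 'a::real_normed_vector set \<Rightarrow> ('a \<Rightarrow> 'b::real_normed_vector) \<Rightarrow> bool" where
  "Ck 0 S f \<longleftrightarrow> (\<forall>x\<in>S. f differentiable (at x))"
| "Ck (Suc k) S f \<longleftrightarrow> (\<forall>x\<in>S. f differentiable (at x)) \<and>
     (\<forall>v. Ck k S (\<lambda>x. frechet_derivative f (at x) v))"

lemma iter_deriv_append: "iter_deriv f (us @ vs) = iter_deriv (iter_deriv f vs) us"
  by (induction us) auto

lemma Ck_iff_iter_deriv:
  "Ck k S f \<longleftrightarrow> (\<forall>vs. length vs \<le> k \<longrightarrow> (\<forall>x\<in>S. iter_deriv f vs differentiable (at x)))"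
proof (induction k arbitrary: f)
  case 0
  then show ?case by auto
next
  case (Suc k)
  have "(\<forall>vs. length vs \<le> Suc k \<longrightarrow> (\<forall>x\<in>S. iter_deriv f vs differentiable (at x))) \<longleftrightarrow>
    (\<forall>x\<in>S. f differentiable (at x)) \<and>
    (\<forall>v vs. length vs \<le> k \<longrightarrow> (\<forall>x\<in>S. iter_deriv f (vs @ [v]) differentiable (at x)))"
    (is "?L \<longleftrightarrow> ?R")
  proof
    assume L: ?L
    have "f differentiable (at x)" if "x \<in> S" for x
      using L[rule_format, of "[]" x] that by simp
    then show ?R using L by auto
  next
    assume R: ?R
    show ?L
    proof (intro allI impI)
      fix vs :: "'a list" assume "length vs \<le> Suc k"
      then show "\<forall>x\<in>S. iter_deriv f vs differentiable (at x)"
        using R by (cases vs rule: rev_cases) auto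
    qed
  qed
  then show ?case
    by (simp add: Suc.IH iter_deriv_append)
qed

lemma smooth_on_iff_Ck: "smooth_on S f \<longleftrightarrow> (\<forall>k. Ck k S f)"
  unfolding smooth_on_def Ck_iff_iter_deriv by blast

lemma Ck_differentiable: "Ck k S f \<Longrightarrow> x \<in> S \<Longrightarrow> f differentiable (at x)"
  by (cases k) auto

lemma Ck_Suc_imp: "Ck (Suc k) S f \<Longrightarrow> Ck k S f"
  by (simp only: Ck_iff_iter_deriv) simp

lemma Ck_cong_imp:
  assumes "open S" "Ck k S f" "\<And>x. x \<in> S \<Longrightarrow> f x = g x"
  shows "Ck k S g"
  using assms(2,3)
proof (induction k arbitrary: f g)
  case 0
  have "g differentiable (at x)" if "x \<in> S" for x
    using 0 that has_derivative_transform_within_open[OF _ assms(1) that, of f _ UNIV g]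
    by (fastforce simp: differentiable_def)
  then show ?case by simp
next
  case (Suc k)
  have d: "g differentiable (at x)" if "x \<in> S" for x
    using Suc.prems that has_derivative_transform_within_open[OF _ assms(1) that, of f _ UNIV g]
    by (fastforce simp: differentiable_def)
  have "frechet_derivative f (at x) v = frechet_derivative g (at x) v" if "x \<in> S" for x v
    using frechet_derivative_transform_within_open[of f x S g] Suc.prems that assms(1) by auto
  then have "Ck k S (\<lambda>x. frechet_derivative g (at x) v)" for v
    using Suc.IH[of "\<lambda>x. frechet_derivative f (at x) v"] Suc.prems(1) by auto
  with d show ?case by auto
qed

lemma Ck_linear:
  assumes "bounded_linear L" "open S" "Ck k S f"
  shows "Ck k S (\<lambda>x. L (f x))"
  using assms(3)
proof (induction k arbitrary: f)
  case 0
  then show ?case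
    using bounded_linear.has_derivative[OF assms(1)] by (fastforce simp: differentiable_def)
next
  case (Suc k)
  then have d: "f differentiable (at x)" if "x \<in> S" for x using that by auto
  have D: "((\<lambda>x. L (f x)) has_derivative (\<lambda>v. L (frechet_derivative f (at x) v))) (at x)" if "x \<in> S" for x
    using bounded_linear.has_derivative[OF assms(1)] d[OF that] by (simp add: frechet_derivative_works)
  have "Ck k S (\<lambda>x. frechet_derivative (\<lambda>x. L (f x)) (at x) v)" for v
    by (rule Ck_cong_imp[OF assms(2) Suc.IH[of "\<lambda>x. frechet_derivative f (at x) v"]])
      (use Suc.prems frechet_derivative_at[OF D] in \<open>auto simp: fun_eq_iff\<close>)
  then show ?case
    using D by (auto simp: differentiable_def)
qed

lemma Ck_add:
  assumes "open S" "Ck k S f" "Ck k S g"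
  shows "Ck k S (\<lambda>x. f x + g x)"
  using assms(2,3)
proof (induction k arbitrary: f g)
  case 0
  then show ?case by auto
next
  case (Suc k)
  then have d: "f differentiable (at x)" "g differentiable (at x)" if "x \<in> S" for x
    using that by auto
  have D: "((\<lambda>x. f x + g x) has_derivative
      (\<lambda>v. frechet_derivative f (at x) v + frechet_derivative g (at x) v)) (at x)" if "x \<in> S" for x
    using d[OF that] by (auto simp: frechet_derivative_works intro: has_derivative_add)
  have "Ck k S (\<lambda>x. frechet_derivative (\<lambda>x. f x + g x) (at x) v)" for v
    by (rule Ck_cong_imp[OF assms(1) Suc.IH[of "\<lambda>x. frechet_derivative f (at x) v" "\<lambda>x. frechet_derivative g (at x) v"]])
      (use Suc.prems frechet_derivative_at[OF D] in \<open>auto simp: fun_eq_iff\<close>)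
  then show ?case
    using D by (auto simp: differentiable_def)
qed

lemma Ck_bilinear:
  assumes "bounded_bilinear times2" "open S" "Ck k S f" "Ck k S g"
  shows "Ck k S (\<lambda>x. times2 (f x) (g x))"
  using assms(3,4)
proof (induction k arbitrary: f g)
  case 0
  then show ?case
    using bounded_bilinear.FDERIV[OF assms(1)] by (fastforce simp: differentiable_def)
next
  case (Suc k)
  then have d: "f differentiable (at x)" "g differentiable (at x)" if "x \<in> S" for x
    using that by auto
  have D: "((\<lambda>x. times2 (f x) (g x)) has_derivative
      (\<lambda>v. times2 (f x) (frechet_derivative g (at x) v) + times2 (frechet_derivative f (at x) v) (g x))) (at x)"
    if "x \<in> S" for x
    using bounded_bilinear.FDERIV[OF assms(1)] d[OF that] by (auto simp: frechet_derivative_works)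
  have "Ck k S (\<lambda>x. frechet_derivative (\<lambda>x. times2 (f x) (g x)) (at x) v)" for v
    by (rule Ck_cong_imp[OF assms(2) Ck_add[OF assms(2)
        Suc.IH[of f "\<lambda>x. frechet_derivative g (at x) v"] Suc.IH[of "\<lambda>x. frechet_derivative f (at x) v" g]]])
      (use Suc.prems Ck_Suc_imp frechet_derivative_at[OF D] in \<open>auto simp: fun_eq_iff\<close>)
  then show ?case
    using D by (auto simp: differentiable_def)
qed

lemma Ck_const: "Ck k S (\<lambda>x. c)"
  by (induction k arbitrary: c) auto

lemma Ck_ident: "Ck k S (\<lambda>x. x)"
  by (cases k) (auto simp: Ck_const)

lemma Ck_sum:
  assumes "open S" "\<And>i. i \<in> I \<Longrightarrow> Ck k S (f i)"
  shows "Ck k S (\<lambda>x. \<Sum>i\<in>I. f i x)"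
  using assms(2) by (induction I rule: infinite_finite_induct) (auto simp: Ck_const intro!: Ck_add assms(1))

text \<open>The chain rule produces a derivative of \<open>g\<close> in a direction that varies with
  the point. Expanding this direction in the basis leaves derivatives of \<open>g\<close> in fixed
  directions, to which the induction hypothesis applies.\<close>

lemma Ck_compose:
  fixes g :: "'b::euclidean_space \<Rightarrow> 'c::real_normed_vector"
  assumes "open S" "open T" "\<And>x. x \<in> S \<Longrightarrow> f x \<in> T" "Ck k S f" "Ck k T g"
  shows "Ck k S (\<lambda>x. g (f x))"
  using assms(4,5)
proof (induction k arbitrary: g)
  case 0
  then show ?case
    using assms(3) differentiable_chain_at[of f _ g] by (auto simp: o_def)
next
  case (Suc k)
  have df: "f differentiable (at x)" and dg: "g differentiable (at (f x))" if "x \<in> S" for x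
    using that Suc.prems assms(3) by auto
  have D: "((\<lambda>x. g (f x)) has_derivative
      (\<lambda>v. frechet_derivative g (at (f x)) (frechet_derivative f (at x) v))) (at x)" if "x \<in> S" for x
    using diff_chain_at[of f _ x g] df[OF that] dg[OF that] by (auto simp: frechet_derivative_works o_def)
  have lin: "frechet_derivative g (at (f x)) w = (\<Sum>b\<in>Basis. (w \<bullet> b) *\<^sub>R frechet_derivative g (at (f x)) b)"
    if "x \<in> S" for x w
    using linear_frechet_derivative[OF dg[OF that]] by (rule linear_eq_sum_Basis)
  have "Ck k S (\<lambda>x. frechet_derivative (\<lambda>x. g (f x)) (at x) v)" for v
  proof (rule Ck_cong_imp[OF assms(1)])
    show "Ck k S (\<lambda>x. \<Sum>b\<in>Basis. (frechet_derivative f (at x) v \<bullet> b) *\<^sub>R frechet_derivative g (at (f x)) b)"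
    proof (intro Ck_sum assms(1) Ck_bilinear[OF bounded_bilinear_scaleR])
      fix b :: 'b
      show "Ck k S (\<lambda>x. frechet_derivative f (at x) v \<bullet> b)"
        by (rule Ck_linear[OF bounded_linear_inner_left assms(1)]) (use Suc.prems in auto)
      show "Ck k S (\<lambda>x. frechet_derivative g (at (f x)) b)"
        by (rule Suc.IH) (use Suc.prems Ck_Suc_imp in auto)
    qed
    show "(\<Sum>b\<in>Basis. (frechet_derivative f (at x) v \<bullet> b) *\<^sub>R frechet_derivative g (at (f x)) b) =
      frechet_derivative (\<lambda>x. g (f x)) (at x) v" if "x \<in> S" for x
      by (simp only: lin[OF that, symmetric] frechet_derivative_at[OF D[OF that], symmetric])
  qed
  then show ?case
    using D by (auto simp: differentiable_def)
qed

section \<open>Closure properties of smooth maps\<close>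

lemma smooth_on_differentiable: "smooth_on S f \<Longrightarrow> x \<in> S \<Longrightarrow> f differentiable (at x)"
  using Ck_differentiable smooth_on_iff_Ck by blast

lemma smooth_on_has_derivative:
  "smooth_on S f \<Longrightarrow> x \<in> S \<Longrightarrow> (f has_derivative frechet_derivative f (at x)) (at x)"
  using smooth_on_differentiable frechet_derivative_works by blast

lemma smooth_on_continuous_on: "smooth_on S f \<Longrightarrow> continuous_on S f"
  by (meson continuous_at_imp_continuous_on differentiable_imp_continuous_within smooth_on_differentiable)

lemma smooth_on_frechet_derivative:
  "smooth_on S f \<Longrightarrow> smooth_on S (\<lambda>x. frechet_derivative f (at x) v)"
  unfolding smooth_on_iff_Ck using Ck.simps(2) by blast

lemma smooth_on_cong_imp:
  "open S \<Longrightarrow> smooth_on S f \<Longrightarrow> (\<And>x. x \<in> S \<Longrightarrow> f x = g x) \<Longrightarrow> smooth_on S g"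
  unfolding smooth_on_iff_Ck using Ck_cong_imp by blast

lemma smooth_on_cong:
  "open S \<Longrightarrow> (\<And>x. x \<in> S \<Longrightarrow> f x = g x) \<Longrightarrow> smooth_on S f \<longleftrightarrow> smooth_on S g"
  using smooth_on_cong_imp[of S f g] smooth_on_cong_imp[of S g f] by auto

lemma smooth_on_subset: "smooth_on S f \<Longrightarrow> T \<subseteq> S \<Longrightarrow> smooth_on T f"
  unfolding smooth_on_def by blast

lemma smooth_on_local: "(\<And>x. x \<in> S \<Longrightarrow> \<exists>T. x \<in> T \<and> smooth_on T f) \<Longrightarrow> smooth_on S f"
  unfolding smooth_on_def by (intro allI ballI) meson

lemma smooth_on_const: "smooth_on S (\<lambda>x. c)"
  unfolding smooth_on_iff_Ck by (simp add: Ck_const)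

lemma smooth_on_ident: "smooth_on S (\<lambda>x. x)"
  unfolding smooth_on_iff_Ck by (simp add: Ck_ident)

lemma smooth_on_linear: "bounded_linear L \<Longrightarrow> open S \<Longrightarrow> smooth_on S f \<Longrightarrow> smooth_on S (\<lambda>x. L (f x))"
  unfolding smooth_on_iff_Ck by (rule allI, rule Ck_linear[of L S _ f]) auto

lemma bounded_linear_smooth_on: "bounded_linear L \<Longrightarrow> open S \<Longrightarrow> smooth_on S L"
  by (rule smooth_on_linear[of L S "\<lambda>x. x"]) (auto intro: smooth_on_ident)

lemma smooth_on_add: "open S \<Longrightarrow> smooth_on S f \<Longrightarrow> smooth_on S g \<Longrightarrow> smooth_on S (\<lambda>x. f x + g x)"
  unfolding smooth_on_iff_Ck by (rule allI, rule Ck_add[of S _ f g]) auto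

lemma smooth_on_bilinear:
  "bounded_bilinear times2 \<Longrightarrow> open S \<Longrightarrow> smooth_on S f \<Longrightarrow> smooth_on S g \<Longrightarrow> smooth_on S (\<lambda>x. times2 (f x) (g x))"
  unfolding smooth_on_iff_Ck by (rule allI, rule Ck_bilinear[of times2 S _ f g]) auto

lemma smooth_on_mult:
  fixes f g :: "'a::real_normed_vector \<Rightarrow> real"
  shows "open S \<Longrightarrow> smooth_on S f \<Longrightarrow> smooth_on S g \<Longrightarrow> smooth_on S (\<lambda>x. f x * g x)"
  by (rule smooth_on_bilinear[OF bounded_bilinear_mult])

lemma smooth_on_sum:
  "open S \<Longrightarrow> (\<And>i. i \<in> I \<Longrightarrow> smooth_on S (f i)) \<Longrightarrow> smooth_on S (\<lambda>x. \<Sum>i\<in>I. f i x)"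
  unfolding smooth_on_iff_Ck by (rule allI, rule Ck_sum[of S I _ f]) auto

lemma smooth_on_prod:
  fixes f :: "'i \<Rightarrow> 'a::real_normed_vector \<Rightarrow> real"
  assumes "open S" "\<And>i. i \<in> I \<Longrightarrow> smooth_on S (f i)"
  shows "smooth_on S (\<lambda>x. \<Prod>i\<in>I. f i x)"
  using assms(2)
  by (induction I rule: infinite_finite_induct) (auto simp: smooth_on_const intro!: smooth_on_mult assms(1))

lemma smooth_on_compose:
  fixes g :: "'b::euclidean_space \<Rightarrow> 'c::real_normed_vector"
  shows "open S \<Longrightarrow> open T \<Longrightarrow> (\<And>x. x \<in> S \<Longrightarrow> f x \<in> T) \<Longrightarrow> smooth_on S f \<Longrightarrow> smooth_on T g \<Longrightarrow>
    smooth_on S (\<lambda>x. g (f x))"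
  unfolding smooth_on_iff_Ck by (rule allI, rule Ck_compose[of S T f _ g]) auto

lemma smooth_on_Pair:
  assumes "open S" "smooth_on S f" "smooth_on S g"
  shows "smooth_on S (\<lambda>x. (f x, g x))"
proof -
  have "smooth_on S (\<lambda>x. (f x, 0) + (0, g x))"
    by (intro smooth_on_add assms(1)
        smooth_on_linear[OF bounded_linear_Pair[OF bounded_linear_ident bounded_linear_zero] assms(1,2)]
        smooth_on_linear[OF bounded_linear_Pair[OF bounded_linear_zero bounded_linear_ident] assms(1,3)])
  then show ?thesis by simp
qed

lemma smooth_on_frechet_derivative_field:
  fixes f :: "'a::euclidean_space \<Rightarrow> 'b::real_normed_vector"
  assumes "open S" "smooth_on S f" "smooth_on S X"
  shows "smooth_on S (\<lambda>x. frechet_derivative f (at x) (X x))"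
proof (rule smooth_on_cong_imp[OF assms(1)])
  show "smooth_on S (\<lambda>x. \<Sum>b\<in>Basis. (X x \<bullet> b) *\<^sub>R frechet_derivative f (at x) b)"
    by (intro smooth_on_sum assms(1) smooth_on_bilinear[OF bounded_bilinear_scaleR]
        smooth_on_linear[OF bounded_linear_inner_left _ assms(3)] smooth_on_frechet_derivative assms(2))
  fix x assume "x \<in> S"
  then have L: "linear (frechet_derivative f (at x))"
    by (rule linear_frechet_derivative[OF smooth_on_differentiable[OF assms(2)]])
  show "(\<Sum>b\<in>Basis. (X x \<bullet> b) *\<^sub>R frechet_derivative f (at x) b) = frechet_derivative f (at x) (X x)"
    by (rule linear_eq_sum_Basis[OF L, symmetric])
qed

text \<open>The exponent is arbitrary because differentiation lowers it. The exponents 1/2 and -1/2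
  will give the square roots of J in numerator and denominator.\<close>

lemma smooth_on_powr: "smooth_on {0<..} (\<lambda>x::real. x powr a)"
  unfolding smooth_on_iff_Ck
proof
  fix k
  have D: "((\<lambda>x::real. x powr a) has_derivative (\<lambda>v. v * (a * x powr (a - 1)))) (at x)" if "x > 0" for x a
    using has_real_derivative_powr[OF that, of a]
    unfolding has_field_derivative_def by (rule has_derivative_eq_rhs) (simp add: fun_eq_iff)
  show "Ck k {0<..} (\<lambda>x::real. x powr a)"
  proof (induction k arbitrary: a)
    case 0
    then show ?case using D by (auto simp: differentiable_def)
  next
    case (Suc k)
    have "Ck k {0<..} (\<lambda>x. frechet_derivative (\<lambda>x. x powr a) (at x) v)" for v
      by (rule Ck_cong_imp[OF _ Ck_linear[OF bounded_linear_mult_right[of "v * a"] _ Suc.IH[of "a - 1"]]])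
        (auto simp flip: frechet_derivative_at[OF D])
    then show ?case using D by (auto simp: differentiable_def)
  qed
qed

section \<open>Derivatives along curves and the symmetry of second derivatives\<close>

lemma has_derivative_along_curve:
  fixes f :: "'a::real_normed_vector \<Rightarrow> 'b::real_normed_vector"
  assumes "f differentiable (at (c t))" "(c has_vector_derivative v) (at t)"
  shows "((\<lambda>s. f (c s)) has_vector_derivative frechet_derivative f (at (c t)) v) (at t)"
proof -
  have L: "linear (frechet_derivative f (at (c t)))"
    using assms(1) by (rule linear_frechet_derivative)
  have "((f \<circ> c) has_derivative frechet_derivative f (at (c t)) \<circ> (\<lambda>s. s *\<^sub>R v)) (at t)"
    using assms by (intro diff_chain_at) (auto simp: has_vector_derivative_def frechet_derivative_works)
  then show ?thesis
    by (simp add: has_vector_derivative_def o_def linear_cmul[OF L])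
qed

lemma real_deriv_along_curve:
  fixes F :: "'b::real_normed_vector \<Rightarrow> real"
  assumes "F differentiable (at p)" "c t = p" "(c has_vector_derivative v) (at t)"
  shows "((\<lambda>s. F (c s)) has_real_derivative frechet_derivative F (at p) v) (at t)"
  using has_derivative_along_curve[of F c t v] assms by (simp add: has_real_derivative_iff_has_vector_derivative)

text \<open>Turns an identity that holds for group elements near the unit into an infinitesimal
  one.\<close>

lemma has_vector_derivative_eventually_unique:
  fixes f g :: "real \<Rightarrow> 'b::real_normed_vector"
  assumes "(f has_vector_derivative f') (at a)" "(g has_vector_derivative g') (at a)"
    "eventually (\<lambda>s. f s = g s) (at a)" "f a = g a"
  shows "f' = g'"
proof -
  have "(g has_vector_derivative f') (at a)"
    using assms(1,3,4) unfolding has_vector_derivative_def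
    by (rule has_derivative_transform_eventually) auto
  then show ?thesis using assms(2) vector_derivative_unique_at by blast
qed

text \<open>The mean value theorem is used twice: in direction \<open>u\<close> for the increment of
  \<open>f\<close> along \<open>v\<close>, then in direction \<open>v\<close> for the derivative
  along \<open>u\<close>.\<close>

lemma second_difference_mvt:
  fixes f :: "'a::real_normed_vector \<Rightarrow> real"
  assumes "open S" "smooth_on S f" "h > 0"
    and S: "\<And>s t. 0 \<le> s \<Longrightarrow> s \<le> h \<Longrightarrow> 0 \<le> t \<Longrightarrow> t \<le> h \<Longrightarrow> p + s *\<^sub>R u + t *\<^sub>R v \<in> S"
  shows "\<exists>s t. 0 < s \<and> s < h \<and> 0 < t \<and> t < h \<and>
    f (p + h *\<^sub>R u + h *\<^sub>R v) - f (p + h *\<^sub>R u) - f (p + h *\<^sub>R v) + f p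
     = h * h * iter_deriv f [v, u] (p + s *\<^sub>R u + t *\<^sub>R v)"
proof -
  define G where "G = (\<lambda>s. f (p + s *\<^sub>R u + h *\<^sub>R v) - f (p + s *\<^sub>R u))"
  have fd: "((\<lambda>s. f (p + s *\<^sub>R u + t *\<^sub>R v)) has_real_derivative iter_deriv f [u] (p + s *\<^sub>R u + t *\<^sub>R v)) (at s)"
    if "0 \<le> s" "s \<le> h" "0 \<le> t" "t \<le> h" for s t
  proof -
    have "((\<lambda>s. p + s *\<^sub>R u + t *\<^sub>R v) has_vector_derivative u) (at s)"
      unfolding has_vector_derivative_def by (auto intro!: derivative_eq_intros)
    from has_derivative_along_curve[OF smooth_on_differentiable[OF assms(2) S[OF that]] this] show ?thesis
      by (simp add: has_real_derivative_iff_has_vector_derivative)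
  qed
  have fd2: "((\<lambda>t. iter_deriv f [u] (p + s *\<^sub>R u + t *\<^sub>R v)) has_real_derivative iter_deriv f [v, u] (p + s *\<^sub>R u + t *\<^sub>R v)) (at t)"
    if "0 \<le> s" "s \<le> h" "0 \<le> t" "t \<le> h" for s t
  proof -
    have "((\<lambda>t. p + s *\<^sub>R u + t *\<^sub>R v) has_vector_derivative v) (at t)"
      unfolding has_vector_derivative_def by (auto intro!: derivative_eq_intros)
    from has_derivative_along_curve[OF smooth_on_differentiable[OF smooth_on_frechet_derivative[OF assms(2)]
        S[OF that]] this] show ?thesis
      by (simp add: has_real_derivative_iff_has_vector_derivative)
  qed
  have "(G has_real_derivative iter_deriv f [u] (p + s *\<^sub>R u + h *\<^sub>R v) - iter_deriv f [u] (p + s *\<^sub>R u)) (at s)"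
    if "0 \<le> s" "s \<le> h" for s
    unfolding G_def using fd[OF that, of h] fd[OF that, of 0] assms(3) by (intro DERIV_diff) auto
  from MVT2[OF assms(3) this] obtain s where s: "0 < s" "s < h"
    "G h - G 0 = (h - 0) * (iter_deriv f [u] (p + s *\<^sub>R u + h *\<^sub>R v) - iter_deriv f [u] (p + s *\<^sub>R u))"
    by auto
  from MVT2[OF assms(3) fd2[of s]] s obtain t where t: "0 < t" "t < h"
    "iter_deriv f [u] (p + s *\<^sub>R u + h *\<^sub>R v) - iter_deriv f [u] (p + s *\<^sub>R u)
      = h * iter_deriv f [v, u] (p + s *\<^sub>R u + t *\<^sub>R v)"
    by auto
  have "G h - G 0 = h * h * iter_deriv f [v, u] (p + s *\<^sub>R u + t *\<^sub>R v)"
    using s(3) t(3) by simp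
  then show ?thesis using s(1,2) t(1,2) unfolding G_def by (intro exI[of _ s] exI[of _ t]) auto
qed

text \<open>The second difference is symmetric in \<open>u\<close> and \<open>v\<close>, so the two
  mixed derivatives agree at suitable points arbitrarily close to \<open>p\<close>; both are
  continuous at \<open>p\<close>.\<close>

lemma iter_deriv_commute:
  fixes f :: "'a::real_normed_vector \<Rightarrow> real"
  assumes "open S" "smooth_on S f" "p \<in> S"
  shows "iter_deriv f [u, v] p = iter_deriv f [v, u] p"
proof -
  have cont: "isCont (iter_deriv f [a, b]) p" for a b
    using smooth_on_differentiable[OF smooth_on_frechet_derivative[OF smooth_on_frechet_derivative[OF assms(2)]]
        assms(3), of b a] by (simp add: differentiable_imp_continuous_within)
  have "\<bar>iter_deriv f [v, u] p - iter_deriv f [u, v] p\<bar> \<le> e" if "e > 0" for e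
  proof -
    obtain d where d: "d > 0" "ball p d \<subseteq> S"
      using assms(1,3) openE by blast
    obtain d1 where d1: "d1 > 0" "\<And>q. dist q p < d1 \<Longrightarrow> dist (iter_deriv f [v, u] q) (iter_deriv f [v, u] p) < e / 2"
      using cont[of v u] \<open>e > 0\<close> unfolding continuous_at_eps_delta by (metis half_gt_zero)
    obtain d2 where d2: "d2 > 0" "\<And>q. dist q p < d2 \<Longrightarrow> dist (iter_deriv f [u, v] q) (iter_deriv f [u, v] p) < e / 2"
      using cont[of u v] \<open>e > 0\<close> unfolding continuous_at_eps_delta by (metis half_gt_zero)
    define m where "m = min d (min d1 d2)"
    \<comment> \<open>This keeps the whole parallelogram with sides \<open>h u\<close> and
      \<open>h v\<close> within distance \<open>m / 2\<close> of \<open>p\<close>; the summand 1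
      covers \<open>u = v = 0\<close>.\<close>
    define h where "h = m / 2 / (norm u + norm v + 1)"
    have m: "m > 0" using d d1 d2 by (simp add: m_def)
    have np: "norm u + norm v + 1 > 0" using norm_ge_zero[of u] norm_ge_zero[of v] by linarith
    have h: "h > 0" using m np by (simp add: h_def)
    have near: "dist (p + s *\<^sub>R u + t *\<^sub>R v) p < m" if "0 \<le> s" "s \<le> h" "0 \<le> t" "t \<le> h" for s t
    proof -
      have "dist (p + s *\<^sub>R u + t *\<^sub>R v) p \<le> s * norm u + t * norm v"
        using that norm_triangle_ineq[of "s *\<^sub>R u" "t *\<^sub>R v"] by (simp add: dist_norm add.assoc)
      also have "\<dots> \<le> h * norm u + h * norm v"
        by (intro add_mono mult_right_mono that) auto
      also have "\<dots> \<le> h * (norm u + norm v + 1)" using h by (simp add: algebra_simps)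
      also have "\<dots> = m / 2"
      proof -
        have "m / 2 / c * c = m / 2" if "c > 0" for c :: real using that by simp
        then show ?thesis unfolding h_def using np by blast
      qed
      finally show ?thesis using m by simp
    qed
    have near': "dist (p + s *\<^sub>R v + t *\<^sub>R u) p < m" if "0 \<le> s" "s \<le> h" "0 \<le> t" "t \<le> h" for s t
      using near[of t s] that by (simp add: ac_simps)
    have "p + s *\<^sub>R u + t *\<^sub>R v \<in> S" if "0 \<le> s" "s \<le> h" "0 \<le> t" "t \<le> h" for s t
      using near[OF that] d(2) by (auto simp: m_def dist_commute mem_ball subset_iff)
    from second_difference_mvt[OF assms(1,2) h this] obtain s t where st: "0 < s" "s < h" "0 < t" "t < h"
      "f (p + h *\<^sub>R u + h *\<^sub>R v) - f (p + h *\<^sub>R u) - f (p + h *\<^sub>R v) + f p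
     = h * h * iter_deriv f [v, u] (p + s *\<^sub>R u + t *\<^sub>R v)" by blast
    have "p + s *\<^sub>R v + t *\<^sub>R u \<in> S" if "0 \<le> s" "s \<le> h" "0 \<le> t" "t \<le> h" for s t
      using near'[OF that] d(2) by (auto simp: m_def dist_commute mem_ball subset_iff)
    from second_difference_mvt[OF assms(1,2) h this] obtain s' t' where st': "0 < s'" "s' < h" "0 < t'" "t' < h"
      "f (p + h *\<^sub>R v + h *\<^sub>R u) - f (p + h *\<^sub>R v) - f (p + h *\<^sub>R u) + f p
     = h * h * iter_deriv f [u, v] (p + s' *\<^sub>R v + t' *\<^sub>R u)" by blast
    have "p + h *\<^sub>R v + h *\<^sub>R u = p + h *\<^sub>R u + h *\<^sub>R v" by (simp add: ac_simps)
    then have "h * h * iter_deriv f [v, u] (p + s *\<^sub>R u + t *\<^sub>R v) = h * h * iter_deriv f [u, v] (p + s' *\<^sub>R v + t' *\<^sub>R u)"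
      using st(5) st'(5) by (simp del: iter_deriv.simps add: algebra_simps)
    then have eq: "iter_deriv f [v, u] (p + s *\<^sub>R u + t *\<^sub>R v) = iter_deriv f [u, v] (p + s' *\<^sub>R v + t' *\<^sub>R u)"
      using h by (simp del: iter_deriv.simps)
    have "dist (iter_deriv f [v, u] (p + s *\<^sub>R u + t *\<^sub>R v)) (iter_deriv f [v, u] p) < e / 2"
      using near[of s t] st by (intro d1) (simp add: m_def)
    moreover have "dist (iter_deriv f [u, v] (p + s' *\<^sub>R v + t' *\<^sub>R u)) (iter_deriv f [u, v] p) < e / 2"
      using near'[of s' t'] st' by (intro d2) (simp add: m_def)
    ultimately show ?thesis using eq unfolding dist_real_def by linarith
  qed
  then have "\<bar>iter_deriv f [v, u] p - iter_deriv f [u, v] p\<bar> \<le> 0"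
    by (rule field_le_epsilon) (simp del: iter_deriv.simps)
  then show ?thesis by simp
qed

section \<open>Functionals on smooth functions\<close>

text \<open>Linearity and locality are what the algebraic identities use of a distribution. For Lie
  derivatives and contracted cochains they can be followed without carrying seminorm estimates
  along.\<close>

definition smooth_functional :: "'a::euclidean_space set \<Rightarrow> (('a \<Rightarrow> real) \<Rightarrow> real) \<Rightarrow> bool" where
  "smooth_functional W u \<longleftrightarrow>
     (\<forall>f. \<not> smooth_on W f \<longrightarrow> u f = 0) \<and>
     (\<forall>f g a b. smooth_on W f \<and> smooth_on W g \<longrightarrow> u (\<lambda>x. a * f x + b * g x) = a * u f + b * u g) \<and>
     (\<forall>f g. smooth_on W f \<and> (\<forall>x\<in>W. f x = g x) \<longrightarrow> u f = u g)"

lemma sum_fun_apply: "(\<Sum>i\<in>I. F i) x = (\<Sum>i\<in>I. F i x)"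
  by (induction I rule: infinite_finite_induct) auto

lemma smooth_functional_lincomb:
  "smooth_functional W u \<Longrightarrow> smooth_on W f \<Longrightarrow> smooth_on W g \<Longrightarrow>
    u (\<lambda>x. a * f x + b * g x) = a * u f + b * u g"
  unfolding smooth_functional_def by blast

lemma smooth_functional_add:
  "smooth_functional W u \<Longrightarrow> smooth_on W f \<Longrightarrow> smooth_on W g \<Longrightarrow> u (\<lambda>x. f x + g x) = u f + u g"
  using smooth_functional_lincomb[of W u f g 1 1] by simp

lemma smooth_functional_cmul:
  "smooth_functional W u \<Longrightarrow> smooth_on W f \<Longrightarrow> u (\<lambda>x. a * f x) = a * u f"
  using smooth_functional_lincomb[of W u f f a 0] by simp

lemma smooth_functional_sum:
  assumes "smooth_functional W u" "open W" "\<And>i. i \<in> I \<Longrightarrow> smooth_on W (f i)"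
  shows "u (\<lambda>x. \<Sum>i\<in>I. c i * f i x) = (\<Sum>i\<in>I. c i * u (f i))"
  using assms(3)
proof (induction I rule: infinite_finite_induct)
  case (insert i I)
  have "smooth_on W (\<lambda>x. \<Sum>i\<in>I. c i * f i x)"
    using insert by (intro smooth_on_sum smooth_on_mult smooth_on_const assms(2)) auto
  then show ?case
    using insert smooth_functional_lincomb[OF assms(1), of "f i" "\<lambda>x. \<Sum>i\<in>I. c i * f i x" "c i" 1] by simp
qed (use smooth_functional_cmul[OF assms(1) smooth_on_const, of 0] in auto)

text \<open>Covers nonsmooth \<open>f\<close> too: on an open set smoothness depends only on the
  values there, and without it both sides have the default value 0.\<close>

lemma smooth_functional_cong:
  assumes "smooth_functional W u" "open W" "\<And>x. x \<in> W \<Longrightarrow> f x = g x"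
  shows "u f = u g"
proof (cases "smooth_on W f")
  case True
  then show ?thesis using assms unfolding smooth_functional_def by blast
next
  case False
  then have "\<not> smooth_on W g" using smooth_on_cong[of W f g] assms(2,3) by blast
  then show ?thesis using False assms(1) unfolding smooth_functional_def by simp
qed

text \<open>Locality comes from the estimate with r = 0: if f = g on the open set \<open>W\<close>,
  all iterated derivatives of f - g vanish on the compact subset.\<close>

lemma smooth_functional_comp_distribution:
  assumes "u \<in> comp_distributions W" "open W"
  shows "smooth_functional W u"
proof -
  have lin: "u (\<lambda>x. a * f x + b * g x) = a * u f + b * u g" if "smooth_on W f" "smooth_on W g" for f g a b
    using assms(1) that unfolding comp_distributions_def by blast
  obtain K N C where K: "K \<subseteq> W" and bound: "\<And>f r. smooth_on W f \<Longrightarrow> 0 \<le> r \<Longrightarrow>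
      (\<forall>x\<in>K. \<forall>vs. set vs \<subseteq> Basis \<and> length vs \<le> N \<longrightarrow> \<bar>iter_deriv f vs x\<bar> \<le> r) \<Longrightarrow> \<bar>u f\<bar> \<le> C * r"
    using assms(1) unfolding comp_distributions_def by blast
  have iter0: "iter_deriv h vs x = 0" if "\<forall>x\<in>W. h x = 0" "x \<in> W" for h :: "'a \<Rightarrow> real" and vs x
    using that(2)
  proof (induction vs arbitrary: x)
    case (Cons v vs)
    have "((\<lambda>x. 0) has_derivative (\<lambda>v. 0)) (at x)" by simp
    then have "(iter_deriv h vs has_derivative (\<lambda>v. 0)) (at x)"
      by (rule has_derivative_transform_within_open[OF _ assms(2) Cons.prems]) (simp add: Cons.IH)
    then show ?case by (simp flip: frechet_derivative_at)
  qed (use that in auto)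
  have "u f = u g" if "smooth_on W f" "\<forall>x\<in>W. f x = g x" for f g
  proof -
    have sg: "smooth_on W g" using smooth_on_cong_imp[OF assms(2) that(1)] that(2) by blast
    have sd: "smooth_on W (\<lambda>x. 1 * f x + (-1) * g x)"
      by (intro smooth_on_add smooth_on_mult smooth_on_const that sg assms(2))
    have "\<bar>u (\<lambda>x. 1 * f x + (-1) * g x)\<bar> \<le> C * 0"
    proof (rule bound[OF sd])
      show "\<forall>x\<in>K. \<forall>vs. set vs \<subseteq> Basis \<and> length vs \<le> N \<longrightarrow>
          \<bar>iter_deriv (\<lambda>x. 1 * f x + (-1) * g x) vs x\<bar> \<le> 0"
        using iter0[of "\<lambda>x. 1 * f x + (-1) * g x"] that(2) K by auto
    qed simp
    then show ?thesis using lin[OF that(1) sg, of 1 "-1"] by simp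
  qed
  then show ?thesis
    using assms(1) lin unfolding smooth_functional_def comp_distributions_def by blast
qed

lemma smooth_functional_zero: "smooth_functional W 0"
  unfolding smooth_functional_def by simp

lemma smooth_functional_plus:
  assumes "smooth_functional W u" "smooth_functional W v"
  shows "smooth_functional W (u + v)"
  unfolding smooth_functional_def
proof (intro conjI allI impI)
  fix f g a b
  show "\<not> smooth_on W f \<Longrightarrow> (u + v) f = 0" using assms unfolding smooth_functional_def by simp
  show "smooth_on W f \<and> smooth_on W g \<Longrightarrow> (u + v) (\<lambda>x. a * f x + b * g x) = a * (u + v) f + b * (u + v) g"
    using smooth_functional_lincomb[OF assms(1)] smooth_functional_lincomb[OF assms(2)] by (simp add: algebra_simps)
  assume *: "smooth_on W f \<and> (\<forall>x\<in>W. f x = g x)"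
  then have "u f = u g" "v f = v g" using assms unfolding smooth_functional_def by blast+
  then show "(u + v) f = (u + v) g" by simp
qed

lemma smooth_functional_sum_functionals:
  "(\<And>i. i \<in> I \<Longrightarrow> smooth_functional W (u i)) \<Longrightarrow> smooth_functional W (\<Sum>i\<in>I. u i)"
  by (induction I rule: infinite_finite_induct)
    (auto simp: smooth_functional_zero smooth_functional_plus simp del: plus_fun_apply zero_fun_apply)

lemma smooth_functional_dist_mult:
  assumes "open W" "smooth_functional W u" "smooth_on W g"
  shows "smooth_functional W (dist_mult W g u)"
  unfolding smooth_functional_def
proof (intro conjI allI impI)
  fix f h a b
  show "\<not> smooth_on W f \<Longrightarrow> dist_mult W g u f = 0" by (simp add: dist_mult_def)
  show "dist_mult W g u (\<lambda>x. a * f x + b * h x) = a * dist_mult W g u f + b * dist_mult W g u h"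
    if "smooth_on W f \<and> smooth_on W h"
  proof -
    have "smooth_on W (\<lambda>x. a * f x + b * h x)" "smooth_on W (\<lambda>x. g x * f x)" "smooth_on W (\<lambda>x. g x * h x)"
      using that assms by (auto intro!: smooth_on_add smooth_on_mult smooth_on_const)
    moreover have "(\<lambda>x. g x * (a * f x + b * h x)) = (\<lambda>x. a * (g x * f x) + b * (g x * h x))"
      by (auto simp: algebra_simps)
    ultimately show ?thesis
      using that smooth_functional_lincomb[OF assms(2)] by (simp add: dist_mult_def)
  qed
  assume *: "smooth_on W f \<and> (\<forall>x\<in>W. f x = h x)"
  then have "smooth_on W h" using smooth_on_cong_imp[OF assms(1)] by blast
  moreover have "u (\<lambda>x. g x * f x) = u (\<lambda>x. g x * h x)"
    by (rule smooth_functional_cong[OF assms(2,1)]) (use * in auto)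
  ultimately show "dist_mult W g u f = dist_mult W g u h"
    using * by (simp add: dist_mult_def)
qed

section \<open>Multiplication by functions and Lie derivatives of functionals\<close>

lemma dist_mult_plus: "dist_mult W g (u + v) = dist_mult W g u + dist_mult W g v"
  by (auto simp: dist_mult_def fun_eq_iff)

lemma dist_mult_minus: "dist_mult W g (- u) = - dist_mult W g u"
  by (auto simp: dist_mult_def fun_eq_iff)

lemma dist_mult_diff: "dist_mult W g (u - v) = dist_mult W g u - dist_mult W g v"
  by (auto simp: dist_mult_def fun_eq_iff)

lemma dist_mult_scaleR: "dist_mult W g (r *\<^sub>R u) = r *\<^sub>R dist_mult W g u"
  by (auto simp: dist_mult_def fun_eq_iff scaleR_fun_def)

lemma dist_mult_sum: "dist_mult W g (\<Sum>i\<in>I. u i) = (\<Sum>i\<in>I. dist_mult W g (u i))"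
  by (auto simp: dist_mult_def fun_eq_iff sum_fun_apply)

lemma dist_lie_sum: "dist_lie W X (\<Sum>i\<in>I. u i) = (\<Sum>i\<in>I. dist_lie W X (u i))"
  by (auto simp: dist_lie_def fun_eq_iff sum_fun_apply sum_negf)

lemma dist_mult_cong:
  assumes "smooth_functional W u" "open W" "\<And>p. p \<in> W \<Longrightarrow> g p = h p"
  shows "dist_mult W g u = dist_mult W h u"
  using smooth_functional_cong[OF assms(1,2)] assms(3) by (fastforce simp: dist_mult_def fun_eq_iff)

lemma dist_mult_sum_left:
  assumes "smooth_functional W u" "open W" "\<And>i. i \<in> I \<Longrightarrow> smooth_on W (g i)"
  shows "dist_mult W (\<lambda>p. \<Sum>i\<in>I. c i * g i p) u = (\<Sum>i\<in>I. c i *\<^sub>R dist_mult W (g i) u)"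
proof
  fix f
  have "u (\<lambda>x. (\<Sum>i\<in>I. c i * g i x) * f x) = (\<Sum>i\<in>I. c i * u (\<lambda>x. g i x * f x))" if "smooth_on W f"
    using smooth_functional_sum[OF assms(1,2), of I "\<lambda>i x. g i x * f x" c] smooth_on_mult[OF assms(2,3) that]
    by (simp add: sum_distrib_right mult.assoc)
  then show "dist_mult W (\<lambda>p. \<Sum>i\<in>I. c i * g i p) u f = (\<Sum>i\<in>I. c i *\<^sub>R dist_mult W (g i) u) f"
    by (simp add: dist_mult_def sum_fun_apply scaleR_fun_def)
qed

lemma frechet_derivative_mult:
  fixes f g :: "'a::real_normed_vector \<Rightarrow> real"
  assumes "f differentiable (at p)" "g differentiable (at p)"
  shows "frechet_derivative (\<lambda>x. f x * g x) (at p) v =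
    f p * frechet_derivative g (at p) v + frechet_derivative f (at p) v * g p"
  using frechet_derivative_at[OF has_derivative_mult[OF assms[unfolded frechet_derivative_works]]]
  by (metis)

lemma dist_lie_dist_mult:
  assumes "open W" "smooth_functional W u" "smooth_on W g" "smooth_on W X"
  shows "dist_lie W X (dist_mult W g u) =
    dist_mult W g (dist_lie W X u) + dist_mult W (\<lambda>p. frechet_derivative g (at p) (X p)) u"
proof
  fix f
  show "dist_lie W X (dist_mult W g u) f =
    (dist_mult W g (dist_lie W X u) + dist_mult W (\<lambda>p. frechet_derivative g (at p) (X p)) u) f"
  proof (cases "smooth_on W f")
    case True
    let ?Xf = "\<lambda>p. frechet_derivative f (at p) (X p)" and ?Xg = "\<lambda>p. frechet_derivative g (at p) (X p)"
    have s: "smooth_on W ?Xf" "smooth_on W ?Xg" "smooth_on W (\<lambda>p. g p * f p)"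
      using smooth_on_frechet_derivative_field[OF assms(1) _ assms(4)] smooth_on_mult[OF assms(1,3)] True assms(3)
      by blast+
    have "u (\<lambda>p. frechet_derivative (\<lambda>p. g p * f p) (at p) (X p)) = u (\<lambda>p. g p * ?Xf p + ?Xg p * f p)"
      by (rule smooth_functional_cong[OF assms(2,1)], rule frechet_derivative_mult)
        (use True assms(3) smooth_on_differentiable in blast)+
    also have "\<dots> = u (\<lambda>p. g p * ?Xf p) + u (\<lambda>p. ?Xg p * f p)"
      by (intro smooth_functional_add[OF assms(2)] smooth_on_mult assms s True)
    finally show ?thesis using s True by (simp add: dist_lie_def dist_mult_def)
  qed (simp add: dist_lie_def dist_mult_def)
qed

section \<open>Contraction and the Chevalley-Eilenberg differential\<close>

lemma ce_cochains_linear_Cons: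
  assumes "\<omega> \<in> ce_cochains M"
  shows "linear (\<lambda>v. \<omega> (v # ys))"
proof -
  have "linear (\<lambda>v. \<omega> ((0 # ys)[0 := v]))"
    using assms unfolding ce_cochains_def by (simp del: list_update.simps)
  then show ?thesis by simp
qed

lemma ce_cochains_alternating:
  assumes "\<omega> \<in> ce_cochains M"
  shows "\<omega> (a # a # ys) = 0"
proof -
  have "\<forall>xs i j. i < j \<and> j < length xs \<and> xs ! i = xs ! j \<longrightarrow> \<omega> xs = 0"
    using assms unfolding ce_cochains_def by blast
  from this[rule_format, of 0 1 "a # a # ys"] show ?thesis by simp
qed

lemma ce_cochains_swap:
  assumes "\<omega> \<in> ce_cochains M"
  shows "\<omega> (a # b # ys) = - \<omega> (b # a # ys)"
proof -
  have l1: "linear (\<lambda>v. \<omega> (v # zs))" for zs using ce_cochains_linear_Cons[OF assms] .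
  have l2: "linear (\<lambda>v. \<omega> (c # v # ys))" for c
  proof -
    have "linear (\<lambda>v. \<omega> ((c # 0 # ys)[1 := v]))"
      using assms unfolding ce_cochains_def by (simp del: list_update.simps)
    then show ?thesis by simp
  qed
  have "\<omega> ((a + b) # (a + b) # ys) = 0" using ce_cochains_alternating[OF assms] .
  then have "\<omega> (a # a # ys) + \<omega> (b # a # ys) + (\<omega> (a # b # ys) + \<omega> (b # b # ys)) = 0"
    by (simp only: linear_add[OF l1] linear_add[OF l2])
  then have "\<omega> (b # a # ys) + \<omega> (a # b # ys) = 0"
    by (simp only: ce_cochains_alternating[OF assms] add_0 add_0_right)
  then show ?thesis using eq_neg_iff_add_eq_0 add.commute by metis
qed

text \<open>Contraction inserts a basis vector in front, so the terms are sorted by what happens to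
  the first argument: it acts, is carried along, or is bracketed. Shifting one index by 1 gives the
  minus signs of the two single sums; in the double sum both indices shift and the sign
  stays.\<close>

lemma ce_d_Cons:
  "ce_d br act \<omega> (x # xs) =
    act x (\<omega> xs) - (\<Sum>i<length xs. (-1) ^ i *\<^sub>R act (xs ! i) (\<omega> (x # nths xs (- {i})))) -
    (\<Sum>j<length xs. (-1) ^ j *\<^sub>R \<omega> (br x (xs ! j) # nths xs (- {j}))) +
    (\<Sum>j<length xs. \<Sum>i<j. (-1) ^ (i + j) *\<^sub>R \<omega> (br (xs ! i) (xs ! j) # x # nths xs (- {i, j})))"
proof -
  have e: "{j. Suc j \<in> - {0::nat}} = UNIV" "\<And>i. {j. Suc j \<in> - {Suc i}} = - {i}"
    "\<And>i. {j. Suc j \<in> - {0, Suc i}} = - {i}" "\<And>i k. {j. Suc j \<in> - {Suc i, Suc k}} = - {i, k}"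
    by auto
  show ?thesis
    unfolding ce_d_def length_Cons sum.lessThan_Suc_shift nths_Cons e
    by (simp add: sum.distrib sum_negf sum_subtractf nths_all algebra_simps)
qed

lemma representation_linear:
  assumes "independent B" "span B = UNIV"
  shows "linear (\<lambda>v. representation B v \<xi>)"
  using assms by (intro linearI) (simp_all add: real_vector.representation_add real_vector.representation_scale)

lemma sum_representation:
  fixes B :: "'a::euclidean_space set"
  assumes "independent B" "span B = UNIV"
  shows "(\<Sum>\<xi>\<in>B. representation B v \<xi> *\<^sub>R \<xi>) = v"
  using assms independent_imp_finite[OF assms(1)] by (intro real_vector.sum_representation_eq) auto

text \<open>Equivariance of \<open>b\<close> is asked only in the directions listed in
  \<open>xs\<close>. It will be available for diagonal elements, and the pullback to the diagonal
  evaluates cochains on just these.\<close>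

lemma d_commutator_contraction:
  fixes br :: "'a::euclidean_space \<Rightarrow> 'a \<Rightarrow> 'a"
  assumes br: "bilinear br" and W: "open W"
    and B: "independent B" "span B = UNIV"
    and b: "smooth_on W b"
    and equi: "\<And>x p. x \<in> set xs \<Longrightarrow> p \<in> W \<Longrightarrow> frechet_derivative b (at p) (br p x) = br (b p) x"
    and \<omega>: "\<omega> \<in> ce_cochains M" and M: "\<And>u. u \<in> M \<Longrightarrow> smooth_functional W u"
  shows "d_commutator (ce_d_dist br W) (ce_d_dist br W) (contraction W B b) \<omega> xs = lie_along br W B b (\<omega> xs)"
proof -
  define c where "c = (\<lambda>\<xi> p. representation B (b p) \<xi>)"
  define m where "m = (\<lambda>\<xi>. dist_mult W (c \<xi>))"
  define L where "L = ad_lie br W"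
  define y where "y = (\<lambda>i. nths xs (- {i}))"
  define z where "z = (\<lambda>i j. nths xs (- {i, j}))"
  define n where "n = length xs"
  have finB: "finite B" using B(1) independent_imp_finite by blast
  have blrep: "bounded_linear (\<lambda>v. representation B v \<xi>)" for \<xi>
    using representation_linear[OF B] linear_conv_bounded_linear by blast
  have sc: "smooth_on W (c \<xi>)" for \<xi>
    unfolding c_def by (rule smooth_on_linear[OF blrep W b])
  have sX: "smooth_on W (\<lambda>p. br p x)" for x
  proof -
    have "linear (\<lambda>p. br p x)" using br unfolding bilinear_def by blast
    then show ?thesis using linear_conv_bounded_linear bounded_linear_smooth_on W by blast
  qed
  have sf: "smooth_functional W (\<omega> ys)" for ys
    using \<omega> M unfolding ce_cochains_def by blast
  have lin: "linear (\<lambda>v. \<omega> (v # ys))" for ys using ce_cochains_linear_Cons[OF \<omega>] .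
  have Lm: "L x (m \<xi> u) = m \<xi> (L x u) + dist_mult W (\<lambda>p. frechet_derivative (c \<xi>) (at p) (br p x)) u"
    if "smooth_functional W u" for x \<xi> u
    unfolding L_def ad_lie_def m_def by (rule dist_lie_dist_mult[OF W that sc sX])
  have Dc: "frechet_derivative (c \<xi>) (at p) (br p x) = (\<Sum>\<eta>\<in>B. representation B (br \<eta> x) \<xi> * c \<eta> p)"
    if "x \<in> set xs" "p \<in> W" for \<xi> x p
  proof -
    have "(c \<xi> has_derivative (\<lambda>v. representation B (frechet_derivative b (at p) v) \<xi>)) (at p)"
      unfolding c_def using smooth_on_has_derivative[OF b that(2)] by (rule bounded_linear.has_derivative[OF blrep])
    from frechet_derivative_at[OF this]
    have "frechet_derivative (c \<xi>) (at p) (br p x) = representation B (br (b p) x) \<xi>"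
      using equi[OF that] by metis
    also have "br (b p) x = br (\<Sum>\<eta>\<in>B. c \<eta> p *\<^sub>R \<eta>) x"
      unfolding c_def sum_representation[OF B] ..
    also have "\<dots> = (\<Sum>\<eta>\<in>B. c \<eta> p *\<^sub>R br \<eta> x)"
    proof -
      have l: "linear (\<lambda>p. br p x)" using br unfolding bilinear_def by blast
      show ?thesis by (simp only: linear_sum[OF l] linear_cmul[OF l])
    qed
    also have "representation B \<dots> \<xi> = (\<Sum>\<eta>\<in>B. c \<eta> p * representation B (br \<eta> x) \<xi>)"
      by (simp only: linear_sum[OF representation_linear[OF B]] linear_cmul[OF representation_linear[OF B]] real_scaleR_def)
    finally show ?thesis by (simp add: mult.commute)
  qed
  \<comment> \<open>By \<open>Dc\<close>, differentiating the coefficients applies the matrix of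
    bracketing with \<open>x\<close>. Exchanging the two sums moves this matrix from the
    coefficients to the basis vectors, so the Leibniz terms become bracket terms.\<close>
  have K: "(\<Sum>\<xi>\<in>B. dist_mult W (\<lambda>p. frechet_derivative (c \<xi>) (at p) (br p x)) (\<omega> (\<xi> # ys))) =
      (\<Sum>\<xi>\<in>B. m \<xi> (\<omega> (br \<xi> x # ys)))" if "x \<in> set xs" for x ys
  proof -
    have "(\<Sum>\<xi>\<in>B. dist_mult W (\<lambda>p. frechet_derivative (c \<xi>) (at p) (br p x)) (\<omega> (\<xi> # ys))) =
      (\<Sum>\<xi>\<in>B. \<Sum>\<eta>\<in>B. representation B (br \<eta> x) \<xi> *\<^sub>R m \<eta> (\<omega> (\<xi> # ys)))"
    proof (rule sum.cong[OF refl])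
      fix \<xi>
      have "dist_mult W (\<lambda>p. frechet_derivative (c \<xi>) (at p) (br p x)) (\<omega> (\<xi> # ys)) =
        dist_mult W (\<lambda>p. \<Sum>\<eta>\<in>B. representation B (br \<eta> x) \<xi> * c \<eta> p) (\<omega> (\<xi> # ys))"
        by (rule dist_mult_cong[OF sf W Dc[OF that]])
      then show "dist_mult W (\<lambda>p. frechet_derivative (c \<xi>) (at p) (br p x)) (\<omega> (\<xi> # ys)) =
        (\<Sum>\<eta>\<in>B. representation B (br \<eta> x) \<xi> *\<^sub>R m \<eta> (\<omega> (\<xi> # ys)))"
        unfolding m_def using dist_mult_sum_left[OF sf W sc] by simp
    qed
    also have "\<dots> = (\<Sum>\<eta>\<in>B. \<Sum>\<xi>\<in>B. representation B (br \<eta> x) \<xi> *\<^sub>R m \<eta> (\<omega> (\<xi> # ys)))"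
      by (rule sum.swap)
    also have "\<dots> = (\<Sum>\<eta>\<in>B. m \<eta> (\<omega> (br \<eta> x # ys)))"
    proof (rule sum.cong[OF refl])
      fix \<eta>
      have "\<omega> (br \<eta> x # ys) = \<omega> ((\<Sum>\<xi>\<in>B. representation B (br \<eta> x) \<xi> *\<^sub>R \<xi>) # ys)"
        by (simp only: sum_representation[OF B])
      also have "\<dots> = (\<Sum>\<xi>\<in>B. representation B (br \<eta> x) \<xi> *\<^sub>R \<omega> (\<xi> # ys))"
        by (simp only: linear_sum[OF lin] linear_cmul[OF lin])
      finally show "(\<Sum>\<xi>\<in>B. representation B (br \<eta> x) \<xi> *\<^sub>R m \<eta> (\<omega> (\<xi> # ys))) = m \<eta> (\<omega> (br \<eta> x # ys))"
        unfolding m_def by (simp only: dist_mult_sum dist_mult_scaleR)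
    qed
    finally show ?thesis .
  qed
  \<comment> \<open>\<open>P\<close> collects the action terms, \<open>Q\<close> the brackets with
    the contracted vector, \<open>R\<close> the brackets among the arguments. \<open>P\<close> and
    \<open>R\<close> cancel by signs alone. The \<open>Q\<close> of one summand comes from the
    Leibniz terms via \<open>K\<close>, that of the other from the differential: this is where
    equivariance enters.\<close>
  define P where "P = (\<lambda>i \<xi>. (-1) ^ i *\<^sub>R m \<xi> (L (xs ! i) (\<omega> (\<xi> # y i))))"
  define Q where "Q = (\<lambda>i \<xi>. (-1) ^ i *\<^sub>R m \<xi> (\<omega> (br \<xi> (xs ! i) # y i)))"
  define R where "R = (\<lambda>j i \<xi>. (-1) ^ (i + j) *\<^sub>R m \<xi> (\<omega> (br (xs ! i) (xs ! j) # \<xi> # z i j)))"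
  have contr: "contraction W B b \<eta> ys = (\<Sum>\<xi>\<in>B. m \<xi> (\<eta> (\<xi> # ys)))" for \<eta> ys
    unfolding contraction_def m_def c_def ..
  have "(-1) ^ i *\<^sub>R L (xs ! i) (\<Sum>\<xi>\<in>B. m \<xi> (\<omega> (\<xi> # y i))) = (\<Sum>\<xi>\<in>B. P i \<xi> + Q i \<xi>)" if "i < n" for i
  proof -
    have "L (xs ! i) (\<Sum>\<xi>\<in>B. m \<xi> (\<omega> (\<xi> # y i))) = (\<Sum>\<xi>\<in>B. L (xs ! i) (m \<xi> (\<omega> (\<xi> # y i))))"
      unfolding L_def ad_lie_def by (rule dist_lie_sum)
    also have "\<dots> = (\<Sum>\<xi>\<in>B. m \<xi> (L (xs ! i) (\<omega> (\<xi> # y i))) + m \<xi> (\<omega> (br \<xi> (xs ! i) # y i)))"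
      using K[of "xs ! i" "y i"] that by (simp only: Lm[OF sf] sum.distrib n_def nth_mem)
    finally show ?thesis by (simp only: P_def Q_def scaleR_sum_right scaleR_add_right)
  qed
  moreover have "(-1) ^ (i + j) *\<^sub>R (\<Sum>\<xi>\<in>B. m \<xi> (\<omega> (\<xi> # br (xs ! i) (xs ! j) # z i j))) = (\<Sum>\<xi>\<in>B. - R j i \<xi>)" for i j
    by (simp only: R_def ce_cochains_swap[OF \<omega>, of _ "br (xs ! i) (xs ! j)"] m_def dist_mult_minus
        scaleR_sum_right scaleR_minus_right)
  ultimately have T1: "ce_d_dist br W (contraction W B b \<omega>) xs =
      (\<Sum>i<n. \<Sum>\<xi>\<in>B. P i \<xi> + Q i \<xi>) + (\<Sum>j<n. \<Sum>i<j. \<Sum>\<xi>\<in>B. - R j i \<xi>)"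
    unfolding ce_d_dist_def ce_d_def contr by (simp add: n_def y_def z_def L_def del: plus_fun_apply)
  have T2: "contraction W B b (ce_d_dist br W \<omega>) xs =
      (\<Sum>\<xi>\<in>B. m \<xi> (L \<xi> (\<omega> xs)) - (\<Sum>i<n. P i \<xi>) - (\<Sum>i<n. Q i \<xi>) + (\<Sum>j<n. \<Sum>i<j. R j i \<xi>))"
    unfolding contr ce_d_dist_def ce_d_Cons m_def
    by (simp only: dist_mult_plus dist_mult_diff dist_mult_sum dist_mult_scaleR P_def Q_def R_def m_def
        n_def y_def z_def L_def)
  have sP: "(\<Sum>\<xi>\<in>B. \<Sum>i<n. P i \<xi>) = (\<Sum>i<n. \<Sum>\<xi>\<in>B. P i \<xi>)"
    and sQ: "(\<Sum>\<xi>\<in>B. \<Sum>i<n. Q i \<xi>) = (\<Sum>i<n. \<Sum>\<xi>\<in>B. Q i \<xi>)" by (rule sum.swap)+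
  have sR: "(\<Sum>\<xi>\<in>B. \<Sum>j<n. \<Sum>i<j. R j i \<xi>) = (\<Sum>j<n. \<Sum>i<j. \<Sum>\<xi>\<in>B. R j i \<xi>)"
    by (subst sum.swap) (intro sum.cong refl sum.swap)
  have "ce_d_dist br W (contraction W B b \<omega>) xs + contraction W B b (ce_d_dist br W \<omega>) xs =
      (\<Sum>\<xi>\<in>B. m \<xi> (L \<xi> (\<omega> xs)))"
    unfolding T1 T2 sum.distrib sum_subtractf sum_negf sP sQ sR by (simp add: algebra_simps del: plus_fun_apply)
  then show ?thesis
    unfolding d_commutator_def lie_along_def m_def c_def L_def by simp
qed

section \<open>Smooth maps into and out of a Lie group\<close>

lemma smooth_atlas_chartD:
  assumes "smooth_atlas A" "(V, \<phi>) \<in> A"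
  shows "open V" "open (\<phi> ` V)" "continuous_on V \<phi>" "continuous_on (\<phi> ` V) (inv_into V \<phi>)"
    "\<And>x. x \<in> V \<Longrightarrow> inv_into V \<phi> (\<phi> x) = x" "\<And>y. y \<in> \<phi> ` V \<Longrightarrow> inv_into V \<phi> y \<in> V"
    "\<And>y. y \<in> \<phi> ` V \<Longrightarrow> \<phi> (inv_into V \<phi> y) = y"
proof -
  have *: "open V \<and> open (\<phi> ` V) \<and> homeomorphism V (\<phi> ` V) \<phi> (inv_into V \<phi>)"
    using assms unfolding smooth_atlas_def by blast
  then show "open V" "open (\<phi> ` V)" by auto
  from * have h: "homeomorphism V (\<phi> ` V) \<phi> (inv_into V \<phi>)" by auto
  then show "continuous_on V \<phi>" "continuous_on (\<phi> ` V) (inv_into V \<phi>)"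
    "\<And>x. x \<in> V \<Longrightarrow> inv_into V \<phi> (\<phi> x) = x"
    unfolding homeomorphism_def by auto
  show "\<And>y. y \<in> \<phi> ` V \<Longrightarrow> inv_into V \<phi> y \<in> V" "\<And>y. y \<in> \<phi> ` V \<Longrightarrow> \<phi> (inv_into V \<phi> y) = y"
    by (auto simp: inv_into_into f_inv_into_f)
qed

lemma smooth_atlas_cover:
  assumes "smooth_atlas A"
  obtains V \<phi> where "(V, \<phi>) \<in> A" "x \<in> V"
proof -
  have "x \<in> (\<Union>(V, \<phi>)\<in>A. V)" using assms unfolding smooth_atlas_def by auto
  then show ?thesis using that by auto
qed

lemma smooth_into_continuous_on: "smooth_into A S h \<Longrightarrow> continuous_on S h"
  unfolding smooth_into_def by blast

lemma smooth_intoD: "smooth_into A S h \<Longrightarrow> (V, \<phi>) \<in> A \<Longrightarrow> smooth_on (S \<inter> h -` V) (\<lambda>a. \<phi> (h a))"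
  unfolding smooth_into_def by blast

lemma smooth_into_compose:
  fixes h :: "'b::euclidean_space \<Rightarrow> 'g::topological_space"
  assumes A: "smooth_atlas A" and h: "smooth_into A T h" "open T"
    and q: "open S" "smooth_on S q" "\<And>x. x \<in> S \<Longrightarrow> q x \<in> T"
  shows "smooth_into A S (\<lambda>x. h (q x))"
  unfolding smooth_into_def
proof (intro conjI ballI, goal_cases)
  case 1
  show c: ?case
    by (rule continuous_on_compose2[OF smooth_into_continuous_on[OF h(1)] smooth_on_continuous_on[OF q(2)]])
      (use q(3) in auto)
  case (2 a)
  obtain V \<phi> where a: "a = (V, \<phi>)" by (cases a)
  then have V: "(V, \<phi>) \<in> A" using 2 by simp
  have o1: "open (T \<inter> h -` V)"
    by (rule continuous_open_preimage[OF smooth_into_continuous_on[OF h(1)] h(2) smooth_atlas_chartD(1)[OF A V]])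
  have o2: "open (S \<inter> (\<lambda>x. h (q x)) -` V)"
    by (rule continuous_open_preimage[OF c q(1) smooth_atlas_chartD(1)[OF A V]])
  have "smooth_on (S \<inter> (\<lambda>x. h (q x)) -` V) (\<lambda>a. \<phi> (h (q a)))"
    by (rule smooth_on_compose[OF o2 o1 _ smooth_on_subset[OF q(2)] smooth_intoD[OF h(1) V]])
      (use q(3) in auto)
  then show ?case by (simp add: a)
qed

lemma smooth_on_smooth_from:
  fixes h :: "'b::euclidean_space \<Rightarrow> 'g::topological_space"
  assumes A: "smooth_atlas A" and f: "smooth_from A T f" "open T"
    and h: "open S" "smooth_into A S h" "\<And>x. x \<in> S \<Longrightarrow> h x \<in> T"
  shows "smooth_on S (\<lambda>x. f (h x))"
proof (rule smooth_on_local)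
  fix x assume x: "x \<in> S"
  obtain V \<phi> where V: "(V, \<phi>) \<in> A" "h x \<in> V" using smooth_atlas_cover[OF A] .
  note D = smooth_atlas_chartD[OF A V(1)]
  have o: "open (S \<inter> h -` V)"
    by (rule continuous_open_preimage[OF smooth_into_continuous_on[OF h(2)] h(1) D(1)])
  have eq: "\<phi> ` (V \<inter> T) = \<phi> ` V \<inter> inv_into V \<phi> -` T"
    using D(5) by (auto simp: image_iff)
  have o2: "open (\<phi> ` (V \<inter> T))"
    unfolding eq by (rule continuous_open_preimage[OF D(4,2) f(2)])
  have sf: "smooth_on (\<phi> ` (V \<inter> T)) (\<lambda>a. f (inv_into V \<phi> a))"
    using f(1) V(1) unfolding smooth_from_def by blast
  have "smooth_on (S \<inter> h -` V) (\<lambda>a. f (inv_into V \<phi> (\<phi> (h a))))"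
    by (rule smooth_on_compose[OF o o2 _ smooth_intoD[OF h(2) V(1)] sf]) (use h(3) in auto)
  then have "smooth_on (S \<inter> h -` V) (\<lambda>a. f (h a))"
    by (rule smooth_on_cong_imp[OF o]) (use D(5) in auto)
  with x V(2) show "\<exists>T. x \<in> T \<and> smooth_on T (\<lambda>x. f (h x))"
    by (intro exI[of _ "S \<inter> h -` V"]) simp
qed

lemma smooth_into_const: "smooth_into A S (\<lambda>x. k)"
  unfolding smooth_into_def by (auto intro: smooth_on_const)

lemma smooth_into_chart_inverse:
  assumes A: "smooth_atlas A" and V: "(V, \<phi>) \<in> A"
  shows "smooth_into A (\<phi> ` V) (inv_into V \<phi>)"
proof -
  note D = smooth_atlas_chartD[OF A V]
  have eq: "\<phi> ` (V \<inter> W) = \<phi> ` V \<inter> inv_into V \<phi> -` W" for W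
    using D(5) by (auto simp: image_iff)
  show ?thesis
    unfolding smooth_into_def eq[symmetric]
    using A V D(4) unfolding smooth_atlas_def by fastforce
qed

lemma smooth_into_cong:
  assumes A: "smooth_atlas A" and "open S" "smooth_into A S h" "\<And>x. x \<in> S \<Longrightarrow> h x = k x"
  shows "smooth_into A S k"
  unfolding smooth_into_def
proof (intro conjI ballI, goal_cases)
  case 1
  then show ?case using smooth_into_continuous_on[OF assms(3)] assms(4) continuous_on_cong by metis
next
  case (2 a)
  obtain V \<phi> where a: "a = (V, \<phi>)" by (cases a)
  then have V: "(V, \<phi>) \<in> A" using 2 by simp
  have eq: "S \<inter> k -` V = S \<inter> h -` V" using assms(4) by auto
  have o: "open (S \<inter> h -` V)"
    by (rule continuous_open_preimage[OF smooth_into_continuous_on[OF assms(3)] assms(2) smooth_atlas_chartD(1)[OF A V]])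
  have "smooth_on (S \<inter> h -` V) (\<lambda>a. \<phi> (k a))"
    by (rule smooth_on_cong_imp[OF o smooth_intoD[OF assms(3) V]]) (use assms(4) in auto)
  then show ?case by (simp add: a eq)
qed

lemma smooth_into_local:
  assumes "open S" "\<And>x. x \<in> S \<Longrightarrow> \<exists>T. open T \<and> x \<in> T \<and> smooth_into A T h"
  shows "smooth_into A S h"
  unfolding smooth_into_def
proof (intro conjI ballI, goal_cases)
  case 1
  have "isCont h x" if "x \<in> S" for x
    using assms(2)[OF that] smooth_into_continuous_on continuous_on_eq_continuous_at by blast
  then show ?case by (rule continuous_at_imp_continuous_on[OF ballI])
next
  case (2 a)
  obtain V \<phi> where a: "a = (V, \<phi>)" by (cases a)
  then have V: "(V, \<phi>) \<in> A" using 2 by simp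
  have "smooth_on (S \<inter> h -` V) (\<lambda>a. \<phi> (h a))"
  proof (rule smooth_on_local)
    fix x assume x: "x \<in> S \<inter> h -` V"
    then obtain T where "x \<in> T" "smooth_into A T h" using assms(2) by blast
    then show "\<exists>T. x \<in> T \<and> smooth_on T (\<lambda>a. \<phi> (h a))"
      using smooth_intoD[OF _ V, of T h] x by (intro exI[of _ "T \<inter> h -` V"]) simp
  qed
  then show ?case by (simp add: a)
qed

lemma smooth_from_continuous_on:
  fixes f :: "'g::t2_space \<Rightarrow> 'b::real_normed_vector"
  assumes A: "smooth_atlas A" and f: "smooth_from A T f" and T: "open T"
  shows "continuous_on T f"
proof (rule continuous_at_imp_continuous_on, rule ballI)
  fix x assume x: "x \<in> T"
  obtain V \<phi> where V: "(V, \<phi>) \<in> A" "x \<in> V" using smooth_atlas_cover[OF A] .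
  note D = smooth_atlas_chartD[OF A V(1)]
  have "smooth_on (\<phi> ` (V \<inter> T)) (\<lambda>a. f (inv_into V \<phi> a))"
    using f V(1) unfolding smooth_from_def by blast
  then have "continuous_on (V \<inter> T) (\<lambda>y. f (inv_into V \<phi> (\<phi> y)))"
    by (intro continuous_on_compose2[OF smooth_on_continuous_on continuous_on_subset[OF D(3)]]) auto
  then have "continuous_on (V \<inter> T) f"
    by (rule continuous_on_cong[THEN iffD1, rotated 2]) (use D(5) in auto)
  then show "isCont f x"
    using x V(2) D(1) T by (meson IntI continuous_on_eq_continuous_at open_Int)
qed

section \<open>Smoothness and continuity of the group operations\<close>

context
  fixes A :: "('g::{t2_space,second_countable_topology} set \<times> ('g \<Rightarrow> 'v::euclidean_space)) set"
    and mul e iv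
  assumes G: "lie_group A mul e iv"
begin

lemma lie_group_atlas: "smooth_atlas A"
  using G unfolding lie_group_def by blast

text \<open>Smoothness of the multiplication is given in charts of the source only. Near each point
  \<open>h\<close> and \<open>k\<close> are read in such charts, and the local statements are
  glued.\<close>

lemma smooth_into_mul:
  fixes h k :: "'b::euclidean_space \<Rightarrow> 'g"
  assumes S: "open S" and h: "smooth_into A S h" and k: "smooth_into A S k"
  shows "smooth_into A S (\<lambda>x. mul (h x) (k x))"
proof (rule smooth_into_local[OF S])
  fix x assume x: "x \<in> S"
  obtain V \<phi> where V: "(V, \<phi>) \<in> A" "h x \<in> V" using smooth_atlas_cover[OF lie_group_atlas] .
  obtain W \<psi> where W: "(W, \<psi>) \<in> A" "k x \<in> W" using smooth_atlas_cover[OF lie_group_atlas] .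
  note DV = smooth_atlas_chartD[OF lie_group_atlas V(1)]
  note DW = smooth_atlas_chartD[OF lie_group_atlas W(1)]
  have M: "smooth_into A ((\<phi> ` V) \<times> (\<psi> ` W)) (\<lambda>(a, b). mul (inv_into V \<phi> a) (inv_into W \<psi> b))"
    using G V(1) W(1) unfolding lie_group_def by blast
  define T where "T = (S \<inter> h -` V) \<inter> (S \<inter> k -` W)"
  have oT: "open T" unfolding T_def
    by (intro open_Int continuous_open_preimage smooth_into_continuous_on[OF h] smooth_into_continuous_on[OF k]
        S DV(1) DW(1))
  have "smooth_on T (\<lambda>a. (\<phi> (h a), \<psi> (k a)))"
    by (rule smooth_on_Pair[OF oT smooth_on_subset[OF smooth_intoD[OF h V(1)]] smooth_on_subset[OF smooth_intoD[OF k W(1)]]])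
      (auto simp: T_def)
  from smooth_into_compose[OF lie_group_atlas M open_Times[OF DV(2) DW(2)] oT this]
  have "smooth_into A T (\<lambda>a. mul (inv_into V \<phi> (\<phi> (h a))) (inv_into W \<psi> (\<psi> (k a))))"
    by (auto simp: T_def)
  then have "smooth_into A T (\<lambda>a. mul (h a) (k a))"
    by (rule smooth_into_cong[OF lie_group_atlas oT]) (use DV(5) DW(5) in \<open>auto simp: T_def\<close>)
  then show "\<exists>T. open T \<and> x \<in> T \<and> smooth_into A T (\<lambda>a. mul (h a) (k a))"
    using oT x V(2) W(2) by (auto simp: T_def)
qed

lemma smooth_into_iv:
  fixes h :: "'b::euclidean_space \<Rightarrow> 'g"
  assumes S: "open S" and h: "smooth_into A S h"
  shows "smooth_into A S (\<lambda>x. iv (h x))"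
proof (rule smooth_into_local[OF S])
  fix x assume x: "x \<in> S"
  obtain V \<phi> where V: "(V, \<phi>) \<in> A" "h x \<in> V" using smooth_atlas_cover[OF lie_group_atlas] .
  note DV = smooth_atlas_chartD[OF lie_group_atlas V(1)]
  have M: "smooth_into A (\<phi> ` V) (\<lambda>a. iv (inv_into V \<phi> a))"
    using G V(1) unfolding lie_group_def by blast
  define T where "T = S \<inter> h -` V"
  have oT: "open T" unfolding T_def
    by (intro continuous_open_preimage smooth_into_continuous_on[OF h] S DV(1))
  have "smooth_on T (\<lambda>a. \<phi> (h a))" unfolding T_def by (rule smooth_intoD[OF h V(1)])
  from smooth_into_compose[OF lie_group_atlas M DV(2) oT this]
  have "smooth_into A T (\<lambda>a. iv (inv_into V \<phi> (\<phi> (h a))))"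
    by (auto simp: T_def)
  then have "smooth_into A T (\<lambda>a. iv (h a))"
    by (rule smooth_into_cong[OF lie_group_atlas oT]) (use DV(5) in \<open>auto simp: T_def\<close>)
  then show "\<exists>T. open T \<and> x \<in> T \<and> smooth_into A T (\<lambda>a. iv (h a))"
    using oT x V(2) by (auto simp: T_def)
qed

lemma smooth_from_translate:
  assumes f: "smooth_from A UNIV f"
  shows "smooth_from A UNIV (\<lambda>g. f (mul (mul k g) l))"
  unfolding smooth_from_def
proof (clarify)
  fix V \<phi> assume V: "(V, \<phi>) \<in> A"
  note DV = smooth_atlas_chartD[OF lie_group_atlas V]
  show "smooth_on (\<phi> ` (V \<inter> UNIV)) (\<lambda>a. f (mul (mul k (inv_into V \<phi> a)) l))"
    using smooth_on_smooth_from[OF lie_group_atlas f open_UNIV DV(2)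
        smooth_into_mul[OF DV(2) smooth_into_mul[OF DV(2) smooth_into_const
          smooth_into_chart_inverse[OF lie_group_atlas V]] smooth_into_const]]
    by simp
qed

text \<open>Continuity is recorded separately because the curves t -> E (t x) are given as
  continuous curves, while smoothness of \<open>E\<close> is known only on \<open>U\<close>;
  conjugation must be followed along such curves outside \<open>U\<close>.\<close>

lemma continuous_on_lie_group_mul: "continuous_on UNIV (\<lambda>p. mul (fst p) (snd p))"
proof (rule continuous_at_imp_continuous_on, rule ballI)
  fix p :: "'g \<times> 'g"
  obtain V \<phi> where V: "(V, \<phi>) \<in> A" "fst p \<in> V" using smooth_atlas_cover[OF lie_group_atlas] .
  obtain W \<psi> where W: "(W, \<psi>) \<in> A" "snd p \<in> W" using smooth_atlas_cover[OF lie_group_atlas] .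
  note DV = smooth_atlas_chartD[OF lie_group_atlas V(1)]
  note DW = smooth_atlas_chartD[OF lie_group_atlas W(1)]
  have M: "smooth_into A ((\<phi> ` V) \<times> (\<psi> ` W)) (\<lambda>(a, b). mul (inv_into V \<phi> a) (inv_into W \<psi> b))"
    using G V(1) W(1) unfolding lie_group_def by blast
  have c: "continuous_on (V \<times> W) (\<lambda>p. (\<phi> (fst p), \<psi> (snd p)))"
    by (intro continuous_on_Pair continuous_on_compose2[OF DV(3) continuous_on_fst[OF continuous_on_id]]
        continuous_on_compose2[OF DW(3) continuous_on_snd[OF continuous_on_id]]) auto
  have "continuous_on (V \<times> W) (\<lambda>p. mul (inv_into V \<phi> (\<phi> (fst p))) (inv_into W \<psi> (\<psi> (snd p))))"
    using continuous_on_compose2[OF smooth_into_continuous_on[OF M] c] by (simp add: image_subset_iff)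
  then have "continuous_on (V \<times> W) (\<lambda>p. mul (fst p) (snd p))"
    by (rule continuous_on_cong[THEN iffD1, rotated 2]) (use DV(5) DW(5) in auto)
  moreover have "p \<in> V \<times> W" using V(2) W(2) by (cases p) auto
  ultimately show "isCont (\<lambda>p. mul (fst p) (snd p)) p"
    using open_Times[OF DV(1) DW(1)] continuous_on_eq_continuous_at by blast
qed

lemma continuous_on_lie_group_iv: "continuous_on UNIV iv"
proof (rule continuous_at_imp_continuous_on, rule ballI)
  fix p
  obtain V \<phi> where V: "(V, \<phi>) \<in> A" "p \<in> V" using smooth_atlas_cover[OF lie_group_atlas] .
  note DV = smooth_atlas_chartD[OF lie_group_atlas V(1)]
  have M: "smooth_into A (\<phi> ` V) (\<lambda>a. iv (inv_into V \<phi> a))"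
    using G V(1) unfolding lie_group_def by blast
  have "continuous_on V (\<lambda>p. iv (inv_into V \<phi> (\<phi> p)))"
    by (rule continuous_on_compose2[OF smooth_into_continuous_on[OF M] DV(3)]) auto
  then have "continuous_on V iv"
    by (rule continuous_on_cong[THEN iffD1, rotated 2]) (use DV(5) in auto)
  then show "isCont iv p"
    using DV(1) V(2) continuous_on_eq_continuous_at by blast
qed

lemma continuous_on_mul:
  "continuous_on S h \<Longrightarrow> continuous_on S k \<Longrightarrow> continuous_on S (\<lambda>x. mul (h x) (k x))"
  using continuous_on_compose2[OF continuous_on_lie_group_mul continuous_on_Pair] by auto

lemma continuous_on_iv: "continuous_on S h \<Longrightarrow> continuous_on S (\<lambda>x. iv (h x))"
  using continuous_on_compose2[OF continuous_on_lie_group_iv] by auto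

end

section \<open>The adjoint action of a Lie group\<close>

lemma smooth_from_lincomb:
  fixes f h :: "'g::topological_space \<Rightarrow> real"
  assumes "smooth_atlas A" "smooth_from A UNIV f" "smooth_from A UNIV h"
  shows "smooth_from A UNIV (\<lambda>g. a * f g + b * h g)"
  unfolding smooth_from_def
proof (clarify)
  fix V \<phi> assume V: "(V, \<phi>) \<in> A"
  have o: "open (\<phi> ` (V \<inter> UNIV))" using smooth_atlas_chartD(2)[OF assms(1) V] by simp
  show "smooth_on (\<phi> ` (V \<inter> UNIV)) (\<lambda>x. a * f (inv_into V \<phi> x) + b * h (inv_into V \<phi> x))"
    by (intro smooth_on_add smooth_on_mult smooth_on_const o)
      (use assms(2,3) V in \<open>auto simp: smooth_from_def\<close>)
qed

locale lie_group_exp =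
  fixes br :: "'a::euclidean_space \<Rightarrow> 'a \<Rightarrow> 'a"
    and A :: "('g::{t2_space,second_countable_topology} set \<times> ('g \<Rightarrow> 'v::euclidean_space)) set"
    and mul :: "'g \<Rightarrow> 'g \<Rightarrow> 'g" and e :: 'g and iv :: "'g \<Rightarrow> 'g"
    and lf :: "'a \<Rightarrow> ('g \<Rightarrow> real) \<Rightarrow> 'g \<Rightarrow> real"
    and E :: "'a \<Rightarrow> 'g" and U :: "'a set"
  assumes lie: "lie_algebra br" and G: "lie_group A mul e iv"
    and LA: "lie_algebra_of_group br A mul lf" and EXP: "lie_exp A e lf E"
    and star: "star_nbhd_0 U" and diffeo_E: "diffeo_onto_image A U E"
begin

abbreviation sm :: "('g \<Rightarrow> real) \<Rightarrow> bool" where "sm \<equiv> smooth_from A UNIV"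

sublocale G: group mul e iv using G unfolding lie_group_def by blast

lemma cancel: "mul g (mul (iv g) h) = h" "mul (iv g) (mul g h) = h"
  by (simp_all flip: G.assoc)

lemmas group_simps = G.assoc cancel G.inverse_distrib_swap

lemma atlas: "smooth_atlas A" using lie_group_atlas[OF G] .

lemma openU: "open U" and zeroU: "0 \<in> U"
  using star unfolding star_nbhd_0_def by auto

lemma lf_linear: "linear lf" and lf_bij: "bij_betw lf UNIV (left_invariant_fields A mul)"
  and lf_br: "sm f \<Longrightarrow> lf (br x y) f = lf x (lf y f) - lf y (lf x f)"
  using LA unfolding lie_algebra_of_group_def by auto

lemma lf_mem: "lf x \<in> left_invariant_fields A mul"
  using lf_bij bij_betwE by blast

lemma lf_nonsmooth: "\<not> sm f \<Longrightarrow> lf x f = 0"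
  and lf_smooth: "sm f \<Longrightarrow> sm (lf x f)"
  and lf_lincomb: "sm f \<Longrightarrow> sm h \<Longrightarrow> lf x (\<lambda>g. a * f g + b * h g) = (\<lambda>g. a * lf x f g + b * lf x h g)"
  and lf_leibniz: "sm f \<Longrightarrow> sm h \<Longrightarrow> lf x (\<lambda>g. f g * h g) = (\<lambda>g. lf x f g * h g + f g * lf x h g)"
  and lf_left: "sm f \<Longrightarrow> lf x (\<lambda>g. f (mul k g)) = (\<lambda>g. lf x f (mul k g))"
  using lf_mem[of x] unfolding left_invariant_fields_def by blast+

lemma lf_add: "lf (x + y) f k = lf x f k + lf y f k"
  using linear_add[OF lf_linear, of x y] by simp

lemma lf_scaleR: "lf (r *\<^sub>R x) f k = r * lf x f k"
  using linear_cmul[OF lf_linear, of r x] by (simp add: scaleR_fun_def)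

lemma lf_zero: "lf 0 f k = 0"
  using linear_0[OF lf_linear] by simp

text \<open>Reduces identities for \<open>Ad\<close> to identities of derivations, which are
  computations with translations. On nonsmooth functions both fields are 0 by convention.\<close>

lemma lf_eqI:
  assumes "\<And>f k. sm f \<Longrightarrow> lf x f k = lf y f k"
  shows "x = y"
proof -
  have "lf x = lf y"
  proof (intro ext)
    fix f k show "lf x f k = lf y f k"
      using assms lf_nonsmooth[of f x] lf_nonsmooth[of f y] by (cases "sm f") auto
  qed
  then show ?thesis using lf_bij unfolding bij_betw_def inj_on_def by blast
qed

lemma sm_left: "sm f \<Longrightarrow> sm (\<lambda>g. f (mul k g))"
  using smooth_from_translate[OF G, of f k e] by simp

lemma sm_right: "sm f \<Longrightarrow> sm (\<lambda>g. f (mul g k))"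
  using smooth_from_translate[OF G, of f e k] by simp

lemma sm_translate: "sm f \<Longrightarrow> sm (\<lambda>h. f (mul (mul k h) l))"
  by (rule smooth_from_translate[OF G])

text \<open>The push-forward of \<open>X\<close> under right translation by \<open>iv g\<close>. For
  left-invariant \<open>X\<close> it is also the push-forward under conjugation by
  \<open>g\<close>.\<close>

definition conj_field :: "'g \<Rightarrow> (('g \<Rightarrow> real) \<Rightarrow> 'g \<Rightarrow> real) \<Rightarrow> ('g \<Rightarrow> real) \<Rightarrow> 'g \<Rightarrow> real" where
  "conj_field g X f = (\<lambda>k. X (\<lambda>h. f (mul h (iv g))) (mul k g))"

lemma conj_field_left_invariant: "conj_field g (lf x) \<in> left_invariant_fields A mul"
proof -
  let ?R = "\<lambda>f h. f (mul h (iv g))"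
  \<comment> \<open>Translating back by \<open>g\<close> would make \<open>f\<close> smooth; this
    transports the default value 0 on nonsmooth functions.\<close>
  have ns: "\<not> sm (?R f)" if "\<not> sm f" for f :: "'g \<Rightarrow> real"
    using sm_right[of "?R f" g] that by (auto simp: group_simps)
  show ?thesis
    unfolding left_invariant_fields_def
  proof (intro CollectI conjI allI impI)
    fix f h :: "'g \<Rightarrow> real" and a b :: real and k :: 'g
    show "\<not> sm f \<Longrightarrow> conj_field g (lf x) f = 0"
      using ns lf_nonsmooth by (simp add: conj_field_def fun_eq_iff)
    show "sm f \<Longrightarrow> sm (conj_field g (lf x) f)"
      unfolding conj_field_def by (intro sm_right[of "lf x (?R f)"] lf_smooth) (rule sm_right)
    show "sm f \<and> sm h \<Longrightarrow> conj_field g (lf x) (\<lambda>g. a * f g + b * h g) =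
        (\<lambda>k. a * conj_field g (lf x) f k + b * conj_field g (lf x) h k)"
      unfolding conj_field_def using lf_lincomb[of "?R f" "?R h" x a b] sm_right by auto
    show "sm f \<and> sm h \<Longrightarrow> conj_field g (lf x) (\<lambda>g. f g * h g) =
        (\<lambda>k. conj_field g (lf x) f k * h k + f k * conj_field g (lf x) h k)"
      unfolding conj_field_def using lf_leibniz[of "?R f" "?R h" x] sm_right by (auto simp: group_simps)
    show "sm f \<Longrightarrow> conj_field g (lf x) (\<lambda>g. f (mul k g)) = (\<lambda>g'. conj_field g (lf x) f (mul k g'))"
      unfolding conj_field_def using lf_left[of "?R f" x k] sm_right by (auto simp: group_simps)
  qed
qed

definition Ad :: "'g \<Rightarrow> 'a \<Rightarrow> 'a" where
  "Ad g x = inv_into UNIV lf (conj_field g (lf x))"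

lemma lf_Ad: "lf (Ad g x) f k = lf x (\<lambda>h. f (mul h (iv g))) (mul k g)"
proof -
  have "lf (Ad g x) = conj_field g (lf x)"
    unfolding Ad_def using conj_field_left_invariant lf_bij bij_betw_inv_into_right by metis
  then show ?thesis by (simp add: conj_field_def)
qed

lemma lf_right: "lf x (\<lambda>h. f (mul h (iv g))) = (\<lambda>k. lf (Ad g x) f (mul k (iv g)))"
  by (simp add: lf_Ad group_simps)

lemma linear_Ad: "linear (Ad g)"
  by (rule linearI; rule lf_eqI) (simp_all add: lf_Ad lf_add lf_scaleR)

lemma Ad_e: "Ad e x = x"
  by (rule lf_eqI) (simp add: lf_Ad)

lemma Ad_mul: "Ad (mul g h) x = Ad g (Ad h x)"
  by (rule lf_eqI) (simp add: lf_Ad group_simps)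

lemma Ad_br: "Ad g (br x y) = br (Ad g x) (Ad g y)"
proof (rule lf_eqI)
  fix f k assume f: "sm f"
  have "lf (Ad g (br x y)) f k =
      lf x (lf y (\<lambda>h. f (mul h (iv g)))) (mul k g) - lf y (lf x (\<lambda>h. f (mul h (iv g)))) (mul k g)"
    by (simp add: lf_Ad lf_br[OF sm_right[OF f]])
  also have "\<dots> = lf (br (Ad g x) (Ad g y)) f k"
    unfolding lf_right lf_br[OF f] by (simp add: group_simps)
  finally show "lf (Ad g (br x y)) f k = lf (br (Ad g x) (Ad g y)) f k" .
qed

section \<open>Derivatives along exponential curves\<close>

lemma E_0: "E 0 = e"
  using EXP unfolding lie_exp_def by blast

lemma E_continuous: "continuous_on UNIV (\<lambda>t. E (t *\<^sub>R x))"
  using EXP unfolding lie_exp_def integral_curve_def by blast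

lemma E_deriv: "sm f \<Longrightarrow> ((\<lambda>s. f (E (s *\<^sub>R x))) has_real_derivative lf x f (E (t *\<^sub>R x))) (at t)"
  using EXP unfolding lie_exp_def integral_curve_def by blast

text \<open>Left invariance absorbs the factor \<open>k\<close>; the right factor
  \<open>iv g\<close> replaces the field of \<open>x\<close> by that of
  \<open>Ad g x\<close>.\<close>

lemma E_translate_deriv:
  assumes "sm f"
  shows "((\<lambda>s. f (mul (mul k (E (s *\<^sub>R x))) (iv g))) has_real_derivative
    lf (Ad g x) f (mul (mul k (E (t *\<^sub>R x))) (iv g))) (at t)"
proof -
  have "((\<lambda>s. f (mul (mul k (E (s *\<^sub>R x))) (iv g))) has_real_derivative
    lf x (\<lambda>h. f (mul (mul k h) (iv g))) (E (t *\<^sub>R x))) (at t)"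
    using E_deriv[OF sm_translate[OF assms]] .
  moreover have "lf x (\<lambda>h. f (mul (mul k h) (iv g))) = (\<lambda>h. lf (Ad g x) f (mul (mul k h) (iv g)))"
    using lf_left[OF sm_right[OF assms, of "iv g"], of x k] unfolding lf_right .
  ultimately show ?thesis by simp
qed

lemma E_smooth_into: "smooth_into A U E"
  using diffeo_E unfolding diffeo_onto_image_def by blast

lemma E_smooth_into_compose:
  fixes q :: "'b::euclidean_space \<Rightarrow> 'a"
  shows "open S \<Longrightarrow> smooth_on S q \<Longrightarrow> (\<And>x. x \<in> S \<Longrightarrow> q x \<in> U) \<Longrightarrow> smooth_into A S (\<lambda>x. E (q x))"
  by (rule smooth_into_compose[OF atlas E_smooth_into openU])

lemma sm_compose:
  fixes h :: "'b::euclidean_space \<Rightarrow> 'g"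
  shows "open S \<Longrightarrow> sm f \<Longrightarrow> smooth_into A S h \<Longrightarrow> smooth_on S (\<lambda>x. f (h x))"
  by (rule smooth_on_smooth_from[OF atlas _ open_UNIV]) auto

lemma open_scaleR_vimage: "continuous_on UNIV q \<Longrightarrow> open {s. q s *\<^sub>R v \<in> U}"
  using open_vimage[OF openU continuous_on_scaleR[OF _ continuous_on_const], of q v] by (simp add: vimage_def)

text \<open>Star-shapedness makes this set an interval around 0, on which a curve with zero
  derivative is constant.\<close>

lemma convex_scaleR_vimage: "convex {s. s *\<^sub>R v \<in> U}"
proof -
  have *: "x *\<^sub>R v \<in> U" if "b *\<^sub>R v \<in> U" "0 \<le> x / b" "x / b \<le> 1" "b \<noteq> 0" for b x :: real
  proof -
    have "x *\<^sub>R v = (1 - x / b) *\<^sub>R 0 + (x / b) *\<^sub>R (b *\<^sub>R v)" using that by simp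
    then have "x *\<^sub>R v \<in> closed_segment 0 (b *\<^sub>R v)"
      using that unfolding closed_segment_def by blast
    then show ?thesis using star that unfolding star_nbhd_0_def by blast
  qed
  have "is_interval {s. s *\<^sub>R v \<in> U}"
    unfolding is_interval_1
  proof (clarsimp)
    fix a b x :: real assume h: "a *\<^sub>R v \<in> U" "b *\<^sub>R v \<in> U" "a \<le> x" "x \<le> b"
    show "x *\<^sub>R v \<in> U"
    proof (cases "x = 0")
      case True then show ?thesis using zeroU by simp
    next
      case False
      then consider "x > 0" | "x < 0" by linarith
      then show ?thesis
        using *[OF h(2), of x] *[OF h(1), of x] h(3,4) by cases (auto simp: divide_simps)
    qed
  qed
  then show ?thesis by (simp add: is_interval_convex_1)
qed

text \<open>The function h(a, b) = f(k' E(a v) E(b v)^-1) is constant on the diagonal, so its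
  partial derivative in b at (b0, b0) is minus the one in a, which \<open>E_translate_deriv\<close>
  provides. The vector \<open>Ad (E (b0 v)) v\<close> remains until \<open>Ad_E_fixed\<close>
  identifies it with \<open>v\<close>.\<close>

lemma E_inverse_deriv_aux:
  assumes f: "sm f" and b0: "b0 *\<^sub>R v \<in> U"
  shows "((\<lambda>b. f (mul k (iv (E (b *\<^sub>R v))))) has_real_derivative
    - lf (Ad (E (b0 *\<^sub>R v)) v) f (mul k (iv (E (b0 *\<^sub>R v))))) (at b0)"
proof -
  define k' where "k' = mul k (iv (E (b0 *\<^sub>R v)))"
  define h where "h = (\<lambda>p. f (mul (mul k' (E (fst p *\<^sub>R v))) (iv (E (snd p *\<^sub>R v)))))"
  define S where "S = {p::real \<times> real. fst p *\<^sub>R v \<in> U} \<inter> {p. snd p *\<^sub>R v \<in> U}"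
  have oS: "open S"
    unfolding S_def by (intro open_Int open_scaleR_vimage continuous_intros)
  have "smooth_on S h"
    unfolding h_def
    by (intro sm_compose[OF oS f] smooth_into_mul[OF G oS] smooth_into_iv[OF G oS] smooth_into_const
        E_smooth_into_compose[OF oS] bounded_linear_smooth_on[OF _ oS]
        bounded_linear_compose[OF bounded_linear_scaleR_left bounded_linear_fst]
        bounded_linear_compose[OF bounded_linear_scaleR_left bounded_linear_snd])
      (auto simp: S_def)
  then have hd: "h differentiable (at (b0, b0))"
    using b0 by (auto simp: S_def intro: smooth_on_differentiable)
  define D where "D = frechet_derivative h (at (b0, b0))"
  have linD: "linear D" unfolding D_def using hd by (rule linear_frechet_derivative)
  have "((\<lambda>s. h (s, b0)) has_real_derivative D (1, 0)) (at b0)"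
    unfolding D_def by (rule real_deriv_along_curve[OF hd])
      (auto simp: has_vector_derivative_def zero_prod_def intro!: derivative_eq_intros)
  moreover have "((\<lambda>s. h (s, b0)) has_real_derivative lf (Ad (E (b0 *\<^sub>R v)) v) f k') (at b0)"
    using E_translate_deriv[OF f, of k' v "E (b0 *\<^sub>R v)" b0] by (simp add: h_def group_simps)
  ultimately have D10: "D (1, 0) = lf (Ad (E (b0 *\<^sub>R v)) v) f k'" using DERIV_unique by blast
  have "((\<lambda>s. h (s, s)) has_real_derivative D (1, 1)) (at b0)"
    unfolding D_def by (rule real_deriv_along_curve[OF hd])
      (auto simp: has_vector_derivative_def zero_prod_def intro!: derivative_eq_intros)
  moreover have "(\<lambda>s. h (s, s)) = (\<lambda>s. f k')" by (simp add: h_def group_simps)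
  ultimately have D11: "D (1, 1) = 0" using DERIV_unique DERIV_const by metis
  have "D (1, 1) = D (1, 0) + D (0, 1)" by (simp flip: linear_add[OF linD])
  then have "D (0, 1) = - lf (Ad (E (b0 *\<^sub>R v)) v) f k'" using D10 D11 by simp
  moreover have "((\<lambda>s. h (b0, s)) has_real_derivative D (0, 1)) (at b0)"
    unfolding D_def by (rule real_deriv_along_curve[OF hd])
      (auto simp: has_vector_derivative_def zero_prod_def intro!: derivative_eq_intros)
  ultimately show ?thesis by (simp add: h_def k'_def group_simps)
qed

text \<open>The field of \<open>Ad (E (s v)) x\<close> at the unit is the derivative in r, at r = 0,
  of F(a, r, b) = f(E(a v) E(r x) E(b v)^-1) with a = b = s. Moving a and b contributes the two
  orders of composition of the fields of \<open>w\<close> and \<open>c\<close>, with opposite signs,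
  hence their commutator.\<close>

lemma Ad_deriv_aux:
  assumes f: "sm f" and s: "s *\<^sub>R v \<in> U"
  shows "((\<lambda>s. lf (Ad (E (s *\<^sub>R v)) x) f e) has_real_derivative
    lf (br (Ad (E (s *\<^sub>R v)) v) (Ad (E (s *\<^sub>R v)) x)) f e) (at s)"
proof -
  define F where "F = (\<lambda>p. f (mul (mul (E (fst p *\<^sub>R v)) (E (fst (snd p) *\<^sub>R x))) (iv (E (snd (snd p) *\<^sub>R v)))))"
  define S where "S = {p::real \<times> real \<times> real. fst p *\<^sub>R v \<in> U} \<inter> {p. fst (snd p) *\<^sub>R x \<in> U} \<inter> {p. snd (snd p) *\<^sub>R v \<in> U}"
  define w where "w = Ad (E (s *\<^sub>R v)) v"
  define c where "c = Ad (E (s *\<^sub>R v)) x"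
  have oS: "open S"
    unfolding S_def by (intro open_Int open_scaleR_vimage continuous_intros)
  have sF: "smooth_on S F"
    unfolding F_def
    by (intro sm_compose[OF oS f] smooth_into_mul[OF G oS] smooth_into_iv[OF G oS] smooth_into_const
        E_smooth_into_compose[OF oS] bounded_linear_smooth_on[OF _ oS]
        bounded_linear_compose[OF bounded_linear_scaleR_left]
        bounded_linear_fst bounded_linear_snd
        bounded_linear_compose[OF bounded_linear_fst] bounded_linear_compose[OF bounded_linear_snd])
      (auto simp: S_def)
  have Fd: "F differentiable (at p)" if "p \<in> S" for p
    using sF that by (rule smooth_on_differentiable)
  define H where "H = (\<lambda>d p. frechet_derivative F (at p) d)"
  have sH: "smooth_on S (H d)" for d
    unfolding H_def by (rule smooth_on_frechet_derivative[OF sF])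
  have Hd: "H d differentiable (at p)" if "p \<in> S" for d p
    using sH that by (rule smooth_on_differentiable)
  have Hr: "H (0, 1, 0) (a, r, b) = lf (Ad (E (b *\<^sub>R v)) x) f (mul (mul (E (a *\<^sub>R v)) (E (r *\<^sub>R x))) (iv (E (b *\<^sub>R v))))"
    if "(a, r, b) \<in> S" for a r b
  proof -
    have "((\<lambda>r. F (a, r, b)) has_real_derivative H (0, 1, 0) (a, r, b)) (at r)"
      unfolding H_def by (rule real_deriv_along_curve[OF Fd[OF that]])
        (auto simp: has_vector_derivative_def zero_prod_def intro!: derivative_eq_intros)
    moreover have "((\<lambda>r. F (a, r, b)) has_real_derivative
        lf (Ad (E (b *\<^sub>R v)) x) f (mul (mul (E (a *\<^sub>R v)) (E (r *\<^sub>R x))) (iv (E (b *\<^sub>R v))))) (at r)"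
      using E_translate_deriv[OF f] by (simp add: F_def)
    ultimately show ?thesis using DERIV_unique by blast
  qed
  have Hb: "H (0, 0, 1) (a, r, b) = - lf (Ad (E (b *\<^sub>R v)) v) f (mul (mul (E (a *\<^sub>R v)) (E (r *\<^sub>R x))) (iv (E (b *\<^sub>R v))))"
    if "(a, r, b) \<in> S" for a r b
  proof -
    have "((\<lambda>b. F (a, r, b)) has_real_derivative H (0, 0, 1) (a, r, b)) (at b)"
      unfolding H_def by (rule real_deriv_along_curve[OF Fd[OF that]])
        (auto simp: has_vector_derivative_def zero_prod_def intro!: derivative_eq_intros)
    moreover have "((\<lambda>b. F (a, r, b)) has_real_derivative
        - lf (Ad (E (b *\<^sub>R v)) v) f (mul (mul (E (a *\<^sub>R v)) (E (r *\<^sub>R x))) (iv (E (b *\<^sub>R v))))) (at b)"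
      using E_inverse_deriv_aux[OF f, of b v "mul (E (a *\<^sub>R v)) (E (r *\<^sub>R x))"] that by (simp add: F_def S_def)
    ultimately show ?thesis using DERIV_unique by blast
  qed
  have oI: "open {s. s *\<^sub>R v \<in> U}" and oJ: "open {r. r *\<^sub>R x \<in> U}"
    by (intro open_scaleR_vimage continuous_intros)+
  have p: "(s, 0, s) \<in> S" using s zeroU by (simp add: S_def)
  define D where "D = frechet_derivative (H (0, 1, 0)) (at (s, 0, s))"
  have linD: "linear D" unfolding D_def using Hd[OF p] by (rule linear_frechet_derivative)
  have "D (1, 0, 0) = lf w (lf c f) e"
  proof -
    have "((\<lambda>a. H (0, 1, 0) (a, 0, s)) has_real_derivative D (1, 0, 0)) (at s)"
      unfolding D_def by (rule real_deriv_along_curve[OF Hd[OF p]])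
        (auto simp: has_vector_derivative_def zero_prod_def intro!: derivative_eq_intros)
    moreover have "((\<lambda>a. H (0, 1, 0) (a, 0, s)) has_real_derivative lf w (lf c f) e) (at s)"
    proof (rule has_field_derivative_transform_within_open[OF _ oI])
      show "((\<lambda>a. lf c f (mul (mul e (E (a *\<^sub>R v))) (iv (E (s *\<^sub>R v))))) has_real_derivative lf w (lf c f) e) (at s)"
        using E_translate_deriv[OF lf_smooth[OF f], of c e v "E (s *\<^sub>R v)" s] by (simp add: w_def)
    qed (use s zeroU in \<open>auto simp: Hr S_def c_def E_0\<close>)
    ultimately show ?thesis using DERIV_unique by blast
  qed
  moreover have "D (0, 0, 1) = - lf c (lf w f) e"
  proof -
    \<comment> \<open>Differentiating in r first would leave a field depending on b. With the order
      exchanged, the field of \<open>w\<close> is fixed and is then differentiated along the curve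
      in r.\<close>
    have "D (0, 0, 1) = iter_deriv F [(0, 0, 1), (0, 1, 0)] (s, 0, s)"
      by (simp add: D_def H_def)
    also have "\<dots> = iter_deriv F [(0, 1, 0), (0, 0, 1)] (s, 0, s)"
      by (rule iter_deriv_commute[OF oS sF p])
    finally have eq: "D (0, 0, 1) = frechet_derivative (H (0, 0, 1)) (at (s, 0, s)) (0, 1, 0)"
      by (simp add: H_def)
    have "((\<lambda>r. H (0, 0, 1) (s, r, s)) has_real_derivative D (0, 0, 1)) (at 0)"
      unfolding eq by (rule real_deriv_along_curve[OF Hd[OF p]])
        (auto simp: has_vector_derivative_def zero_prod_def intro!: derivative_eq_intros)
    moreover have "((\<lambda>r. H (0, 0, 1) (s, r, s)) has_real_derivative - lf c (lf w f) e) (at 0)"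
    proof (rule has_field_derivative_transform_within_open[OF _ oJ])
      show "((\<lambda>r. - lf w f (mul (mul (E (s *\<^sub>R v)) (E (r *\<^sub>R x))) (iv (E (s *\<^sub>R v))))) has_real_derivative
          - lf c (lf w f) e) (at 0)"
        using DERIV_minus[OF E_translate_deriv[OF lf_smooth[OF f], of w "E (s *\<^sub>R v)" x "E (s *\<^sub>R v)" 0]]
        by (simp add: c_def E_0 group_simps)
    qed (use s zeroU in \<open>auto simp: Hb S_def w_def\<close>)
    ultimately show ?thesis using DERIV_unique by blast
  qed
  moreover have "D (1, 0, 1) = D (1, 0, 0) + D (0, 0, 1)" by (simp flip: linear_add[OF linD])
  ultimately have D: "D (1, 0, 1) = lf (br w c) f e" by (simp add: lf_br[OF f])
  have "((\<lambda>s. H (0, 1, 0) (s, 0, s)) has_real_derivative D (1, 0, 1)) (at s)"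
    unfolding D_def by (rule real_deriv_along_curve[OF Hd[OF p]])
      (auto simp: has_vector_derivative_def zero_prod_def intro!: derivative_eq_intros)
  then have "((\<lambda>s. lf (Ad (E (s *\<^sub>R v)) x) f e) has_real_derivative D (1, 0, 1)) (at s)"
    by (rule has_field_derivative_transform_within_open[OF _ oI])
      (use s zeroU in \<open>auto simp: Hr S_def E_0 group_simps\<close>)
  then show ?thesis unfolding D w_def c_def .
qed

text \<open>Otherwise the left-invariant field of some \<open>x \<noteq> 0\<close> would vanish.\<close>

lemma linear_functional_at_unit: "\<exists>f. sm f \<and> (\<forall>z. lf z f e = w \<bullet> z)"
proof -
  define S where "S = {w. \<exists>f. sm f \<and> (\<forall>z. lf z f e = w \<bullet> z)}"
  have lc: "a *\<^sub>R w1 + b *\<^sub>R w2 \<in> S" if w: "w1 \<in> S" "w2 \<in> S" for a b w1 w2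
  proof -
    obtain f h where f: "sm f" "\<And>z. lf z f e = w1 \<bullet> z" and h: "sm h" "\<And>z. lf z h e = w2 \<bullet> z"
      using w unfolding S_def by blast
    have "lf z (\<lambda>g. a * f g + b * h g) e = (a *\<^sub>R w1 + b *\<^sub>R w2) \<bullet> z" for z
      using lf_lincomb[OF f(1) h(1), of z a b] f(2) h(2) by (simp add: inner_left_distrib)
    then show ?thesis
      using smooth_from_lincomb[OF atlas f(1) h(1), of a b] unfolding S_def by blast
  qed
  have reps: "(\<Sum>b\<in>Basis. lf b f e *\<^sub>R b) \<in> S" "lf z f e = (\<Sum>b\<in>Basis. lf b f e *\<^sub>R b) \<bullet> z" if "sm f" for f z
  proof -
    have "linear (\<lambda>z. lf z f e)" by (rule linearI) (simp_all add: lf_add lf_scaleR)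
    then have sum: "lf z f e = (\<Sum>b\<in>Basis. (z \<bullet> b) *\<^sub>R lf b f e)" for z by (rule linear_eq_sum_Basis)
    have eq: "lf z f e = (\<Sum>b\<in>Basis. lf b f e *\<^sub>R b) \<bullet> z" for z
      by (subst sum) (simp add: inner_sum_left inner_commute[of z] mult.commute)
    then show "(\<Sum>b\<in>Basis. lf b f e *\<^sub>R b) \<in> S" "lf z f e = (\<Sum>b\<in>Basis. lf b f e *\<^sub>R b) \<bullet> z"
      using that unfolding S_def by blast+
  qed
  have const: "smooth_from A UNIV (\<lambda>g. 0::real)"
    unfolding smooth_from_def by (auto intro: smooth_on_const)
  have ne: "0 \<in> S"
  proof -
    have "lf z (\<lambda>g. 0) e = 0" for z using lf_lincomb[OF const const, of z 0 0] by simp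
    then show ?thesis using const unfolding S_def by auto
  qed
  have sub: "subspace S"
    unfolding subspace_def using lc[of _ _ 1 1] lc[of _ _ _ 0] ne by auto
  have "S = UNIV"
  proof (rule ccontr)
    assume "S \<noteq> UNIV"
    then have "span S \<noteq> UNIV" using sub span_eq_iff by metis
    then obtain z where z: "z \<noteq> 0" "\<And>x. x \<in> span S \<Longrightarrow> z \<bullet> x = 0"
      using span_not_UNIV_orthogonal[of S] by blast
    have "lf z f k = 0" if f: "sm f" for f k
    proof -
      \<comment> \<open>Left invariance moves the evaluation point to the unit, at the price of
        translating \<open>f\<close>; the translate is again a global smooth function, so
        \<open>z\<close> annihilates it.\<close>
      have "lf z f k = lf z (\<lambda>g. f (mul k g)) e" using lf_left[OF f, of z k] by (simp add: fun_eq_iff)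
      also have "\<dots> = (\<Sum>b\<in>Basis. lf b (\<lambda>g. f (mul k g)) e *\<^sub>R b) \<bullet> z"
        by (rule reps(2)[OF sm_left[OF f]])
      also have "\<dots> = 0"
        using z(2)[OF span_base[OF reps(1)[OF sm_left[OF f, of k]]]] by (simp only: inner_commute)
      finally show ?thesis .
    qed
    then have "z = 0" by (intro lf_eqI) (simp add: lf_zero)
    then show False using z by simp
  qed
  then show ?thesis unfolding S_def by blast
qed

text \<open>A global smooth function whose differential at the unit is the linear form given by
  \<open>b\<close>. For \<open>b\<close> in the basis these are coordinates near the unit.\<close>

definition coordinate_fun :: "'a \<Rightarrow> 'g \<Rightarrow> real" where
  "coordinate_fun b = (SOME f. sm f \<and> (\<forall>z. lf z f e = b \<bullet> z))"

lemma sm_coordinate_fun: "sm (coordinate_fun b)" and lf_coordinate_fun: "lf z (coordinate_fun b) e = b \<bullet> z"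
  using someI_ex[OF linear_functional_at_unit[of b]] unfolding coordinate_fun_def by blast+

lemma lf_coordinate_representation: "(\<Sum>b\<in>Basis. lf z (coordinate_fun b) e *\<^sub>R b) = z"
  by (simp add: lf_coordinate_fun inner_commute[of _ z] euclidean_representation)

lemma Ad_vector_deriv_aux:
  assumes "s *\<^sub>R v \<in> U"
  shows "((\<lambda>s. Ad (E (s *\<^sub>R v)) x) has_vector_derivative br (Ad (E (s *\<^sub>R v)) v) (Ad (E (s *\<^sub>R v)) x)) (at s)"
proof -
  have "((\<lambda>s. \<Sum>b\<in>Basis. lf (Ad (E (s *\<^sub>R v)) x) (coordinate_fun b) e *\<^sub>R b) has_vector_derivative
      (\<Sum>b\<in>Basis. lf (br (Ad (E (s *\<^sub>R v)) v) (Ad (E (s *\<^sub>R v)) x)) (coordinate_fun b) e *\<^sub>R b)) (at s)"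
    using has_vector_derivative_scaleR[OF Ad_deriv_aux[OF sm_coordinate_fun assms] has_vector_derivative_const]
    by (intro has_vector_derivative_sum) simp
  then show ?thesis unfolding lf_coordinate_representation .
qed

lemma br_self: "br x x = 0" and bilinear_br: "bilinear br"
  using lie unfolding lie_algebra_def by auto

text \<open>For \<open>x = v\<close> the derivative of the curve is the bracket of a vector with
  itself, hence 0 on the whole interval; at s = 0 the value is \<open>v\<close>.\<close>

lemma Ad_E_fixed:
  assumes "s *\<^sub>R v \<in> U"
  shows "Ad (E (s *\<^sub>R v)) v = v"
proof -
  have "((\<lambda>s. Ad (E (s *\<^sub>R v)) v) has_vector_derivative 0) (at t within {s. s *\<^sub>R v \<in> U})"
    if "t \<in> {s. s *\<^sub>R v \<in> U}" for t
    using Ad_vector_deriv_aux[of t v v] that by (auto simp: br_self intro: has_vector_derivative_at_within)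
  then obtain c where "\<And>t. t \<in> {s. s *\<^sub>R v \<in> U} \<Longrightarrow> Ad (E (t *\<^sub>R v)) v = c"
    using has_vector_derivative_zero_constant[OF convex_scaleR_vimage] by blast
  from this[of s] this[of 0] show ?thesis using assms zeroU by (simp add: E_0 Ad_e)
qed

lemma Ad_deriv:
  assumes "s *\<^sub>R v \<in> U"
  shows "((\<lambda>s. Ad (E (s *\<^sub>R v)) x) has_vector_derivative br v (Ad (E (s *\<^sub>R v)) x)) (at s)"
  using Ad_vector_deriv_aux[OF assms] Ad_E_fixed[OF assms] by simp

lemma E_inverse_deriv:
  assumes "sm f" "b *\<^sub>R v \<in> U"
  shows "((\<lambda>b. f (mul k (iv (E (b *\<^sub>R v))))) has_real_derivative
    - lf v f (mul k (iv (E (b *\<^sub>R v))))) (at b)"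
  using E_inverse_deriv_aux[OF assms] Ad_E_fixed[OF assms(2)] by simp

end

section \<open>Separation near the unit and conjugation of exponentials\<close>

context lie_group_exp
begin

text \<open>The coordinate functions, composed with \<open>E\<close>, form a map with derivative the
  identity at 0; such a map takes its value at 0 nowhere else nearby.\<close>

lemma E_locally_separated:
  "\<exists>V. open V \<and> 0 \<in> V \<and> V \<subseteq> U \<and> (\<forall>z\<in>V. (\<forall>f. sm f \<longrightarrow> f (E z) = f e) \<longrightarrow> z = 0)"
proof -
  define \<Psi> where "\<Psi> = (\<lambda>z. \<Sum>b\<in>Basis. coordinate_fun b (E z) *\<^sub>R b)"
  have "smooth_on U \<Psi>"
    unfolding \<Psi>_def
    by (intro smooth_on_sum openU smooth_on_bilinear[OF bounded_bilinear_scaleR] smooth_on_const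
        sm_compose[OF openU sm_coordinate_fun E_smooth_into])
  then have d: "\<Psi> differentiable (at 0)" using zeroU by (rule smooth_on_differentiable)
  have "frechet_derivative \<Psi> (at 0) z = z" for z
  proof -
    have "((\<lambda>s. \<Psi> (s *\<^sub>R z)) has_vector_derivative frechet_derivative \<Psi> (at (0 *\<^sub>R z)) z) (at 0)"
      by (rule has_derivative_along_curve)
        (use d in \<open>auto simp: has_vector_derivative_def intro!: derivative_eq_intros\<close>)
    moreover have "((\<lambda>s. \<Psi> (s *\<^sub>R z)) has_vector_derivative (\<Sum>b\<in>Basis. lf z (coordinate_fun b) e *\<^sub>R b)) (at 0)"
      unfolding \<Psi>_def
    proof (intro has_vector_derivative_sum)
      fix b :: 'a
      show "((\<lambda>s. coordinate_fun b (E (s *\<^sub>R z)) *\<^sub>R b) has_vector_derivative lf z (coordinate_fun b) e *\<^sub>R b) (at 0)"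
        using has_vector_derivative_scaleR[OF E_deriv[OF sm_coordinate_fun, of b z 0] has_vector_derivative_const[of b]]
        by (simp add: E_0)
    qed
    ultimately have "frechet_derivative \<Psi> (at (0 *\<^sub>R z)) z = (\<Sum>b\<in>Basis. lf z (coordinate_fun b) e *\<^sub>R b)"
      by (rule vector_derivative_unique_at)
    then show ?thesis unfolding lf_coordinate_representation by simp
  qed
  then have "frechet_derivative \<Psi> (at 0) = (\<lambda>z. z)" by (rule ext)
  then have "(\<Psi> has_derivative (\<lambda>z. z)) (at 0)"
    using d unfolding frechet_derivative_works by simp
  then have "\<forall>\<epsilon>>0. \<exists>r>0. \<forall>z. norm (z - 0) < r \<longrightarrow> norm (\<Psi> z - \<Psi> 0 - (z - 0)) \<le> \<epsilon> * norm (z - 0)"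
    unfolding has_derivative_at_alt by (rule conjunct2)
  \<comment> \<open>With constant 1/2, equal values at \<open>z\<close> and 0 would give norm z <=
    norm z / 2.\<close>
  from this[rule_format, of "1/2"] obtain r where r: "r > 0"
    "\<And>z. norm (z - 0) < r \<Longrightarrow> norm (\<Psi> z - \<Psi> 0 - (z - 0)) \<le> 1/2 * norm (z - 0)"
    by auto
  have "z = 0" if "z \<in> ball 0 r \<inter> U" "\<forall>f. sm f \<longrightarrow> f (E z) = f e" for z
  proof -
    have "coordinate_fun b (E z) = coordinate_fun b e" for b using that(2) sm_coordinate_fun[of b] by blast
    then have "\<Psi> z = \<Psi> 0" unfolding \<Psi>_def by (simp add: E_0)
    then show ?thesis using r(2)[of z] that(1) by simp
  qed
  then show ?thesis
    using r(1) openU zeroU by (intro exI[of _ "ball 0 r \<inter> U"]) auto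
qed

lemma open_E_image:
  assumes "open V" "V \<subseteq> U"
  shows "open (E ` V)"
proof -
  have o: "open (E ` U)" and inj: "inj_on E U" and sf: "smooth_from A (E ` U) (inv_into U E)"
    using diffeo_E unfolding diffeo_onto_image_def by auto
  have "E ` V = E ` U \<inter> inv_into U E -` V"
    using assms(2) inj by (auto simp: inv_into_f_f subset_iff)
  then show ?thesis
    using continuous_open_preimage[OF smooth_from_continuous_on[OF atlas sf o] o assms(1)] by simp
qed

text \<open>Only \<open>Ad g x\<close> is assumed to lie in \<open>U\<close>, so E(t x) is just an
  integral curve, and the comparison curve cannot be treated as a smooth map. Constancy under every
  smooth function yields equality with the unit only nearby; connectedness of the parameter interval
  makes it global.\<close>

lemma E_conjugate:
  assumes U: "Ad g x \<in> U"
  shows "mul (mul g (E x)) (iv g) = E (Ad g x)"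
proof -
  define y where "y = Ad g x"
  \<comment> \<open>The two occurrences of t get separate parameters, so that each factor can be
    differentiated by its own rule.\<close>
  define \<delta> where "\<delta> = (\<lambda>a b. mul (mul (mul g (E (a *\<^sub>R x))) (iv g)) (iv (E (b *\<^sub>R y))))"
  define I where "I = {b. b *\<^sub>R y \<in> U}"
  have I: "convex I" "0 \<in> I" "1 \<in> I"
    unfolding I_def using convex_scaleR_vimage zeroU U by (auto simp: y_def)
  have cont: "continuous_on UNIV (\<lambda>p. \<delta> (snd p) (fst p))"
    unfolding \<delta>_def
    by (intro continuous_on_mul[OF G] continuous_on_iv[OF G] continuous_on_const
        continuous_on_compose2[OF E_continuous] continuous_intros) auto
  have const: "f (\<delta> t t) = f e" if f: "sm f" and t: "t \<in> I" for f t
  proof -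
    \<comment> \<open>Total differentiability follows from the two partial derivatives if one of
      them is continuous as a bounded linear map. This is the one in \<open>a\<close>, which is
      therefore written with \<open>id_blinfun\<close> and put second in the pairs (b, a).\<close>
    have da: "((\<lambda>a. f (\<delta> a b)) has_derivative blinfun_apply (lf y f (\<delta> a b) *\<^sub>R id_blinfun)) (at a within UNIV)"
      if "b \<in> I" for a b
    proof -
      \<comment> \<open>Since \<open>Ad (E (b y))\<close> fixes \<open>y\<close>, both partial
        derivatives are given by the field of \<open>y\<close>, with opposite signs, and cancel on
        the diagonal.\<close>
      have "Ad (mul (E (b *\<^sub>R y)) g) x = y"
        using Ad_E_fixed[of b y] that by (simp add: Ad_mul I_def flip: y_def)
      then have "((\<lambda>a. f (\<delta> a b)) has_real_derivative lf y f (\<delta> a b)) (at a)"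
        using E_translate_deriv[OF f, of g x "mul (E (b *\<^sub>R y)) g" a] by (simp add: \<delta>_def group_simps)
      then show ?thesis
        unfolding has_field_derivative_def by (rule has_derivative_eq_rhs) (simp add: fun_eq_iff blinfun.scaleR_left)
    qed
    have db: "((\<lambda>b. f (\<delta> a b)) has_derivative (*) (- lf y f (\<delta> a b))) (at b within I)"
      if "b \<in> I" for a b
      using has_derivative_at_withinI[OF E_inverse_deriv[OF f, of b y "mul (mul g (E (a *\<^sub>R x))) (iv g)",
            unfolded has_field_derivative_def]] that
      by (simp add: \<delta>_def I_def)
    have cf: "continuous_on UNIV (\<lambda>p. lf y f (\<delta> (snd p) (fst p)))"
      by (rule continuous_on_compose2[OF smooth_from_continuous_on[OF atlas lf_smooth[OF f] open_UNIV] cont]) auto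
    have D: "((\<lambda>t. f (\<delta> t t)) has_derivative (\<lambda>h. 0)) (at t within I)" if t: "t \<in> I" for t
    proof -
      have "((\<lambda>(b, a). f (\<delta> a b)) has_derivative
          (\<lambda>(tb, ta). - lf y f (\<delta> t t) * tb + blinfun_apply (lf y f (\<delta> t t) *\<^sub>R id_blinfun) ta)) (at (t, t) within I \<times> UNIV)"
      proof (rule has_derivative_partialsI[OF db[OF t] da])
        have "continuous_on (I \<times> UNIV) (\<lambda>(b, a). lf y f (\<delta> a b) *\<^sub>R id_blinfun)"
          using continuous_on_subset[OF cf, of "I \<times> UNIV"]
          by (auto simp: split_beta' intro!: continuous_intros)
        then show "continuous (at (t, t) within I \<times> UNIV) (\<lambda>(b, a). lf y f (\<delta> a b) *\<^sub>R id_blinfun)"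
          using t by (auto simp: continuous_on_eq_continuous_within)
      qed auto
      then have D2: "((\<lambda>(b, a). f (\<delta> a b)) has_derivative
          (\<lambda>(tb, ta). lf y f (\<delta> t t) * (ta - tb))) (at (t, t) within I \<times> UNIV)"
        by (rule has_derivative_eq_rhs) (auto simp: fun_eq_iff blinfun.scaleR_left algebra_simps)
      have "((\<lambda>s. (s, s)) has_derivative (\<lambda>h. (h, h))) (at t within I)"
        by (auto intro!: derivative_eq_intros)
      from has_derivative_in_compose[OF this has_derivative_subset[OF D2]]
      show ?thesis by auto
    qed
    obtain c where "\<And>t. t \<in> I \<Longrightarrow> f (\<delta> t t) = c"
      using has_derivative_zero_constant[OF I(1) D] by blast
    from this[OF t] this[OF I(2)] show ?thesis by (simp add: \<delta>_def E_0)
  qed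
  obtain V where V: "open V" "0 \<in> V" "V \<subseteq> U" "\<forall>z\<in>V. (\<forall>f. sm f \<longrightarrow> f (E z) = f e) \<longrightarrow> z = 0"
    using E_locally_separated by (elim exE conjE) (rule that)
  have cI: "continuous_on I (\<lambda>t. \<delta> t t)"
    using continuous_on_compose2[OF cont continuous_on_Pair[OF continuous_on_id continuous_on_id], of I] by simp
  \<comment> \<open>A point E z with z in \<open>V\<close> that no smooth function distinguishes
    from the unit is the unit. So the closed condition \<open>\<delta> t t = e\<close> is also open
    in \<open>I\<close>.\<close>
  have eq: "I \<inter> (\<lambda>t. \<delta> t t) -` (E ` V) = {t \<in> I. \<delta> t t = e}"
  proof (intro equalityI subsetI)
    fix t assume "t \<in> I \<inter> (\<lambda>t. \<delta> t t) -` (E ` V)"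
    then obtain z where "t \<in> I" "z \<in> V" "\<delta> t t = E z" by auto
    moreover from this have "z = 0" using V(4) const[of _ t] by metis
    ultimately show "t \<in> {t \<in> I. \<delta> t t = e}" by (simp add: E_0)
  next
    fix t assume "t \<in> {t \<in> I. \<delta> t t = e}"
    then show "t \<in> I \<inter> (\<lambda>t. \<delta> t t) -` (E ` V)" using V(2) E_0 by force
  qed
  have "openin (top_of_set I) {t \<in> I. \<delta> t t = e}"
    unfolding eq[symmetric] by (rule continuous_openin_preimage_gen[OF cI open_E_image[OF V(1,3)]])
  moreover have "closedin (top_of_set I) {t \<in> I. \<delta> t t = e}"
    by (rule continuous_closedin_preimage_constant[OF cI])
  moreover have "0 \<in> {t \<in> I. \<delta> t t = e}" using I(2) by (simp add: \<delta>_def E_0)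
  ultimately have "{t \<in> I. \<delta> t t = e} = I"
    using convex_connected[OF I(1)] unfolding connected_clopen by blast
  then have "\<delta> 1 1 = e" using I(3) by auto
  then have "mul (\<delta> 1 1) (E y) = E y" by simp
  then show ?thesis by (simp add: \<delta>_def y_def group_simps)
qed

end

section \<open>The Jacobian of the exponential map\<close>

text \<open>Bounds in the finitely many basis directions add up to one proportional to
  \<open>norm h\<close> in every direction; this gives the uniform convergence of the derivatives
  required for termwise differentiation.\<close>

lemma frechet_series:
  fixes f :: "nat \<Rightarrow> 'a::euclidean_space \<Rightarrow> 'b::banach"
  assumes "open S" "convex S" "\<And>n. smooth_on S (f n)"
    and bound: "\<And>vs. \<exists>M. summable M \<and> (\<forall>n. \<forall>x\<in>S. norm (iter_deriv (f n) vs x) \<le> M n)"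
    and x: "x \<in> S"
  shows "((\<lambda>x. \<Sum>n. f n x) has_derivative (\<lambda>h. \<Sum>n. frechet_derivative (f n) (at x) h)) (at x)"
proof -
  obtain M where M: "\<And>vs. summable (M vs)" "\<And>vs n x. x \<in> S \<Longrightarrow> norm (iter_deriv (f n) vs x) \<le> M vs n"
    using bound by metis
  define N where "N = (\<lambda>n. \<Sum>b\<in>Basis. M [b] n)"
  have sN: "summable N" unfolding N_def by (intro summable_sum M)
  have D: "(f n has_derivative frechet_derivative (f n) (at x)) (at x)" if "x \<in> S" for n x
    by (rule smooth_on_has_derivative[OF assms(3) that])
  have le: "norm (frechet_derivative (f n) (at x) h) \<le> norm h * N n" if "x \<in> S" for n x h
  proof -
    have "frechet_derivative (f n) (at x) h = (\<Sum>b\<in>Basis. (h \<bullet> b) *\<^sub>R frechet_derivative (f n) (at x) b)"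
      by (rule linear_eq_sum_Basis[OF has_derivative_linear[OF D[OF that]]])
    also have "norm \<dots> \<le> (\<Sum>b\<in>Basis. norm h * M [b] n)"
    proof (rule sum_norm_le)
      fix b :: 'a assume "b \<in> Basis"
      then show "norm ((h \<bullet> b) *\<^sub>R frechet_derivative (f n) (at x) b) \<le> norm h * M [b] n"
        using M(2)[OF that, of n "[b]"] Basis_le_norm[of b h] by (auto intro!: mult_mono)
    qed
    finally show ?thesis by (simp add: N_def sum_distrib_left)
  qed
  have sm: "summable (\<lambda>n. frechet_derivative (f n) (at x) h)" if "x \<in> S" for x h
    by (rule summable_comparison_test'[OF summable_mult[OF sN, of "norm h"], of 0]) (use le[OF that] in simp)
  have "\<forall>\<^sub>F n in sequentially. \<forall>x\<in>S. \<forall>h.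
      norm ((\<Sum>i<n. frechet_derivative (f i) (at x) h) - (\<Sum>i. frechet_derivative (f i) (at x) h)) \<le> \<epsilon> * norm h"
    if eps: "\<epsilon> > 0" for \<epsilon>
  proof -
    obtain n0 where n0: "\<And>n. n \<ge> n0 \<Longrightarrow> norm (\<Sum>i. N (i + n)) < \<epsilon>"
      using suminf_exist_split[OF eps sN] by blast
    show ?thesis
    proof (rule eventually_sequentiallyI[of n0], intro ballI allI)
      fix n x h assume n: "n0 \<le> n" and x: "x \<in> S"
      have "norm ((\<Sum>i<n. frechet_derivative (f i) (at x) h) - (\<Sum>i. frechet_derivative (f i) (at x) h)) =
          norm (\<Sum>i. frechet_derivative (f (i + n)) (at x) h)"
        using suminf_split_initial_segment[OF sm[OF x], of h n] by (simp add: norm_minus_commute)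
      also have "\<dots> \<le> (\<Sum>i. norm h * N (i + n))"
        by (rule norm_suminf_le[OF _ summable_mult[OF summable_ignore_initial_segment[OF sN]]]) (rule le[OF x])
      also have "\<dots> = norm h * (\<Sum>i. N (i + n))"
        by (rule suminf_mult[OF summable_ignore_initial_segment[OF sN]])
      also have "\<dots> \<le> norm h * \<epsilon>"
        using n0[OF n] by (intro mult_left_mono) auto
      finally show "norm ((\<Sum>i<n. frechet_derivative (f i) (at x) h) - (\<Sum>i. frechet_derivative (f i) (at x) h)) \<le> \<epsilon> * norm h"
        by (simp add: mult.commute)
    qed
  qed
  moreover have sf: "summable (\<lambda>n. f n x)" if "x \<in> S" for x
    by (rule summable_comparison_test'[OF M(1)[of "[]"], of 0]) (use M(2)[OF that, of _ "[]"] in simp)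
  ultimately have "\<exists>g. \<forall>x\<in>S. (\<lambda>n. f n x) sums g x \<and>
      (g has_derivative (\<lambda>h. \<Sum>n. frechet_derivative (f n) (at x) h)) (at x within S)"
    by (intro has_derivative_series[OF assms(2) has_derivative_at_withinI[OF D] _ x summable_sums[OF sf[OF x]]])
  then obtain g where g: "\<forall>x\<in>S. (\<lambda>n. f n x) sums g x \<and>
      (g has_derivative (\<lambda>h. \<Sum>n. frechet_derivative (f n) (at x) h)) (at x within S)" ..
  have "(g has_derivative (\<lambda>h. \<Sum>n. frechet_derivative (f n) (at x) h)) (at x)"
    using bspec[OF g x] at_within_open[OF x assms(1)] by simp
  then show ?thesis
    by (rule has_derivative_transform_within_open[OF _ assms(1) x]) (use g in \<open>auto simp: sums_iff\<close>)
qed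

text \<open>The bounds concern all iterated derivatives, so they pass to the differentiated series:
  its bound for \<open>vs\<close> is the old one for \<open>vs @ [v]\<close>.\<close>

lemma smooth_on_series:
  fixes f :: "nat \<Rightarrow> 'a::euclidean_space \<Rightarrow> 'b::banach"
  assumes "open S" "convex S" "\<And>n. smooth_on S (f n)"
    and "\<And>vs. \<exists>M. summable M \<and> (\<forall>n. \<forall>x\<in>S. norm (iter_deriv (f n) vs x) \<le> M n)"
  shows "smooth_on S (\<lambda>x. \<Sum>n. f n x)"
  unfolding smooth_on_iff_Ck
proof
  fix k show "Ck k S (\<lambda>x. \<Sum>n. f n x)"
    using assms(3,4)
  proof (induction k arbitrary: f)
    case 0
    show ?case using frechet_series[OF assms(1,2) 0] by (auto intro: differentiableI)
  next
    case (Suc k)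
    note D = frechet_series[OF assms(1,2) Suc.prems]
    have "Ck k S (\<lambda>x. frechet_derivative (\<lambda>x. \<Sum>n. f n x) (at x) v)" for v
    proof (rule Ck_cong_imp[OF assms(1)])
      show "Ck k S (\<lambda>x. \<Sum>n. frechet_derivative (f n) (at x) v)"
      proof (rule Suc.IH[of "\<lambda>n x. frechet_derivative (f n) (at x) v"])
        show "smooth_on S (\<lambda>x. frechet_derivative (f n) (at x) v)" for n
          by (rule smooth_on_frechet_derivative[OF Suc.prems(1)])
        show "\<exists>M. summable M \<and> (\<forall>n. \<forall>x\<in>S. norm (iter_deriv (\<lambda>x. frechet_derivative (f n) (at x) v) vs x) \<le> M n)" for vs
          using Suc.prems(2)[of "vs @ [v]"] by (simp add: iter_deriv_append)
      qed
      show "(\<Sum>n. frechet_derivative (f n) (at x) v) = frechet_derivative (\<lambda>x. \<Sum>n. f n x) (at x) v" if "x \<in> S" for x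
        using frechet_derivative_at[OF D[OF that]] by (simp add: fun_eq_iff)
    qed
    then show ?case using D by (auto intro: differentiableI)
  qed
qed

lemma smooth_on_iter_deriv: "smooth_on S f \<Longrightarrow> smooth_on S (iter_deriv f vs)"
  unfolding smooth_on_def by (metis iter_deriv_append)

lemma iter_deriv_linear:
  assumes "bounded_linear L" "smooth_on UNIV f"
  shows "iter_deriv (\<lambda>x. L (f x)) vs = (\<lambda>x. L (iter_deriv f vs x))"
proof (induction vs)
  case (Cons v vs)
  have D: "((\<lambda>x. L (iter_deriv f vs x)) has_derivative (\<lambda>h. L (frechet_derivative (iter_deriv f vs) (at x) h))) (at x)" for x
    using smooth_on_has_derivative[OF smooth_on_iter_deriv[OF assms(2)] UNIV_I]
    by (rule bounded_linear.has_derivative[OF assms(1)])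
  show ?case by (simp add: Cons.IH frechet_derivative_at[OF D, symmetric])
qed simp

text \<open>The first slot is linear in x, so at most one of the derivatives falls on it. The
  Leibniz sum thus has one term for each omitted direction and one in which none is omitted.\<close>

lemma iter_deriv_bilinear_ident:
  assumes "bounded_bilinear br" "smooth_on UNIV g"
  shows "iter_deriv (\<lambda>x. br x (g x)) vs = (\<lambda>x. br x (iter_deriv g vs x) +
    (\<Sum>i<length vs. br (vs ! i) (iter_deriv g (take i vs @ drop (Suc i) vs) x)))"
proof (induction vs)
  case (Cons v vs)
  interpret bounded_bilinear br by fact
  define d where "d = (\<lambda>i. take i vs @ drop (Suc i) vs)"
  have D: "(iter_deriv g ws has_derivative frechet_derivative (iter_deriv g ws) (at x)) (at x)" for ws x
    by (rule smooth_on_has_derivative[OF smooth_on_iter_deriv[OF assms(2)] UNIV_I])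
  have D2: "((\<lambda>x. br x (iter_deriv g vs x) + (\<Sum>i<length vs. br (vs ! i) (iter_deriv g (d i) x))) has_derivative
      (\<lambda>h. (br x (frechet_derivative (iter_deriv g vs) (at x) h) + br h (iter_deriv g vs x)) +
        (\<Sum>i<length vs. br (vs ! i) (frechet_derivative (iter_deriv g (d i)) (at x) h)))) (at x)" for x
    by (intro has_derivative_add has_derivative_sum FDERIV D has_derivative_ident
        bounded_linear.has_derivative[OF bounded_linear_right])
  show ?case
    unfolding length_Cons sum.lessThan_Suc_shift
    by (simp add: Cons.IH add.assoc frechet_derivative_at[OF D2, unfolded d_def, symmetric])
qed simp

section \<open>Power series in ad x and their smoothness\<close>

lemma smooth_on_ad_power:
  fixes br :: "'a::euclidean_space \<Rightarrow> 'a \<Rightarrow> 'a"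
  assumes "bounded_bilinear br"
  shows "smooth_on UNIV (\<lambda>x. (br x ^^ n) y)"
  by (induction n) (auto intro: smooth_on_const smooth_on_bilinear[OF assms] smooth_on_ident)

text \<open>Each factor ad x contributes one Leibniz term bounded with \<open>R\<close> and at most
  \<open>k\<close> terms bounded with \<open>c\<close>. The length bound \<open>k\<close> is kept
  fixed since the induction also meets shorter lists.\<close>

lemma iter_deriv_ad_power_bound:
  fixes br :: "'a::euclidean_space \<Rightarrow> 'a \<Rightarrow> 'a"
  assumes br: "bounded_bilinear br" and a: "\<And>x y. norm (br x y) \<le> norm x * norm y * a" "a \<ge> 0"
    and c: "c \<ge> 0" and x: "norm x \<le> R" and vs: "\<forall>v\<in>set vs. norm v \<le> c" "length vs \<le> k"
  shows "norm (iter_deriv (\<lambda>x. (br x ^^ n) y) vs x) \<le> ((R + real k * c) * a) ^ n * norm y"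
  using vs
proof (induction n arbitrary: vs)
  case 0
  have "iter_deriv (\<lambda>x. y) vs x = (if vs = [] then y else 0)"
  proof (induction vs arbitrary: x)
    case (Cons v vs)
    then have "iter_deriv (\<lambda>x. y) vs = (\<lambda>x. if vs = [] then y else 0)" by auto
    then show ?case by simp
  qed simp
  then show ?case by simp
next
  case (Suc n)
  let ?B = "((R + real k * c) * a) ^ n * norm y"
  have R: "R \<ge> 0" using x norm_ge_zero order_trans by blast
  have B: "?B \<ge> 0" using R c a(2) by simp
  define d where "d = (\<lambda>i. take i vs @ drop (Suc i) vs)"
  have dd: "\<forall>v\<in>set (d i). norm v \<le> c" "length (d i) \<le> k" if "i < length vs" for i
    using Suc.prems that unfolding d_def by (auto dest: in_set_takeD in_set_dropD)
  have "iter_deriv (\<lambda>x. (br x ^^ Suc n) y) vs x = br x (iter_deriv (\<lambda>x. (br x ^^ n) y) vs x) +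
      (\<Sum>i<length vs. br (vs ! i) (iter_deriv (\<lambda>x. (br x ^^ n) y) (d i) x))"
    using iter_deriv_bilinear_ident[OF br smooth_on_ad_power[OF br, of n y], of vs] by (simp add: d_def)
  also have "norm \<dots> \<le> R * ?B * a + (\<Sum>i<length vs. c * ?B * a)"
  proof (rule norm_triangle_le, rule add_mono)
    show "norm (br x (iter_deriv (\<lambda>x. (br x ^^ n) y) vs x)) \<le> R * ?B * a"
      by (rule order_trans[OF a(1)], intro mult_right_mono mult_mono x Suc.IH Suc.prems a(2) R norm_ge_zero)
    show "norm (\<Sum>i<length vs. br (vs ! i) (iter_deriv (\<lambda>x. (br x ^^ n) y) (d i) x)) \<le> (\<Sum>i<length vs. c * ?B * a)"
    proof (rule sum_norm_le)
      fix i assume "i \<in> {..<length vs}"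
      then have i: "i < length vs" by simp
      show "norm (br (vs ! i) (iter_deriv (\<lambda>x. (br x ^^ n) y) (d i) x)) \<le> c * ?B * a"
        by (rule order_trans[OF a(1)], intro mult_right_mono mult_mono Suc.IH dd[OF i] a(2) c norm_ge_zero)
          (use Suc.prems i in auto)
    qed
  qed
  also have "\<dots> \<le> R * ?B * a + real k * (c * ?B * a)"
    using Suc.prems(2) B c a(2) by (auto intro!: mult_right_mono)
  also have "\<dots> = ((R + real k * c) * a) ^ Suc n * norm y" by (simp add: algebra_simps)
  finally show ?case .
qed

text \<open>The operator (1 - exp(-ad x)) / ad x applied to \<open>y\<close>; \<open>exp_jac\<close>
  is its determinant.\<close>

definition phi_ad :: "('a::euclidean_space \<Rightarrow> 'a \<Rightarrow> 'a) \<Rightarrow> 'a \<Rightarrow> 'a \<Rightarrow> 'a" where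
  "phi_ad br x y = (\<Sum>n. ((-1) ^ n / fact (Suc n)) *\<^sub>R (br x ^^ n) y)"

lemma norm_ad_power_le:
  fixes br :: "'a::euclidean_space \<Rightarrow> 'a \<Rightarrow> 'a"
  assumes a: "\<And>x y. norm (br x y) \<le> norm x * norm y * a" "a \<ge> 0"
  shows "norm ((br x ^^ n) y) \<le> (norm x * a) ^ n * norm y"
proof (induction n)
  case (Suc n)
  have "norm (br x ((br x ^^ n) y)) \<le> norm x * norm ((br x ^^ n) y) * a" by (rule a)
  also have "\<dots> \<le> norm x * ((norm x * a) ^ n * norm y) * a"
    by (intro mult_right_mono mult_left_mono Suc a) auto
  finally show ?case by (simp add: algebra_simps)
qed simp

lemma summable_exp_bound: "summable (\<lambda>n. q ^ n * C / fact n :: real)"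
  using summable_mult[OF summable_exp[of q], of C] by (simp add: field_simps)

lemma inverse_fact_Suc_le: "1 / fact (Suc n) \<le> (1 / fact n :: real)"
  by (intro divide_left_mono) (auto intro: fact_mono)

text \<open>The parameter \<open>q\<close> covers both series in use: q = 1 for
  \<open>phi_ad\<close> and q = |s| for exp(-s ad x).\<close>

lemma summable_ad_series:
  fixes br :: "'a::euclidean_space \<Rightarrow> 'a \<Rightarrow> 'a"
  assumes br: "bounded_bilinear br" and c: "\<And>n. \<bar>c n\<bar> \<le> q ^ n / fact n"
  shows "summable (\<lambda>n. c n *\<^sub>R (br x ^^ n) y)"
proof -
  obtain a where a: "a \<ge> 0" "\<And>x y. norm (br x y) \<le> norm x * norm y * a"
    using bounded_bilinear.nonneg_bounded[OF br] by blast
  have "norm (c n *\<^sub>R (br x ^^ n) y) \<le> (q * (norm x * a)) ^ n * norm y / fact n" for n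
  proof -
    have "norm (c n *\<^sub>R (br x ^^ n) y) \<le> (q ^ n / fact n) * ((norm x * a) ^ n * norm y)"
      using c[of n] norm_ad_power_le[OF a(2,1), where x=x and n=n and y=y] abs_ge_zero[of "c n"]
      by (simp only: norm_scaleR) (intro mult_mono, auto)
    then show ?thesis by (simp add: power_mult_distrib algebra_simps)
  qed
  then show ?thesis by (intro summable_comparison_test'[OF summable_exp_bound, of 0]) auto
qed

lemma summable_phi_ad:
  fixes br :: "'a::euclidean_space \<Rightarrow> 'a \<Rightarrow> 'a"
  assumes "bounded_bilinear br"
  shows "summable (\<lambda>n. ((-1) ^ n / fact (Suc n)) *\<^sub>R (br x ^^ n) y)"
  by (rule summable_ad_series[OF assms, where q=1 and c="\<lambda>n. (-1) ^ n / fact (Suc n)"])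
    (use inverse_fact_Suc_le in \<open>simp add: abs_divide power_abs del: fact_Suc\<close>)

lemma smooth_on_phi_ad:
  fixes br :: "'a::euclidean_space \<Rightarrow> 'a \<Rightarrow> 'a"
  assumes br: "bounded_bilinear br"
  shows "smooth_on UNIV (\<lambda>x. phi_ad br x y)"
proof (rule smooth_on_local)
  fix x0 :: 'a
  \<comment> \<open>The bounds on the derivatives are uniform only on bounded sets, so smoothness is
    shown on a ball around 0 containing \<open>x0\<close>.\<close>
  define R where "R = norm x0 + 1"
  obtain a where a: "a \<ge> 0" "\<And>x y. norm (br x y) \<le> norm x * norm y * a"
    using bounded_bilinear.nonneg_bounded[OF br] by blast
  have "smooth_on (ball 0 R) (\<lambda>x. \<Sum>n. ((-1) ^ n / fact (Suc n)) *\<^sub>R (br x ^^ n) y)"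
  proof (rule smooth_on_series)
    show "smooth_on (ball 0 R) (\<lambda>x. ((-1) ^ n / fact (Suc n)) *\<^sub>R (br x ^^ n) y)" for n
      by (intro smooth_on_linear[OF bounded_linear_scaleR_right] smooth_on_subset[OF smooth_on_ad_power[OF br]]) auto
    fix vs :: "'a list"
    \<comment> \<open>The sum of the norms bounds every direction in the list and also makes sense
      for the empty list.\<close>
    define c where "c = (\<Sum>v\<leftarrow>vs. norm v)"
    have c: "c \<ge> 0" "\<forall>v\<in>set vs. norm v \<le> c"
      unfolding c_def by (auto intro!: sum_list_nonneg member_le_sum_list)
    let ?q = "(R + real (length vs) * c) * a"
    have "norm (iter_deriv (\<lambda>x. ((-1) ^ n / fact (Suc n)) *\<^sub>R (br x ^^ n) y) vs x) \<le> ?q ^ n * norm y / fact n"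
      if x: "x \<in> ball 0 R" for n x
    proof -
      have "iter_deriv (\<lambda>x. ((-1) ^ n / fact (Suc n)) *\<^sub>R (br x ^^ n) y) vs x =
          ((-1) ^ n / fact (Suc n)) *\<^sub>R iter_deriv (\<lambda>x. (br x ^^ n) y) vs x"
        using iter_deriv_linear[OF bounded_linear_scaleR_right smooth_on_ad_power[OF br]] by metis
      also have "norm \<dots> \<le> (1 / fact n) * (?q ^ n * norm y)"
        unfolding norm_scaleR
      proof (intro mult_mono)
        show "\<bar>(- 1) ^ n / fact (Suc n)\<bar> \<le> (1 / fact n :: real)"
          using inverse_fact_Suc_le[of n] by (simp add: abs_divide power_abs del: fact_Suc)
        show "norm (iter_deriv (\<lambda>x. (br x ^^ n) y) vs x) \<le> ?q ^ n * norm y"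
          by (rule iter_deriv_ad_power_bound[OF br a(2,1) c(1) _ c(2)]) (use x in auto)
      qed auto
      finally show ?thesis by simp
    qed
    then show "\<exists>M. summable M \<and> (\<forall>n. \<forall>x\<in>ball 0 R.
        norm (iter_deriv (\<lambda>x. ((-1) ^ n / fact (Suc n)) *\<^sub>R (br x ^^ n) y) vs x) \<le> M n)"
      using summable_exp_bound[of ?q "norm y"] by blast
  qed auto
  then show "\<exists>T. x0 \<in> T \<and> smooth_on T (\<lambda>x. phi_ad br x y)"
    unfolding phi_ad_def[abs_def] by (intro exI[of _ "ball 0 R"]) (simp add: R_def)
qed

text \<open>Here \<open>y s\<close> is exp(-s ad x) v. Each of its coordinates is a real power
  series in s, which is differentiated term by term.\<close>

lemma exp_ad_deriv:
  fixes br :: "'a::euclidean_space \<Rightarrow> 'a \<Rightarrow> 'a" and x v :: 'a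
  assumes bounded_bilinear_br: "bounded_bilinear br"
  defines "y \<equiv> \<lambda>s. \<Sum>n. ((- s) ^ n / fact n) *\<^sub>R (br x ^^ n) v"
  shows "(y has_vector_derivative - br x (y s)) (at s)"
proof -
  interpret bounded_bilinear br by fact
  have sm: "summable (\<lambda>n. ((- s) ^ n / fact n) *\<^sub>R (br x ^^ n) v)" for s :: real
    by (rule summable_ad_series[OF bounded_bilinear_br, where q = "\<bar>s\<bar>" and c = "\<lambda>n. (- s) ^ n / fact n"])
      (simp add: abs_divide power_abs)
  define c where "c = (\<lambda>b n. ((-1) ^ n / fact n) * ((br x ^^ n) v \<bullet> b))"
  have c: "((- s) ^ n / fact n) *\<^sub>R (br x ^^ n) v \<bullet> b = c b n * s ^ n" for s b n
    unfolding c_def by (subst power_minus) simp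
  have smc: "summable (\<lambda>n. c b n * s ^ n)" for b s
    using bounded_linear.summable[OF bounded_linear_inner_left[of b] sm[of s]] unfolding c .
  have yc: "y s \<bullet> b = (\<Sum>n. c b n * s ^ n)" for s b
    unfolding y_def using bounded_linear.suminf[OF bounded_linear_inner_left[of b] sm[of s]] unfolding c by simp
  have "(\<Sum>n. diffs (c b) n * s ^ n) = (- br x (y s)) \<bullet> b" for b
  proof -
    have bl: "bounded_linear (\<lambda>z. - br x z \<bullet> b)"
      by (rule bounded_linear_compose[OF bounded_linear_inner_left bounded_linear_minus[OF bounded_linear_right]])
    have "diffs (c b) n * s ^ n = - br x (((- s) ^ n / fact n) *\<^sub>R (br x ^^ n) v) \<bullet> b" for n
    proof -
      have "of_nat (Suc n) * ((-1) ^ Suc n / fact (Suc n)) = (- ((-1) ^ n / fact n) :: real)"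
        unfolding fact_Suc power_Suc by (simp del: of_nat_Suc)
      then have "diffs (c b) n * s ^ n = - ((-1) ^ n / fact n) * ((br x ^^ Suc n) v \<bullet> b) * s ^ n"
        unfolding diffs_def c_def by (metis mult.assoc)
      then show ?thesis by (simp add: power_minus[of s] scaleR_right)
    qed
    then show ?thesis
      unfolding y_def using bounded_linear.suminf[OF bl sm[of s]] by simp
  qed
  then have D: "((\<lambda>s. y s \<bullet> b) has_real_derivative (- br x (y s)) \<bullet> b) (at s)" for b
    using termdiffs_strong_converges_everywhere[of "c b" s] smc unfolding yc by simp
  have "((\<lambda>s. \<Sum>b\<in>Basis. (y s \<bullet> b) *\<^sub>R b) has_vector_derivative (\<Sum>b\<in>Basis. ((- br x (y s)) \<bullet> b) *\<^sub>R b)) (at s)"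
    using has_vector_derivative_scaleR[OF D has_vector_derivative_const]
    by (intro has_vector_derivative_sum) simp
  then show ?thesis by (simp only: euclidean_representation)
qed

lemma phi_ad_fixed:
  fixes br :: "'a::euclidean_space \<Rightarrow> 'a \<Rightarrow> 'a"
  assumes "br x v = 0" "bounded_bilinear br"
  shows "phi_ad br x v = v"
proof -
  interpret bounded_bilinear br by fact
  have "(br x ^^ Suc n) v = 0" for n by (induction n) (auto simp: assms(1) zero_right)
  then have "((-1) ^ Suc n / fact (Suc (Suc n))) *\<^sub>R (br x ^^ Suc n) v = 0" for n by (simp only: scaleR_zero_right)
  then show ?thesis
    unfolding phi_ad_def using suminf_split_head[OF summable_phi_ad[OF assms(2)], of x v] by simp
qed

lemma linear_phi_ad:
  fixes br :: "'a::euclidean_space \<Rightarrow> 'a \<Rightarrow> 'a"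
  assumes bounded_bilinear_br: "bounded_bilinear br"
  shows "linear (phi_ad br x)"
proof -
  interpret bounded_bilinear br by fact
  have l: "linear (br x ^^ n)" for n
  proof (induction n)
    case (Suc n)
    then show ?case
      unfolding funpow.simps by (rule linear_compose[OF _ bounded_linear.linear[OF bounded_linear_right]])
  qed (simp add: id_def linear_id[unfolded id_def])
  note s = summable_phi_ad[OF bounded_bilinear_br, of x]
  show ?thesis
  proof (rule linearI)
    fix y z r
    show "phi_ad br x (y + z) = phi_ad br x y + phi_ad br x z"
      unfolding phi_ad_def by (simp only: linear_add[OF l] scaleR_add_right suminf_add[OF s s])
    show "phi_ad br x (r *\<^sub>R y) = r *\<^sub>R phi_ad br x y"
      unfolding phi_ad_def
      by (simp only: linear_cmul[OF l] scaleR_left_commute[of _ r] suminf_scaleR_right[OF s])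
  qed
qed

section \<open>The operator \<open>phi_ad\<close> is injective on the domain of the exponential
  chart\<close>

context lie_group_exp
begin

lemma bounded_bilinear_br: "bounded_bilinear br"
  using bilinear_br bilinear_conv_bounded_bilinear by blast

lemma br_skew: "br x y = - br y x"
proof -
  interpret bounded_bilinear br by (rule bounded_bilinear_br)
  have "br (x + y) (x + y) = 0" by (rule br_self)
  then have "br y x + br x y = 0" unfolding add_left add_right by (simp add: br_self add.commute)
  then show ?thesis using eq_neg_iff_add_eq_0 add.commute by metis
qed

text \<open>The hypothesis gives \<open>e\<^sup>-\<^sup>a\<^sup>d\<^sup>x v = v\<close>, and \<open>s \<mapsto> Ad (exp (s x)) e\<^sup>-\<^sup>s\<^sup>a\<^sup>d\<^sup>x v\<close> is constant.\<close>

lemma Ad_E_phi_ad_zero: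
  assumes x: "x \<in> U" and v: "phi_ad br x v = 0"
  shows "Ad (E x) v = v"
proof -
  interpret bounded_bilinear br by (rule bounded_bilinear_br)
  define y where "y = (\<lambda>s. \<Sum>n. ((- s) ^ n / fact n) *\<^sub>R (br x ^^ n) v)"
  define I where "I = {s. s *\<^sub>R x \<in> U}"
  have Dy: "(y has_vector_derivative - br x (y s)) (at s)" for s
    unfolding y_def by (rule exp_ad_deriv[OF bounded_bilinear_br])
  \<comment> \<open>Both the operator and the vector depend on s; expanding the vector in the basis
    reduces the derivative to the product rule for scalars times curves.\<close>
  have Q: "Ad (E (s *\<^sub>R x)) w = (\<Sum>b\<in>Basis. (w \<bullet> b) *\<^sub>R Ad (E (s *\<^sub>R x)) b)" for s w
    by (rule linear_eq_sum_Basis[OF linear_Ad])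
  have "((\<lambda>s. Ad (E (s *\<^sub>R x)) (y s)) has_vector_derivative 0) (at s within I)" if s: "s \<in> I" for s
  proof -
    have s': "s *\<^sub>R x \<in> U" using s by (simp add: I_def)
    have Dc: "((\<lambda>s. y s \<bullet> b) has_real_derivative (- br x (y s)) \<bullet> b) (at s)" for b
      using bounded_linear.has_vector_derivative[OF bounded_linear_inner_left Dy]
      by (simp add: has_real_derivative_iff_has_vector_derivative)
    have "((\<lambda>s. \<Sum>b\<in>Basis. (y s \<bullet> b) *\<^sub>R Ad (E (s *\<^sub>R x)) b) has_vector_derivative
      (\<Sum>b\<in>Basis. (y s \<bullet> b) *\<^sub>R br x (Ad (E (s *\<^sub>R x)) b) + ((- br x (y s)) \<bullet> b) *\<^sub>R Ad (E (s *\<^sub>R x)) b)) (at s)"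
      by (intro has_vector_derivative_sum has_vector_derivative_scaleR Dc Ad_deriv s')
    also have "(\<Sum>b\<in>Basis. (y s \<bullet> b) *\<^sub>R br x (Ad (E (s *\<^sub>R x)) b) + ((- br x (y s)) \<bullet> b) *\<^sub>R Ad (E (s *\<^sub>R x)) b) =
        br x (Ad (E (s *\<^sub>R x)) (y s)) + Ad (E (s *\<^sub>R x)) (- br x (y s))"
      by (simp only: sum.distrib Q[of s "y s"] Q[of s "- br x (y s)"] sum_right scaleR_right)
    also have "\<dots> = 0"
      using Ad_br[of "E (s *\<^sub>R x)" x "y s"] by (simp add: Ad_E_fixed[OF s'] linear_neg[OF linear_Ad])
    finally show ?thesis
      unfolding Q[symmetric] by (rule has_vector_derivative_at_within)
  qed
  then obtain c where c: "\<And>s. s \<in> I \<Longrightarrow> Ad (E (s *\<^sub>R x)) (y s) = c"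
    using has_vector_derivative_zero_constant[of I] convex_scaleR_vimage unfolding I_def by blast
  have sm: "summable (\<lambda>n. ((- 1) ^ n / fact n) *\<^sub>R (br x ^^ n) v)"
    by (rule summable_ad_series[OF bounded_bilinear_br, where q = 1]) (simp add: abs_divide power_abs)
  have y0: "y 0 = v"
    unfolding y_def using suminf_finite[of "{0}" "\<lambda>n. ((- 0) ^ n / fact n) *\<^sub>R (br x ^^ n) v"] by simp
  \<comment> \<open>Splitting off the term n = 0 gives exp(-ad x) v = v - ad x (phi_ad x v), and the
    last term vanishes by hypothesis.\<close>
  have "y 1 = v + (\<Sum>n. ((- 1) ^ Suc n / fact (Suc n)) *\<^sub>R (br x ^^ Suc n) v)"
    unfolding y_def using suminf_split_head[OF sm] by (simp del: fact_Suc funpow.simps)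
  also have "(\<Sum>n. ((- 1) ^ Suc n / fact (Suc n)) *\<^sub>R (br x ^^ Suc n) v) =
      (\<Sum>n. - br x (((- 1) ^ n / fact (Suc n)) *\<^sub>R (br x ^^ n) v))"
    by (simp add: scaleR_right del: fact_Suc)
  also have "\<dots> = - br x (phi_ad br x v)"
    unfolding phi_ad_def
    by (rule bounded_linear.suminf[OF bounded_linear_minus[OF bounded_linear_right] summable_phi_ad[OF bounded_bilinear_br], symmetric])
  finally have y1: "y 1 = v" using v by (simp add: zero_right)
  show ?thesis using c[of 0] c[of 1] x zeroU y0 y1 by (simp add: I_def E_0 Ad_e)
qed

lemma eventually_scaleR_in_U: "eventually (\<lambda>s::real. s *\<^sub>R v \<in> U) (at 0)"
proof -
  have "((\<lambda>s. s *\<^sub>R v) \<longlongrightarrow> 0 *\<^sub>R v) (at 0)" by (intro tendsto_intros)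
  then show ?thesis using topological_tendstoD[OF _ openU] zeroU by simp
qed

lemma Ad_curve_deriv: "((\<lambda>s. Ad (E (s *\<^sub>R v)) x) has_vector_derivative br v x) (at 0)"
  using Ad_deriv[of 0 v x] zeroU by (simp add: E_0 Ad_e)

lemma eventually_Ad_curve:
  assumes "open S" "x \<in> S"
  shows "eventually (\<lambda>s. Ad (E (s *\<^sub>R v)) x \<in> S) (at 0)"
proof -
  have "isCont (\<lambda>s. Ad (E (s *\<^sub>R v)) x) 0"
    using Ad_curve_deriv by (rule has_vector_derivative_continuous)
  then have "((\<lambda>s. Ad (E (s *\<^sub>R v)) x) \<longlongrightarrow> x) (at 0)"
    unfolding isCont_def by (simp add: E_0 Ad_e)
  then show ?thesis using assms by (rule topological_tendstoD)
qed

lemma phi_ad_nonzero: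
  assumes x: "x \<in> U" and v: "phi_ad br x v = 0"
  shows "v = 0"
proof -
  interpret bounded_bilinear br by (rule bounded_bilinear_br)
  have "Ad (E (s *\<^sub>R v)) x = x" if "s *\<^sub>R v \<in> U" "Ad (E (s *\<^sub>R v)) x \<in> U" for s
  proof -
    have "Ad (E x) (s *\<^sub>R v) = s *\<^sub>R v"
      using Ad_E_phi_ad_zero[OF x v] by (simp add: linear_cmul[OF linear_Ad])
    then have "mul (mul (E x) (E (s *\<^sub>R v))) (iv (E x)) = E (s *\<^sub>R v)"
      using E_conjugate[of "E x" "s *\<^sub>R v"] that(1) by simp
    then have "mul (E x) (E (s *\<^sub>R v)) = mul (E (s *\<^sub>R v)) (E x)"
      by (metis G.assoc G.left_inverse G.right_neutral)
    then have "mul (mul (E (s *\<^sub>R v)) (E x)) (iv (E (s *\<^sub>R v))) = E x"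
      by (metis G.assoc G.right_inverse G.right_neutral)
    then have "E (Ad (E (s *\<^sub>R v)) x) = E x"
      using E_conjugate[OF that(2)] by simp
    moreover have "inj_on E U" using diffeo_E unfolding diffeo_onto_image_def by blast
    ultimately show ?thesis using that(2) x by (auto dest: inj_onD)
  qed
  note fixed = this
  have "eventually (\<lambda>s. Ad (E (s *\<^sub>R v)) x = x) (at 0)"
    using eventually_scaleR_in_U[of v] eventually_Ad_curve[OF openU x, of v] by eventually_elim (rule fixed)
  then have "br v x = 0"
    using has_vector_derivative_eventually_unique[OF Ad_curve_deriv[of v x] has_vector_derivative_const[of x]]
    by (simp add: E_0 Ad_e)
  then have "br x v = 0" using br_skew[of x v] by simp
  \<comment> \<open>On the kernel of ad x only the constant term 1 of the series survives, so
    \<open>v = phi_ad br x v = 0\<close>.\<close>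
  then show ?thesis using phi_ad_fixed[OF _ bounded_bilinear_br] v by metis
qed

lemma phi_ad_Ad: "phi_ad br (Ad g x) (Ad g y) = Ad g (phi_ad br x y)"
proof -
  have p: "(br (Ad g x) ^^ n) (Ad g y) = Ad g ((br x ^^ n) y)" for n
    by (induction n) (simp_all add: Ad_br)
  have bl: "bounded_linear (Ad g)" using linear_Ad linear_conv_bounded_linear by blast
  show ?thesis
    unfolding phi_ad_def p linear_cmul[OF linear_Ad, symmetric]
    by (rule bounded_linear.suminf[OF bl summable_phi_ad[OF bounded_bilinear_br], symmetric])
qed

end

lemma smooth_on_exp_jac:
  assumes "bounded_bilinear br"
  shows "smooth_on UNIV (exp_jac br)"
proof -
  have eq: "exp_jac br = (\<lambda>x. \<Sum>p\<in>{p. p permutes UNIV}. of_int (sign p) * (\<Prod>i\<in>UNIV. phi_ad br x (axis (p i) 1) $ i))"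
    by (simp add: exp_jac_def phi_ad_def fun_eq_iff det_def matrix_def)
  show ?thesis unfolding eq
    by (intro smooth_on_sum smooth_on_mult smooth_on_const smooth_on_prod open_UNIV
        smooth_on_linear[OF bounded_linear_vec_nth] smooth_on_phi_ad assms)
qed

section \<open>Positivity of J and smoothness of Phi_t and kappa_t on O x O\<close>

locale lie_group_exp_domain = lie_group_exp br A mul e iv lf E U
  for br :: "real^'n \<Rightarrow> real^'n \<Rightarrow> real^'n"
    and A :: "('g::{t2_space,second_countable_topology} set \<times> ('g \<Rightarrow> 'v::euclidean_space)) set"
    and mul e iv lf E U +
  fixes Ob :: "(real^'n) set"
  assumes starO: "star_nbhd_0 Ob" and OU: "Ob \<subseteq> U"
    and closed: "\<forall>x\<in>Ob. \<forall>y\<in>Ob. mul (E x) (E y) \<in> E ` U"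
begin

abbreviation "J \<equiv> exp_jac br"
abbreviation "W \<equiv> Ob \<times> Ob"
abbreviation "Ph \<equiv> Phi mul E U"

lemma J_eq: "J x = det (matrix (phi_ad br x))"
  unfolding exp_jac_def phi_ad_def[abs_def] ..

lemma linear_phi: "linear (phi_ad br x)"
  using linear_phi_ad[OF bounded_bilinear_br] .

lemma J_nonzero:
  assumes "x \<in> U"
  shows "J x \<noteq> 0"
proof -
  have "inj (phi_ad br x)"
    using linear_phi phi_ad_nonzero[OF assms] by (auto simp: linear_injective_0)
  then show ?thesis unfolding J_eq using det_nz_iff_inj[OF linear_phi] by blast
qed

text \<open>\<open>Ad g\<close> is invertible and conjugates \<open>phi_ad br x\<close> into
  \<open>phi_ad br (Ad g x)\<close>, so the determinants agree.\<close>

lemma J_Ad: "J (Ad g x) = J x"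
proof -
  have inv: "Ad (iv g) (Ad g y) = y" for y
    by (simp add: Ad_e flip: Ad_mul)
  then have "inj (Ad g)" by (metis injI)
  then have nz: "det (matrix (Ad g)) \<noteq> 0" using det_nz_iff_inj[OF linear_Ad] by blast
  have "phi_ad br (Ad g x) \<circ> Ad g = Ad g \<circ> phi_ad br x"
    by (simp add: fun_eq_iff phi_ad_Ad)
  then have "matrix (phi_ad br (Ad g x)) ** matrix (Ad g) = matrix (Ad g) ** matrix (phi_ad br x)"
    by (metis matrix_compose linear_Ad linear_phi)
  then have "J (Ad g x) * det (matrix (Ad g)) = det (matrix (Ad g)) * J x"
    unfolding J_eq det_mul[symmetric] by simp
  then show ?thesis using nz by simp
qed

text \<open>If J were not positive at \<open>x\<close>, the intermediate value theorem on the
  segment from 0, where J = 1, would give a zero inside the star-shaped \<open>U\<close>.\<close>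

lemma J_pos:
  assumes x: "x \<in> U"
  shows "J x > 0"
proof (rule ccontr)
  assume "\<not> J x > 0"
  moreover have "J 0 = 1"
  proof -
    have "phi_ad br 0 = id"
      using phi_ad_fixed[OF _ bounded_bilinear_br, of 0] bounded_bilinear.zero_left[OF bounded_bilinear_br] by (auto simp: fun_eq_iff)
    then show ?thesis by (simp add: J_eq matrix_id)
  qed
  moreover have "continuous_on {0..1} (\<lambda>t. J (t *\<^sub>R x))"
    by (rule continuous_on_compose2[OF smooth_on_continuous_on[OF smooth_on_exp_jac[OF bounded_bilinear_br]]
          continuous_on_scaleR[OF continuous_on_id continuous_on_const] subset_UNIV])
  ultimately obtain t where t: "0 \<le> t" "t \<le> 1" "J (t *\<^sub>R x) = 0"
    using IVT2'[of "\<lambda>t. J (t *\<^sub>R x)" 1 0 0] by auto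
  have "t *\<^sub>R x \<in> closed_segment 0 x" using t(1,2) by (auto simp: closed_segment_def)
  then have "t *\<^sub>R x \<in> U" using star x unfolding star_nbhd_0_def by blast
  then show False using J_nonzero t(3) by blast
qed

lemma openO: "open Ob" and openW: "open W"
  using starO unfolding star_nbhd_0_def by (auto intro: open_Times)

lemma scale_W:
  assumes "p \<in> W" "0 \<le> t" "t \<le> 1"
  shows "t *\<^sub>R p \<in> W"
proof -
  have "t *\<^sub>R x \<in> Ob" if "x \<in> Ob" for x
  proof -
    have "t *\<^sub>R x \<in> closed_segment 0 x" using assms(2,3) by (auto simp: closed_segment_def)
    then show ?thesis using starO that unfolding star_nbhd_0_def by blast
  qed
  then show ?thesis using assms(1) by (cases p) auto
qed

lemma inj_E: "inj_on E U" and log_smooth: "smooth_from A (E ` U) (inv_into U E)" and open_EU: "open (E ` U)"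
  using diffeo_E unfolding diffeo_onto_image_def by auto

lemma Ph_in_U: "p \<in> W \<Longrightarrow> Ph p \<in> U" and E_Ph: "p \<in> W \<Longrightarrow> E (Ph p) = mul (E (fst p)) (E (snd p))"
  using closed by (auto simp: Phi_def inv_into_into f_inv_into_f)

lemma smooth_Ph: "smooth_on W Ph"
proof -
  have "smooth_into A W (\<lambda>p. mul (E (fst p)) (E (snd p)))"
    by (intro smooth_into_mul[OF G openW] E_smooth_into_compose[OF openW]
        bounded_linear_smooth_on[OF bounded_linear_fst openW] bounded_linear_smooth_on[OF bounded_linear_snd openW])
      (use OU in auto)
  then have "smooth_on W (\<lambda>p. inv_into U E (mul (E (fst p)) (E (snd p))))"
    by (rule smooth_on_smooth_from[OF atlas log_smooth open_EU openW]) (use closed in auto)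
  then show ?thesis by (simp add: Phi_def split_beta')
qed

lemma smooth_J_powr:
  fixes q :: "'b::euclidean_space \<Rightarrow> real^'n"
  assumes "open S" "smooth_on S q" "\<And>x. x \<in> S \<Longrightarrow> q x \<in> U"
  shows "smooth_on S (\<lambda>x. J (q x) powr a)"
proof (rule smooth_on_compose[OF assms(1) _ _ _ smooth_on_powr])
  show "smooth_on S (\<lambda>x. J (q x))"
    by (rule smooth_on_compose[OF assms(1) open_UNIV _ assms(2) smooth_on_exp_jac[OF bounded_bilinear_br]]) auto
qed (use J_pos assms(3) in auto)

lemma smooth_kappa: "smooth_on W (kappa br mul E U)"
proof (rule smooth_on_cong_imp[OF openW])
  \<comment> \<open>On positive arguments the square roots are rewritten as powers, whose smoothness
    is known; the negative exponent avoids a quotient rule.\<close>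
  show "smooth_on W (\<lambda>p. J (fst p) powr (1/2) * J (snd p) powr (1/2) * J (Ph p) powr (-(1/2)))"
    by (intro smooth_on_mult openW smooth_J_powr smooth_Ph bounded_linear_smooth_on[OF bounded_linear_fst openW]
        bounded_linear_smooth_on[OF bounded_linear_snd openW])
      (use OU Ph_in_U in auto)
  fix p assume p: "p \<in> W"
  then have "fst p \<in> U" "snd p \<in> U" "Ph p \<in> U" using OU Ph_in_U by auto
  then have "J (fst p) > 0" "J (snd p) > 0" "J (Ph p) > 0" using J_pos by auto
  then show "J (fst p) powr (1/2) * J (snd p) powr (1/2) * J (Ph p) powr (-(1/2)) = kappa br mul E U p"
    by (simp only: kappa_def split_beta' prod.collapse powr_minus powr_half_sqrt less_imp_le divide_inverse[of _ "sqrt _"])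
qed

lemma smooth_scale: "smooth_on S q \<Longrightarrow> open S \<Longrightarrow> smooth_on S (\<lambda>p. t *\<^sub>R q p)"
  by (rule smooth_on_linear[OF bounded_linear_scaleR_right])

lemma smooth_Phi_t:
  assumes "0 \<le> t" "t \<le> 1"
  shows "smooth_on W (Phi_t mul E U t)"
proof (cases "t = 0")
  case True
  then have "Phi_t mul E U t = (\<lambda>p. fst p + snd p)" by (auto simp: Phi_t_def fun_eq_iff)
  then show ?thesis
    using bounded_linear_smooth_on[OF bounded_linear_add[OF bounded_linear_fst bounded_linear_snd] openW] by simp
next
  case False
  then have "Phi_t mul E U t = (\<lambda>p. (1 / t) *\<^sub>R Ph (t *\<^sub>R p))" by (auto simp: Phi_t_def fun_eq_iff)
  then show ?thesis
    using smooth_scale[OF smooth_on_compose[OF openW openW _ smooth_scale[OF smooth_on_ident openW] smooth_Ph] openW]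
      scale_W[OF _ assms] by auto
qed

lemma smooth_kappa_t:
  assumes "0 \<le> t" "t \<le> 1"
  shows "smooth_on W (kappa_t br mul E U t)"
proof (cases "t = 0")
  case True
  then have "kappa_t br mul E U t = (\<lambda>p. 1)" by (auto simp: kappa_t_def fun_eq_iff)
  then show ?thesis by (simp add: smooth_on_const)
next
  case False
  then have "kappa_t br mul E U t = (\<lambda>p. kappa br mul E U (t *\<^sub>R p))" by (auto simp: kappa_t_def fun_eq_iff)
  then show ?thesis
    using smooth_on_compose[OF openW openW _ smooth_scale[OF smooth_on_ident openW] smooth_kappa]
      scale_W[OF _ assms] by auto
qed

section \<open>Invariance of kappa_t and equivariance of Phi_t\<close>

abbreviation "Ad2 g p \<equiv> (Ad g (fst p), Ad g (snd p))"

text \<open>Both sides have the same image under \<open>E\<close>, which is injective on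
  \<open>U\<close>. The side conditions keep the points inside the domains; near the unit they hold
  automatically.\<close>

lemma Ph_Ad:
  assumes "p \<in> W" "Ad2 g p \<in> W" "Ad g (Ph p) \<in> U"
  shows "Ph (Ad2 g p) = Ad g (Ph p)"
proof -
  have U: "Ad g (fst p) \<in> U" "Ad g (snd p) \<in> U" using assms(2) OU by auto
  have "E (Ph (Ad2 g p)) = mul (E (Ad g (fst p))) (E (Ad g (snd p)))" using E_Ph[OF assms(2)] by simp
  also have "\<dots> = mul (mul g (E (Ph p))) (iv g)"
    unfolding E_conjugate[OF U(1), symmetric] E_conjugate[OF U(2), symmetric] E_Ph[OF assms(1)]
    by (simp add: group_simps)
  also have "\<dots> = E (Ad g (Ph p))" by (rule E_conjugate[OF assms(3)])
  finally show ?thesis using inj_E Ph_in_U[OF assms(2)] assms(3) by (auto dest: inj_onD)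
qed

lemma eventually_Ph_kappa:
  assumes "p \<in> W"
  shows "eventually (\<lambda>s. Ph (Ad2 (E (s *\<^sub>R v)) p) = Ad (E (s *\<^sub>R v)) (Ph p) \<and>
    kappa br mul E U (Ad2 (E (s *\<^sub>R v)) p) = kappa br mul E U p) (at 0)"
proof -
  have p: "fst p \<in> Ob" "snd p \<in> Ob" using assms by auto
  from eventually_Ad_curve[OF openO p(1), of v] eventually_Ad_curve[OF openO p(2), of v]
    eventually_Ad_curve[OF openU Ph_in_U[OF assms], of v]
  show ?thesis
  proof eventually_elim
    case (elim s)
    then have "Ph (Ad2 (E (s *\<^sub>R v)) p) = Ad (E (s *\<^sub>R v)) (Ph p)"
      by (intro Ph_Ad assms) auto
    then show ?case by (cases p) (simp add: kappa_def J_Ad)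
  qed
qed

lemma eventually_Phi_t_kappa_t:
  assumes p: "p \<in> W" and t: "0 \<le> t" "t \<le> 1"
  shows "eventually (\<lambda>s. Phi_t mul E U t (Ad2 (E (s *\<^sub>R v)) p) = Ad (E (s *\<^sub>R v)) (Phi_t mul E U t p) \<and>
    kappa_t br mul E U t (Ad2 (E (s *\<^sub>R v)) p) = kappa_t br mul E U t p) (at 0)"
proof (cases "t = 0")
  case True
  then show ?thesis
    by (cases p) (simp add: Phi_t_def kappa_t_def linear_add[OF linear_Ad])
next
  case False
  from eventually_Ph_kappa[OF scale_W[OF p t], of v] show ?thesis
    by eventually_elim
      (use False in \<open>cases p; simp add: Phi_t_def kappa_t_def linear_cmul[OF linear_Ad]\<close>)
qed

text \<open>Tested on f, this says that the derivative of kappa_t f(Phi_t) along the diagonal field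
  is kappa_t times the derivative of f along its field, taken at Phi_t. Along the adjoint curve of a
  point kappa_t is constant and Phi_t equivariant for small s, so both are the velocity of one real
  curve.\<close>

lemma m_map_ad_lie:
  assumes u: "smooth_functional W u" and t: "0 \<le> t" "t \<le> 1"
  shows "m_map br mul E U Ob t (ad_lie (br2 br) W (diag \<zeta>) u) = ad_lie br UNIV \<zeta> (m_map br mul E U Ob t u)"
proof
  fix f
  let ?F = "Phi_t mul E U t" and ?k = "kappa_t br mul E U t"
  interpret B: bounded_bilinear br by (rule bounded_bilinear_br)
  show "m_map br mul E U Ob t (ad_lie (br2 br) W (diag \<zeta>) u) f = ad_lie br UNIV \<zeta> (m_map br mul E U Ob t u) f"
  proof (cases "smooth_on UNIV f")
    case False
    then show ?thesis by (simp add: m_map_def dist_push_def ad_lie_def dist_lie_def)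
  next
    case True
    let ?Xf = "\<lambda>q. frechet_derivative f (at q) (br q \<zeta>)"
    have comp: "smooth_on W (\<lambda>p. h (?F p))" if "smooth_on UNIV h" for h :: "real^'n \<Rightarrow> real"
      by (rule smooth_on_compose[OF openW open_UNIV _ smooth_Phi_t[OF t] that]) auto
    have sXf: "smooth_on UNIV ?Xf"
      by (rule smooth_on_frechet_derivative_field[OF open_UNIV True bounded_linear_smooth_on[OF B.bounded_linear_left open_UNIV]])
    have sk: "smooth_on W (\<lambda>p. ?k p * f (?F p))"
      by (rule smooth_on_mult[OF openW smooth_kappa_t[OF t] comp[OF True]])
    have "frechet_derivative (\<lambda>p. ?k p * f (?F p)) (at p) (br2 br p (diag \<zeta>)) = ?k p * ?Xf (?F p)" if p: "p \<in> W" for p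
    proof -
      \<comment> \<open>The field of the action is \<open>br p \<zeta>\<close>, with
        \<open>p\<close> on the left, so its curves come from exp(-s zeta).\<close>
      let ?c = "\<lambda>s. Ad2 (E (s *\<^sub>R (- \<zeta>))) p"
      have c0: "?c 0 = p" by (simp add: E_0 Ad_e)
      have Dc: "(?c has_vector_derivative (br (- \<zeta>) (fst p), br (- \<zeta>) (snd p))) (at 0)"
        by (intro has_vector_derivative_Pair Ad_curve_deriv)
      have v: "(br (- \<zeta>) (fst p), br (- \<zeta>) (snd p)) = br2 br p (diag \<zeta>)"
        using br_skew[of "fst p" \<zeta>] br_skew[of "snd p" \<zeta>] by (simp add: br2_def diag_def B.minus_left)
      have "(\<lambda>p. ?k p * f (?F p)) differentiable (at (?c 0))"
        unfolding c0 by (rule smooth_on_differentiable[OF sk p])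
      from has_derivative_along_curve[OF this Dc]
      have D1: "((\<lambda>s. ?k (?c s) * f (?F (?c s))) has_vector_derivative
          frechet_derivative (\<lambda>p. ?k p * f (?F p)) (at p) (br2 br p (diag \<zeta>))) (at 0)"
        unfolding c0 v .
      have "f differentiable (at (Ad (E (0 *\<^sub>R (- \<zeta>))) (?F p)))"
        by (rule smooth_on_differentiable[OF True UNIV_I])
      from has_derivative_along_curve[OF this Ad_curve_deriv]
      have "((\<lambda>s. f (Ad (E (s *\<^sub>R (- \<zeta>))) (?F p))) has_vector_derivative
          frechet_derivative f (at (?F p)) (br (- \<zeta>) (?F p))) (at 0)"
        by (simp add: E_0 Ad_e)
      also have "br (- \<zeta>) (?F p) = br (?F p) \<zeta>" using br_skew[of "?F p" \<zeta>] by (simp add: B.minus_left)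
      finally have D2: "((\<lambda>s. ?k p * f (Ad (E (s *\<^sub>R (- \<zeta>))) (?F p))) has_vector_derivative ?k p * ?Xf (?F p)) (at 0)"
        by (rule has_vector_derivative_mult_right)
      show ?thesis
        by (rule has_vector_derivative_eventually_unique[OF D1 D2])
          (use eventually_Phi_t_kappa_t[OF p t, of "- \<zeta>"] in \<open>auto elim!: eventually_mono simp: E_0 Ad_e\<close>)
    qed
    then have "u (\<lambda>p. frechet_derivative (\<lambda>p. ?k p * f (?F p)) (at p) (br2 br p (diag \<zeta>))) = u (\<lambda>p. ?k p * ?Xf (?F p))"
      by (rule smooth_functional_cong[OF u openW])
    then show ?thesis
      using True sXf comp[OF True] comp[OF sXf] sk
      by (simp add: m_map_def dist_push_def dist_mult_def ad_lie_def dist_lie_def)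
  qed
qed

end

section \<open>Equivariant functions and the two evolution equations\<close>

lemma bilinear_br2:
  fixes br :: "'a::euclidean_space \<Rightarrow> 'a \<Rightarrow> 'a"
  assumes "bilinear br"
  shows "bilinear (br2 br)"
proof -
  interpret bounded_bilinear br using assms bilinear_conv_bounded_bilinear by blast
  show ?thesis
    unfolding bilinear_def br2_def
    by (auto intro!: linearI simp: add_left add_right scaleR_left scaleR_right)
qed

lemma has_vector_derivative_difference_quotient:
  fixes f :: "real \<Rightarrow> 'b::real_normed_vector"
  assumes "(f has_vector_derivative D) (at 0)"
  shows "((\<lambda>s. (1 / s) *\<^sub>R (f s - f 0)) \<longlongrightarrow> D) (at 0)"
proof -
  have "((\<lambda>s. norm (f (0 + s) - f 0 - s *\<^sub>R D) / norm s) \<longlongrightarrow> 0) (at 0)"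
    using assms unfolding has_vector_derivative_def has_derivative_at by blast
  then have "((\<lambda>s. norm ((1 / s) *\<^sub>R (f s - f 0) - D)) \<longlongrightarrow> 0) (at 0)"
  proof (rule Lim_transform_eventually)
    show "\<forall>\<^sub>F s in at 0. norm (f (0 + s) - f 0 - s *\<^sub>R D) / norm s = norm ((1 / s) *\<^sub>R (f s - f 0) - D)"
    proof (rule eventually_at_filter[THEN iffD2], rule always_eventually, intro allI impI)
      fix s :: real assume "s \<noteq> 0"
      then have "(1 / s) *\<^sub>R (f s - f 0) - D = (1 / s) *\<^sub>R (f s - f 0 - s *\<^sub>R D)"
        by (simp add: algebra_simps)
      then show "norm (f (0 + s) - f 0 - s *\<^sub>R D) / norm s = norm ((1 / s) *\<^sub>R (f s - f 0) - D)"
        by simp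
    qed
  qed
  then show ?thesis using tendsto_norm_zero_iff LIM_zero_iff by blast
qed

context lie_group_exp_domain
begin

lemma bounded_bilinear_br2: "bounded_bilinear (br2 br)"
  using bilinear_br2[OF bilinear_br] bilinear_conv_bounded_bilinear by blast

lemma br2_skew: "br2 br p q = - br2 br q p"
  unfolding br2_def using br_skew[of "fst p" "fst q"] br_skew[of "snd p" "snd q"] by simp

lemma zero_W: "0 \<in> W"
  using starO by (simp add: star_nbhd_0_def zero_prod_def)

context
  fixes \<beta> :: "(real^'n) \<times> (real^'n) \<Rightarrow> (real^'n) \<times> (real^'n)"
  assumes sb: "smooth_on W \<beta>" and b0: "\<beta> (0, 0) = (0, 0)" and eq: "diag_equivariant br W \<beta>"
begin

text \<open>As \<open>\<beta>\<close> vanishes at the origin, these are its difference quotients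
  along \<open>p\<close>; hence the limit in \<open>rescale\<close> exists and is the linear part of
  \<open>\<beta>\<close>.\<close>

lemma rescale_tendsto:
  "((\<lambda>s. (1 / s) *\<^sub>R \<beta> (s *\<^sub>R p)) \<longlongrightarrow> frechet_derivative \<beta> (at 0) p) (at_right 0)"
proof -
  have "\<beta> differentiable (at (0 *\<^sub>R p))"
    using smooth_on_differentiable[OF sb zero_W] by simp
  then have "((\<lambda>s. \<beta> (s *\<^sub>R p)) has_vector_derivative frechet_derivative \<beta> (at (0 *\<^sub>R p)) p) (at 0)"
    by (rule has_derivative_along_curve)
      (auto simp: has_vector_derivative_def intro!: derivative_eq_intros)
  from has_vector_derivative_difference_quotient[OF this]
  have "((\<lambda>s. (1 / s) *\<^sub>R \<beta> (s *\<^sub>R p)) \<longlongrightarrow> frechet_derivative \<beta> (at 0) p) (at 0)"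
    using b0 by (simp flip: zero_prod_def)
  then show ?thesis by (rule tendsto_within_subset) simp
qed

lemma rescale_0: "rescale \<beta> 0 = frechet_derivative \<beta> (at 0)"
  unfolding rescale_def using tendsto_Lim[OF _ rescale_tendsto] by (auto simp: fun_eq_iff)

text \<open>Equivariance at the point t p, divided by t. The left side is the derivative of
  \<open>rescale \<beta> t\<close> at \<open>p\<close>, since the factors t and 1/t cancel, and in
  this form it has a limit as t tends to 0.\<close>

lemma equivariant_scaled:
  assumes "p \<in> W" "0 < t" "t \<le> 1"
  shows "frechet_derivative \<beta> (at (t *\<^sub>R p)) (br2 br (diag \<zeta>) p) = br2 br (diag \<zeta>) ((1 / t) *\<^sub>R \<beta> (t *\<^sub>R p))"
proof -
  interpret B: bounded_bilinear "br2 br" by (rule bounded_bilinear_br2)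
  have W: "t *\<^sub>R p \<in> W" using scale_W[OF assms(1)] assms by simp
  have L: "linear (frechet_derivative \<beta> (at (t *\<^sub>R p)))"
    by (rule linear_frechet_derivative[OF smooth_on_differentiable[OF sb W]])
  have "t *\<^sub>R frechet_derivative \<beta> (at (t *\<^sub>R p)) (br2 br (diag \<zeta>) p) = br2 br (diag \<zeta>) (\<beta> (t *\<^sub>R p))"
    using eq[unfolded diag_equivariant_def, rule_format, OF W, of \<zeta>]
    by (simp only: linear_cmul[OF L] B.scaleR_right)
  then have "(1 / t) *\<^sub>R (t *\<^sub>R frechet_derivative \<beta> (at (t *\<^sub>R p)) (br2 br (diag \<zeta>) p)) =
      (1 / t) *\<^sub>R br2 br (diag \<zeta>) (\<beta> (t *\<^sub>R p))" by simp
  then show ?thesis using assms(2) by (simp add: B.scaleR_right)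
qed

lemma equivariant_0:
  assumes p: "p \<in> W"
  shows "frechet_derivative \<beta> (at 0) (br2 br (diag \<zeta>) p) = br2 br (diag \<zeta>) (frechet_derivative \<beta> (at 0) p)"
proof (rule tendsto_unique[of "at_right (0::real)"])
  let ?v = "br2 br (diag \<zeta>) p"
  show "((\<lambda>s. br2 br (diag \<zeta>) ((1 / s) *\<^sub>R \<beta> (s *\<^sub>R p))) \<longlongrightarrow> br2 br (diag \<zeta>) (frechet_derivative \<beta> (at 0) p)) (at_right 0)"
    by (rule bounded_linear.tendsto[OF bounded_bilinear.bounded_linear_right[OF bounded_bilinear_br2] rescale_tendsto])
  have "isCont (\<lambda>q. frechet_derivative \<beta> (at q) ?v) 0"
    using smooth_on_differentiable[OF smooth_on_frechet_derivative[OF sb] zero_W]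
    by (rule differentiable_imp_continuous_within)
  moreover have "((\<lambda>s. s *\<^sub>R p) \<longlongrightarrow> 0) (at_right (0::real))"
    by (intro tendsto_eq_intros) auto
  ultimately have "((\<lambda>s. frechet_derivative \<beta> (at (s *\<^sub>R p)) ?v) \<longlongrightarrow> frechet_derivative \<beta> (at 0) ?v) (at_right 0)"
    by (rule isCont_tendsto_compose)
  moreover have "\<forall>\<^sub>F s in at_right (0::real). s \<in> {0<..<1}"
    by (rule eventually_at_right_real) simp
  then have "\<forall>\<^sub>F s in at_right (0::real). frechet_derivative \<beta> (at (s *\<^sub>R p)) ?v = br2 br (diag \<zeta>) ((1 / s) *\<^sub>R \<beta> (s *\<^sub>R p))"
    by eventually_elim (rule equivariant_scaled[OF p], auto)
  ultimately show "((\<lambda>s. br2 br (diag \<zeta>) ((1 / s) *\<^sub>R \<beta> (s *\<^sub>R p))) \<longlongrightarrow> frechet_derivative \<beta> (at 0) ?v) (at_right 0)"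
    by (rule Lim_transform_eventually)
qed simp

lemma smooth_rescale:
  assumes t: "0 \<le> t" "t \<le> 1"
  shows "smooth_on W (rescale \<beta> t)"
proof (cases "t = 0")
  case True
  have "bounded_linear (frechet_derivative \<beta> (at 0))"
    using smooth_on_has_derivative[OF sb zero_W] by (rule has_derivative_bounded_linear)
  then show ?thesis unfolding True rescale_0 by (rule bounded_linear_smooth_on[OF _ openW])
next
  case False
  then have "rescale \<beta> t = (\<lambda>p. (1 / t) *\<^sub>R \<beta> (t *\<^sub>R p))" by (auto simp: rescale_def fun_eq_iff)
  then show ?thesis
    using smooth_scale[OF smooth_on_compose[OF openW openW _ smooth_scale[OF smooth_on_ident openW] sb] openW]
      scale_W[OF _ t] by auto
qed

lemma equivariant_rescale:
  assumes t: "0 \<le> t" "t \<le> 1" and p: "p \<in> W"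
  shows "frechet_derivative (rescale \<beta> t) (at p) (br2 br p (diag \<zeta>)) = br2 br (rescale \<beta> t p) (diag \<zeta>)"
proof -
  have "frechet_derivative (rescale \<beta> t) (at p) (br2 br (diag \<zeta>) p) = br2 br (diag \<zeta>) (rescale \<beta> t p)"
  proof (cases "t = 0")
    case True
    have "bounded_linear (frechet_derivative \<beta> (at 0))"
      using smooth_on_has_derivative[OF sb zero_W] by (rule has_derivative_bounded_linear)
    then have "(rescale \<beta> t has_derivative rescale \<beta> t) (at p)"
      unfolding True rescale_0 by (rule bounded_linear_imp_has_derivative)
    from frechet_derivative_at[OF this] show ?thesis
      using equivariant_0[OF p] unfolding True rescale_0 by simp
  next
    case False
    then have r: "rescale \<beta> t = (\<lambda>p. (1 / t) *\<^sub>R \<beta> (t *\<^sub>R p))" by (auto simp: rescale_def fun_eq_iff)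
    note d = smooth_on_has_derivative[OF sb scale_W[OF p t]]
    have "((\<beta> \<circ> (\<lambda>p. t *\<^sub>R p)) has_derivative (frechet_derivative \<beta> (at (t *\<^sub>R p)) \<circ> (\<lambda>h. t *\<^sub>R h))) (at p)"
      by (rule diff_chain_at[of "\<lambda>p. t *\<^sub>R p", OF _ d]) (auto intro!: derivative_eq_intros)
    from has_derivative_scaleR_right[OF this, of "1 / t"]
    have "(rescale \<beta> t has_derivative (\<lambda>h. (1 / t) *\<^sub>R frechet_derivative \<beta> (at (t *\<^sub>R p)) (t *\<^sub>R h))) (at p)"
      unfolding r by (simp add: o_def)
    note D = frechet_derivative_at[OF this, symmetric]
    have "frechet_derivative (rescale \<beta> t) (at p) h = frechet_derivative \<beta> (at (t *\<^sub>R p)) h" for h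
      unfolding D linear_cmul[OF has_derivative_linear[OF d]] using False by simp
    then show ?thesis using equivariant_scaled[OF p] t False unfolding r by simp
  qed
  \<comment> \<open>Reversing both brackets changes both signs and gives the order used in the field
    of the action.\<close>
  then show ?thesis
    using linear_neg[OF linear_frechet_derivative[OF smooth_on_differentiable[OF smooth_rescale[OF t] p]]]
      br2_skew[of p "diag \<zeta>"] br2_skew[of "rescale \<beta> t p" "diag \<zeta>"] by simp
qed

end

lemma m_map_plus: "m_map br mul E U Ob t (u + v) = m_map br mul E U Ob t u + m_map br mul E U Ob t v"
  by (auto simp: m_map_def dist_push_def dist_mult_def fun_eq_iff)

lemma m_map_scaleR: "m_map br mul E U Ob t (r *\<^sub>R u) = r *\<^sub>R m_map br mul E U Ob t u"
  by (auto simp: m_map_def dist_push_def dist_mult_def fun_eq_iff scaleR_fun_def)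

lemma m_map_sum: "m_map br mul E U Ob t (\<Sum>i\<in>I. u i) = (\<Sum>i\<in>I. m_map br mul E U Ob t (u i))"
  by (auto simp: m_map_def dist_push_def dist_mult_def fun_eq_iff sum_fun_apply)

text \<open>The diagonal embedding respects brackets, and \<open>m_map\<close> intertwines the two
  actions by \<open>m_map_ad_lie\<close>. The hypothesis on \<open>\<eta>\<close> concerns its
  values only, so the statement applies directly to contracted cochains.\<close>

lemma M_map_chain_map:
  assumes t: "0 \<le> t" "t \<le> 1" and \<eta>: "\<And>xs. smooth_functional W (\<eta> xs)"
  shows "M_map br mul E U Ob t (ce_d_dist (br2 br) W \<eta>) zs = ce_d_dist br UNIV (M_map br mul E U Ob t \<eta>) zs"
proof -
  have d: "br2 br (diag a) (diag b) = diag (br a b)" for a b by (simp add: br2_def diag_def)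
  have nth: "map diag zs ! i = diag (zs ! i)" if "i < length zs" for i using that by simp
  have "M_map br mul E U Ob t (ce_d_dist (br2 br) W \<eta>) zs =
     (\<Sum>i<length zs. (-1) ^ i *\<^sub>R m_map br mul E U Ob t (ad_lie (br2 br) W (map diag zs ! i) (\<eta> (map diag (nths zs (- {i})))))) +
     (\<Sum>j<length zs. \<Sum>i<j. (-1) ^ (i + j) *\<^sub>R m_map br mul E U Ob t
       (\<eta> (br2 br (map diag zs ! i) (map diag zs ! j) # map diag (nths zs (- {i, j})))))"
    unfolding M_map_def ce_d_dist_def ce_d_def
    by (simp only: m_map_plus m_map_sum m_map_scaleR nths_map length_map)
  also have "\<dots> =
     (\<Sum>i<length zs. (-1) ^ i *\<^sub>R ad_lie br UNIV (zs ! i) (m_map br mul E U Ob t (\<eta> (map diag (nths zs (- {i})))))) +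
     (\<Sum>j<length zs. \<Sum>i<j. (-1) ^ (i + j) *\<^sub>R m_map br mul E U Ob t
       (\<eta> (map diag (br (zs ! i) (zs ! j) # nths zs (- {i, j})))))"
    by (intro arg_cong2[of _ _ _ _ "(+)"] sum.cong refl) (simp_all add: nth d m_map_ad_lie[OF \<eta> t])
  finally show ?thesis
    unfolding M_map_def ce_d_dist_def ce_d_def .
qed

end

theorem mainTheorem2:
  fixes br :: "real^'n \<Rightarrow> real^'n \<Rightarrow> real^'n"
    and A :: "('g::{t2_space,second_countable_topology} set \<times> ('g \<Rightarrow> real^'n)) set"
    and mul :: "'g \<Rightarrow> 'g \<Rightarrow> 'g" and e :: 'g and iv :: "'g \<Rightarrow> 'g"
    and lf :: "real^'n \<Rightarrow> ('g \<Rightarrow> real) \<Rightarrow> 'g \<Rightarrow> real"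
    and E :: "real^'n \<Rightarrow> 'g"
    and U Ob :: "(real^'n) set"
    and B :: "((real^'n) \<times> (real^'n)) set"
    and \<beta> :: "(real^'n) \<times> (real^'n) \<Rightarrow> (real^'n) \<times> (real^'n)"
  assumes "lie_algebra br"
    and "lie_group A mul e iv"
    and "connected (UNIV :: 'g set)" and "simply_connected (UNIV :: 'g set)"
    and "lie_algebra_of_group br A mul lf"
    and "lie_exp A e lf E"
    and "star_nbhd_0 U" and "diffeo_onto_image A U E"
    and "star_nbhd_0 Ob" and "Ob \<subseteq> U"
    and "\<forall>x\<in>Ob. \<forall>y\<in>Ob. mul (E x) (E y) \<in> E ` U"
    and "independent B" and "span B = UNIV"
    and "smooth_on (Ob \<times> Ob) \<beta>" and "\<beta> (0, 0) = (0, 0)"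
    and "diag_equivariant br (Ob \<times> Ob) \<beta>"
  shows
    "((\<forall>t\<in>{0..1}. \<forall>u\<in>comp_distributions (Ob \<times> Ob).
         has_dist_derivative (\<lambda>s. m_map br mul E U Ob s u)
           (- m_map br mul E U Ob t (lie_along (br2 br) (Ob \<times> Ob) B (rescale \<beta> t) u)) t)
      \<longleftrightarrow>
      (\<forall>t\<in>{0..1}. \<forall>\<omega>\<in>ce_cochains (comp_distributions (Ob \<times> Ob)). \<forall>zs.
         has_dist_derivative (\<lambda>s. M_map br mul E U Ob s \<omega> zs)
           (- M_map br mul E U Ob t
               (d_commutator (ce_d_dist (br2 br) (Ob \<times> Ob)) (ce_d_dist (br2 br) (Ob \<times> Ob))
                  (contraction (Ob \<times> Ob) B (rescale \<beta> t)) \<omega>) zs) t))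
     \<and>
     ((\<forall>t\<in>{0..1}. \<forall>\<omega>\<in>ce_cochains (comp_distributions (Ob \<times> Ob)). \<forall>zs.
         has_dist_derivative (\<lambda>s. M_map br mul E U Ob s \<omega> zs)
           (- M_map br mul E U Ob t
               (d_commutator (ce_d_dist (br2 br) (Ob \<times> Ob)) (ce_d_dist (br2 br) (Ob \<times> Ob))
                  (contraction (Ob \<times> Ob) B (rescale \<beta> t)) \<omega>) zs) t)
      \<longleftrightarrow>
      (\<forall>t\<in>{0..1}. \<forall>\<omega>\<in>ce_cochains (comp_distributions (Ob \<times> Ob)). \<forall>zs.
         has_dist_derivative (\<lambda>s. M_map br mul E U Ob s \<omega> zs)
           (- d_commutator (ce_d_dist (br2 br) (Ob \<times> Ob)) (ce_d_dist br UNIV)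
                (\<lambda>\<eta>. M_map br mul E U Ob t (contraction (Ob \<times> Ob) B (rescale \<beta> t) \<eta>)) \<omega> zs) t))"
proof -
  interpret lie_group_exp_domain br A mul e iv lf E U Ob
    using assms by unfold_locales
  let ?W = "Ob \<times> Ob"
  let ?D = "comp_distributions ?W"
  let ?m = "m_map br mul E U Ob" and ?M = "M_map br mul E U Ob"
  let ?d2 = "ce_d_dist (br2 br) ?W"
  let ?\<iota> = "\<lambda>t. contraction ?W B (rescale \<beta> t)"
  have \<beta>: "smooth_on ?W \<beta>" "\<beta> (0, 0) = (0, 0)" "diag_equivariant br ?W \<beta>" by fact+
  have sf: "smooth_functional ?W u" if "u \<in> ?D" for u
    using smooth_functional_comp_distribution[OF that openW] .
  have sb: "smooth_on ?W (rescale \<beta> t)" if "t \<in> {0..1}" for t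
    using smooth_rescale[OF \<beta>] that by simp
  \<comment> \<open>The pullback along the diagonal feeds the commutator only diagonal arguments,
    where it equals the Lie derivative along beta_t of the value of the cochain.\<close>
  have commutator: "?M t (d_commutator ?d2 ?d2 (?\<iota> t) \<omega>) zs = ?m t (lie_along (br2 br) ?W B (rescale \<beta> t) (\<omega> (map diag zs)))"
    if t: "t \<in> {0..1}" and \<omega>: "\<omega> \<in> ce_cochains ?D" for t \<omega> zs
  proof -
    have "d_commutator ?d2 ?d2 (?\<iota> t) \<omega> (map diag zs) = lie_along (br2 br) ?W B (rescale \<beta> t) (\<omega> (map diag zs))"
      by (rule d_commutator_contraction[OF bilinear_br2[OF bilinear_br] openW \<open>independent B\<close> \<open>span B = UNIV\<close> sb[OF t] _ \<omega> sf])
        (use equivariant_rescale[OF \<beta>] t in auto)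
    then show ?thesis by (simp add: M_map_def)
  qed
  \<comment> \<open>\<open>M_map\<close> is moved past the differential in the summand d iota; the
    other summand, iota d, is the same on both sides.\<close>
  have chain: "?M t (d_commutator ?d2 ?d2 (?\<iota> t) \<omega>) zs =
      d_commutator ?d2 (ce_d_dist br UNIV) (\<lambda>\<eta>. ?M t (?\<iota> t \<eta>)) \<omega> zs"
    if t: "t \<in> {0..1}" and \<omega>: "\<omega> \<in> ce_cochains ?D" for t \<omega> zs
  proof -
    have "bounded_linear (\<lambda>v. representation B v \<xi>)" for \<xi>
      using representation_linear[OF \<open>independent B\<close> \<open>span B = UNIV\<close>] linear_conv_bounded_linear by blast
    then have "smooth_on ?W (\<lambda>p. representation B (rescale \<beta> t p) \<xi>)" for \<xi>
      by (rule smooth_on_linear[OF _ openW sb[OF t]])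
    moreover have "smooth_functional ?W (\<omega> xs)" for xs
      using \<omega> sf unfolding ce_cochains_def by blast
    ultimately have "smooth_functional ?W (?\<iota> t \<omega> xs)" for xs
      unfolding contraction_def
      by (intro smooth_functional_sum_functionals smooth_functional_dist_mult[OF openW])
    then have "?M t (?d2 (?\<iota> t \<omega>)) zs = ce_d_dist br UNIV (?M t (?\<iota> t \<omega>)) zs"
      by (rule M_map_chain_map[rotated 2]) (use t in auto)
    moreover have "?M t (d_commutator ?d2 ?d2 (?\<iota> t) \<omega>) zs = ?M t (?d2 (?\<iota> t \<omega>)) zs + ?M t (?\<iota> t (?d2 \<omega>)) zs"
      unfolding M_map_def d_commutator_def plus_fun_apply m_map_plus[symmetric] by (simp add: plus_fun_def)
    ultimately show ?thesis by (simp add: d_commutator_def)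
  qed
  \<comment> \<open>A distribution as a cochain concentrated in degree 0. On the empty list of
    arguments M_t reduces to m_t, so the equation for M_t there is the one for m_t.\<close>
  have degree_0: "(\<lambda>xs. if xs = [] then u else 0) \<in> ce_cochains ?D" if u: "u \<in> ?D" for u
  proof -
    have "0 \<in> ?D" unfolding comp_distributions_def by (auto intro!: exI[of _ "{}"] exI[of _ "0::real"])
    moreover have "linear (\<lambda>v. if xs[i := v] = [] then u else 0)" if "i < length xs" for xs :: "((real^'n) \<times> (real^'n)) list" and i
      using that by (auto intro!: linearI)
    ultimately show ?thesis using u unfolding ce_cochains_def by (auto intro!: linearI)
  qed
  show ?thesis
  proof (intro conjI iffI ballI allI, goal_cases)
    case (1 t \<omega> zs)
    \<comment> \<open>For fixed arguments, the equation for M_t is the equation for m_t at this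
      single distribution.\<close>
    then have "\<omega> (map diag zs) \<in> ?D" unfolding ce_cochains_def by blast
    with 1 show ?case unfolding commutator[OF 1(2,3)] by (simp add: M_map_def)
  next
    case (2 t u)
    have "has_dist_derivative (\<lambda>s. ?M s (\<lambda>xs. if xs = [] then u else 0) [])
        (- ?M t (d_commutator ?d2 ?d2 (?\<iota> t) (\<lambda>xs. if xs = [] then u else 0)) []) t"
      using 2(1)[rule_format, OF 2(2) degree_0[OF 2(3)]] .
    then show ?case unfolding commutator[OF 2(2) degree_0[OF 2(3)]] by (simp add: M_map_def)
  next
    case (3 t \<omega> zs)
    from 3(1)[rule_format, OF 3(2,3), of zs] show ?case unfolding chain[OF 3(2,3)] .
  next
    case (4 t \<omega> zs)
    from 4(1)[rule_format, OF 4(2,3), of zs] show ?case unfolding chain[OF 4(2,3)] .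
  qed
qed

end
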